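(* Let $\mathbb K$ be a commutative unital ring in which $2$ is invertible. Let $(G_i,d_i,Z_i)$, $i=1,2$, be two centrally $\mathbb Z/2\mathbb Z$-graded groups with non-trivial grading elements $Z_i$, and let $G=G_1\widehat\times_Z G_2$. Then the algebras $\mathbb K[G]^\pm$ are given in terms of ungraded, respectively graded, tensor products of algebras by $$\mathbb K[G]^+\cong\mathbb K[G_1]^+\otimes\mathbb K[G_2]^+,\qquad\mathbb K[G]^-\cong\mathbb K[G_1]^-\,\widehat\otimes\,\mathbb K[G_2]^-.$$ In particular, for $\mathbf t\in\{1,Z\}^n$, let $\underline{\mathrm{Cl}}(\mathbf t)$ be the Clifford algebra of $\mathbb K^n$ for the diagonal quadratic form with $i$-th coefficient $1$ if $t_i=1$ and $-1$ if $t_i=Z$. Then $$\mathbb K[Q(\mathbf t)]^+\cong\mathbb K[\mathcal P(\mathsf n)],\qquad\mathbb K[Q(\mathbf t)]^-\cong\underline{\mathrm{Cl}}(\mathbf t)$$ as algebras. In particular, $\mathbb K[Q_{p,q}]^-\cong\mathrm{Cl}_{p,q}(\mathbb K)$.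
   Context: A centrally $\mathbb Z/2\mathbb Z$-graded group is a group $G$ with a morphism $d:G\to\mathbb Z/2\mathbb Z$ and a central element $Z$ (grading element) with $Z^2=e$, $d(Z)=0$. The graded product $G_1\widehat\times_Z G_2$ is the quotient set of $G_1\times G_2$ by $(Z_1g_1,g_2)\sim(g_1,Z_2g_2)$, with classes $[g_1,g_2]$, group law $[g_1,g_2][h_1,h_2]=Z^{d(h_1)d(g_2)}[g_1h_1,g_2h_2]$, where $Z=[Z_1,1]=[1,Z_2]$ is its grading element, and grading $d([g_1,g_2])=d(g_1)+d(g_2)$; this product is associative. $\mathbb K[G]$ is the group algebra with basis $(\delta_g)_{g\in G}$; $\mathbb K[G]^\pm=\{f\in\mathbb K[G]\mid Z_*f=\pm f\}$ where $Z_*\delta_g=\delta_{Zg}$; these are ideals, each regarded as an algebra, and $\mathbb Z/2\mathbb Z$-graded as follows: the degree-$k$ part is $\{f\mid\alpha_*f=(-1)^kf\}$, $k\in\{0,1\}$, where $\alpha_*\delta_g=\delta_{Z^{d(g)}g}$. The graded tensor product $\mathbb A\widehat\otimes\mathbb B$ of $\mathbb Z/2\mathbb Z$-graded algebras is the tensor product module with product $(a\otimes b)(a'\otimes b')=(-1)^{|b||a'|}aa'\otimes bb'$ for homogeneous elements. $Q(1)$ is the set $(\mathbb Z/2\mathbb Z)^2$ with $(x_0,x_1)(y_0,y_1)=(x_0+y_0,x_1+y_1)$, and $Q(Z)$ is the same set with $(x_0,x_1)(y_0,y_1)=(x_0+y_0+x_1y_1,x_1+y_1)$; both have $d(x_0,x_1)=x_1$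 and $Z=(1,0)$. For $\mathbf t\in\{1,Z\}^n$, $Q(\mathbf t)=Q(t_1)\widehat\times_Z\cdots\widehat\times_Z Q(t_n)$; $Q_{p,q}=Q(1,\dots,1,Z,\dots,Z)$ with $p$ entries $1$ and $q$ entries $Z$. $\mathcal P(\mathsf n)$ is the power set of $\{1,\dots,n\}$, a group under symmetric difference. The Clifford algebra of a quadratic space $(V,q)$ is the universal unital associative algebra with a linear map $j:V\to\mathrm{Cl}(V,q)$ satisfying $j(v)^2=q(v)1$; $\mathrm{Cl}_{p,q}(\mathbb K)$ is that of $\mathbb K^{p+q}$ with diagonal form with $p$ coefficients $1$ followed by $q$ coefficients $-1$. *)

theory Defs
  imports "HOL-Algebra.Elementary_Groups" "HOL-Algebra.QuotRing" "HOL-Algebra.Module" "HOL-Library.FSet"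
begin

section \<open>Centrally graded groups and their graded product\<close>

text \<open>The group \<open>\<int>/2\<int>\<close> is \<open>integer_mod_group 2\<close>, whose elements are the integers 0 and 1.\<close>

record 'a graded_group = "'a monoid" +
  gdeg :: "'a \<Rightarrow> int"
  gelt :: "'a"

locale centrally_graded_group = group G for G :: "('a, 'm) graded_group_scheme" (structure) +
  assumes gdeg_hom: "gdeg G \<in> hom G (integer_mod_group 2)"
    and gelt_closed: "gelt G \<in> carrier G"
    and gelt_central: "x \<in> carrier G \<Longrightarrow> gelt G \<otimes> x = x \<otimes> gelt G"
    and gelt_square: "gelt G \<otimes> gelt G = \<one>"
    and gdeg_gelt: "gdeg G (gelt G) = 0"

definition gprod_rel ::
  "('a, 'm) graded_group_scheme \<Rightarrow> ('b, 'n) graded_group_scheme \<Rightarrow> (('a \<times> 'b) \<times> ('a \<times> 'b)) set" where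
  "gprod_rel G1 G2 =
     {((gelt G1 \<otimes>\<^bsub>G1\<^esub> x, y), (x, gelt G2 \<otimes>\<^bsub>G2\<^esub> y)) | x y. x \<in> carrier G1 \<and> y \<in> carrier G2}"

text \<open>The class of a pair for the equivalence relation generated by \<^const>\<open>gprod_rel\<close>.\<close>

definition gcls ::
  "('a, 'm) graded_group_scheme \<Rightarrow> ('b, 'n) graded_group_scheme \<Rightarrow> 'a \<times> 'b \<Rightarrow> ('a \<times> 'b) set" where
  "gcls G1 G2 p = (gprod_rel G1 G2 \<union> (gprod_rel G1 G2)\<inverse>)\<^sup>* `` {p}"

text \<open>In the product, the power of the grading element acts through the first factor, as
  \<open>Z[a, b] = [Z\<^sub>1 a, b]\<close>.\<close>

definition graded_product ::
  "('a, 'm) graded_group_scheme \<Rightarrow> ('b, 'n) graded_group_scheme \<Rightarrow> ('a \<times> 'b) set graded_group" where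
  "graded_product G1 G2 =
     \<lparr>carrier = gcls G1 G2 ` (carrier G1 \<times> carrier G2),
      monoid.mult = (\<lambda>X Y. \<Union>(g1, g2)\<in>X. \<Union>(h1, h2)\<in>Y.
         gcls G1 G2 (gelt G1 [^]\<^bsub>G1\<^esub> (gdeg G1 h1 * gdeg G2 g2) \<otimes>\<^bsub>G1\<^esub> (g1 \<otimes>\<^bsub>G1\<^esub> h1), g2 \<otimes>\<^bsub>G2\<^esub> h2)),
      one = gcls G1 G2 (\<one>\<^bsub>G1\<^esub>, \<one>\<^bsub>G2\<^esub>),
      gdeg = (\<lambda>X. the_elem ((\<lambda>(g1, g2). (gdeg G1 g1 + gdeg G2 g2) mod 2) ` X)),
      gelt = gcls G1 G2 (gelt G1, \<one>\<^bsub>G2\<^esub>)\<rparr>"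


section \<open>The groups \<open>Q(t)\<close>\<close>

datatype one_or_Z = One | Zed

definition Q1 :: "one_or_Z \<Rightarrow> (int \<times> int) graded_group" where
  "Q1 t =
     \<lparr>carrier = {0, 1} \<times> {0, 1},
      monoid.mult = (\<lambda>(x0, x1) (y0, y1).
         case t of One \<Rightarrow> ((x0 + y0) mod 2, (x1 + y1) mod 2)
                 | Zed \<Rightarrow> ((x0 + y0 + x1 * y1) mod 2, (x1 + y1) mod 2)),
      one = (0, 0),
      gdeg = snd,
      gelt = (1, 0)\<rparr>"

text \<open>Each graded product raises the type of the elements. To have all \<open>Q(t)\<close> over the same type, the
  classes, which are finite sets here, are wrapped in a recursive datatype.\<close>

datatype q_elt = Base "int \<times> int" | Class "((int \<times> int) \<times> q_elt) fset"

definition transport_graded_group ::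
  "('a \<Rightarrow> 'b) \<Rightarrow> ('a, 'm) graded_group_scheme \<Rightarrow> 'b graded_group" where
  "transport_graded_group f G =
     \<lparr>carrier = f ` carrier G,
      monoid.mult = (\<lambda>x y. f (inv_into (carrier G) f x \<otimes>\<^bsub>G\<^esub> inv_into (carrier G) f y)),
      one = f \<one>\<^bsub>G\<^esub>,
      gdeg = (\<lambda>x. gdeg G (inv_into (carrier G) f x)),
      gelt = f (gelt G)\<rparr>"

text \<open>The iterated product is bracketed to the right. The empty product is the unit of the graded
  product, the group \<open>{1, Z}\<close> in degree 0.\<close>

fun Q :: "one_or_Z list \<Rightarrow> q_elt graded_group" where
  "Q [] = transport_graded_group Base ((Q1 One)\<lparr>carrier := {0, 1} \<times> {0}\<rparr>)"
| "Q [t] = transport_graded_group Base (Q1 t)"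
| "Q (t # u # ts) =
     transport_graded_group (\<lambda>X. Class (Abs_fset X)) (graded_product (Q1 t) (Q (u # ts)))"

definition Qpq :: "nat \<Rightarrow> nat \<Rightarrow> q_elt graded_group" where
  "Qpq p q = Q (replicate p One @ replicate q Zed)"

definition power_set_group :: "nat \<Rightarrow> nat set monoid" where
  "power_set_group n = \<lparr>carrier = Pow {1..n}, monoid.mult = sym_diff, one = {}\<rparr>"


section \<open>Free modules and algebras\<close>

text \<open>The library locale \<^locale>\<open>algebra\<close> is for commutative algebras only.\<close>

locale assoc_algebra = module K A + ring A for K (structure) and A (structure) +
  assumes smult_mult_left: "\<lbrakk>c \<in> carrier K; x \<in> carrier A; y \<in> carrier A\<rbrakk>
      \<Longrightarrow> (c \<odot>\<^bsub>A\<^esub> x) \<otimes>\<^bsub>A\<^esub> y = c \<odot>\<^bsub>A\<^esub> (x \<otimes>\<^bsub>A\<^esub> y)"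
    and smult_mult_right: "\<lbrakk>c \<in> carrier K; x \<in> carrier A; y \<in> carrier A\<rbrakk>
      \<Longrightarrow> x \<otimes>\<^bsub>A\<^esub> (c \<odot>\<^bsub>A\<^esub> y) = c \<odot>\<^bsub>A\<^esub> (x \<otimes>\<^bsub>A\<^esub> y)"

definition linear_map ::
  "('k, 'm) ring_scheme \<Rightarrow> ('k, 'a, 'n) module_scheme \<Rightarrow> ('k, 'b, 'o) module_scheme \<Rightarrow> ('a \<Rightarrow> 'b) set" where
  "linear_map K V W = {f. f \<in> carrier V \<rightarrow> carrier W \<and>
     (\<forall>x\<in>carrier V. \<forall>y\<in>carrier V. f (x \<oplus>\<^bsub>V\<^esub> y) = f x \<oplus>\<^bsub>W\<^esub> f y) \<and>
     (\<forall>c\<in>carrier K. \<forall>x\<in>carrier V. f (c \<odot>\<^bsub>V\<^esub> x) = c \<odot>\<^bsub>W\<^esub> f x)}"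

definition algebra_hom ::
  "('k, 'm) ring_scheme \<Rightarrow> ('k, 'a, 'n) module_scheme \<Rightarrow> ('k, 'b, 'o) module_scheme \<Rightarrow> ('a \<Rightarrow> 'b) set" where
  "algebra_hom K A B = ring_hom A B \<inter> linear_map K A B"

definition algebra_isomorphic ::
  "('k, 'm) ring_scheme \<Rightarrow> ('k, 'a, 'n) module_scheme \<Rightarrow> ('k, 'b, 'o) module_scheme \<Rightarrow> bool" where
  "algebra_isomorphic K A B \<longleftrightarrow> (\<exists>h \<in> algebra_hom K A B. bij_betw h (carrier A) (carrier B))"

definition supp :: "('k, 'm) ring_scheme \<Rightarrow> ('x \<Rightarrow> 'k) \<Rightarrow> 'x set" where
  "supp K f = {x. f x \<noteq> \<zero>\<^bsub>K\<^esub>}"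

definition free_module :: "('k, 'm) ring_scheme \<Rightarrow> 'x set \<Rightarrow> ('k, 'x \<Rightarrow> 'k) module" where
  "free_module K X =
     \<lparr>carrier = {f. range f \<subseteq> carrier K \<and> supp K f \<subseteq> X \<and> finite (supp K f)},
      monoid.mult = undefined,
      one = undefined,
      zero = (\<lambda>x. \<zero>\<^bsub>K\<^esub>),
      add = (\<lambda>f g x. f x \<oplus>\<^bsub>K\<^esub> g x),
      smult = (\<lambda>c f x. c \<otimes>\<^bsub>K\<^esub> f x)\<rparr>"

definition delta :: "('k, 'm) ring_scheme \<Rightarrow> 'x \<Rightarrow> 'x \<Rightarrow> 'k" where
  "delta K x = (\<lambda>y. if y = x then \<one>\<^bsub>K\<^esub> else \<zero>\<^bsub>K\<^esub>)"

text \<open>The linear map on a free module with values \<open>\<phi> x\<close> on the basis, and the bilinear map with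
  values \<open>\<beta> x y\<close>.\<close>

definition lin_ext ::
  "('k, 'm) ring_scheme \<Rightarrow> ('k, 'a, 'n) module_scheme \<Rightarrow> ('x \<Rightarrow> 'a) \<Rightarrow> ('x \<Rightarrow> 'k) \<Rightarrow> 'a" where
  "lin_ext K M \<phi> f = (\<Oplus>\<^bsub>M\<^esub>x\<in>supp K f. f x \<odot>\<^bsub>M\<^esub> \<phi> x)"

definition bilin_ext ::
  "('k, 'm) ring_scheme \<Rightarrow> ('k, 'a, 'n) module_scheme \<Rightarrow> ('x \<Rightarrow> 'y \<Rightarrow> 'a)
     \<Rightarrow> ('x \<Rightarrow> 'k) \<Rightarrow> ('y \<Rightarrow> 'k) \<Rightarrow> 'a" where
  "bilin_ext K M \<beta> f g = lin_ext K M (\<lambda>x. lin_ext K M (\<beta> x) g) f"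

text \<open>The group algebra, defined for monoids because free algebras are obtained from it as well.\<close>

definition monoid_algebra ::
  "('k, 'm) ring_scheme \<Rightarrow> ('g, 'n) monoid_scheme \<Rightarrow> ('k, 'g \<Rightarrow> 'k) module" where
  "monoid_algebra K G = (let F = free_module K (carrier G) in
     F\<lparr>monoid.mult := bilin_ext K F (\<lambda>x y. delta K (x \<otimes>\<^bsub>G\<^esub> y)),
       one := delta K \<one>\<^bsub>G\<^esub>\<rparr>)"

definition pushforward ::
  "('k, 'm) ring_scheme \<Rightarrow> ('g, 'n) monoid_scheme \<Rightarrow> ('g \<Rightarrow> 'g) \<Rightarrow> ('g \<Rightarrow> 'k) \<Rightarrow> ('g \<Rightarrow> 'k)" where
  "pushforward K G \<phi> = lin_ext K (monoid_algebra K G) (\<lambda>x. delta K (\<phi> x))"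

definition quotient_algebra ::
  "('k, 'a, 'n) module_scheme \<Rightarrow> 'a set \<Rightarrow> ('k, 'a set) module" where
  "quotient_algebra A I =
     ring.extend (A Quot I) (module.fields (\<lambda>c X. \<Union>x\<in>X. I +>\<^bsub>A\<^esub> (c \<odot>\<^bsub>A\<^esub> x)))"


section \<open>The algebras \<open>K[G]\<^sup>\<plusminus>\<close>\<close>

text \<open>The unit of this ideal of \<open>K[G]\<close> is \<open>(\<delta>\<^sub>1 + s \<delta>\<^sub>Z) / 2\<close>.\<close>

definition sign_ideal ::
  "('k, 'm) ring_scheme \<Rightarrow> 'k \<Rightarrow> ('g, 'n) graded_group_scheme \<Rightarrow> ('k, 'g \<Rightarrow> 'k) module" where
  "sign_ideal K s G = (let A = monoid_algebra K G in
     A\<lparr>carrier := {f \<in> carrier A. pushforward K G (\<lambda>g. gelt G \<otimes>\<^bsub>G\<^esub> g) f = s \<odot>\<^bsub>A\<^esub> f},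
       one := inv\<^bsub>K\<^esub> (\<one>\<^bsub>K\<^esub> \<oplus>\<^bsub>K\<^esub> \<one>\<^bsub>K\<^esub>) \<odot>\<^bsub>A\<^esub> (delta K \<one>\<^bsub>G\<^esub> \<oplus>\<^bsub>A\<^esub> (s \<odot>\<^bsub>A\<^esub> delta K (gelt G)))\<rparr>)"

abbreviation group_algebra_plus ::
  "('k, 'm) ring_scheme \<Rightarrow> ('g, 'n) graded_group_scheme \<Rightarrow> ('k, 'g \<Rightarrow> 'k) module" where
  "group_algebra_plus K G \<equiv> sign_ideal K \<one>\<^bsub>K\<^esub> G"

abbreviation group_algebra_minus ::
  "('k, 'm) ring_scheme \<Rightarrow> ('g, 'n) graded_group_scheme \<Rightarrow> ('k, 'g \<Rightarrow> 'k) module" where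
  "group_algebra_minus K G \<equiv> sign_ideal K (\<ominus>\<^bsub>K\<^esub> \<one>\<^bsub>K\<^esub>) G"

definition sign_ideal_part ::
  "('k, 'm) ring_scheme \<Rightarrow> 'k \<Rightarrow> ('g, 'n) graded_group_scheme \<Rightarrow> nat \<Rightarrow> ('g \<Rightarrow> 'k) set" where
  "sign_ideal_part K s G k =
     {f \<in> carrier (sign_ideal K s G).
        pushforward K G (\<lambda>g. gelt G [^]\<^bsub>G\<^esub> gdeg G g \<otimes>\<^bsub>G\<^esub> g) f
          = ((\<ominus>\<^bsub>K\<^esub> \<one>\<^bsub>K\<^esub>) [^]\<^bsub>K\<^esub> k) \<odot>\<^bsub>monoid_algebra K G\<^esub> f}"

abbreviation group_algebra_minus_part ::
  "('k, 'm) ring_scheme \<Rightarrow> ('g, 'n) graded_group_scheme \<Rightarrow> nat \<Rightarrow> ('g \<Rightarrow> 'k) set" where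
  "group_algebra_minus_part K G \<equiv> sign_ideal_part K (\<ominus>\<^bsub>K\<^esub> \<one>\<^bsub>K\<^esub>) G"


section \<open>Tensor products\<close>

definition generated_submodule ::
  "('k, 'm) ring_scheme \<Rightarrow> ('k, 'a, 'n) module_scheme \<Rightarrow> 'a set \<Rightarrow> 'a set" where
  "generated_submodule K M S = \<Inter>{H. submodule H K M \<and> S \<subseteq> H}"

definition tensor_relations ::
  "('k, 'm) ring_scheme \<Rightarrow> ('k, 'a, 'n) module_scheme \<Rightarrow> ('k, 'b, 'o) module_scheme
     \<Rightarrow> ('a \<times> 'b \<Rightarrow> 'k) set" where
  "tensor_relations K A B = (let F = free_module K (carrier A \<times> carrier B) in
     {delta K (a \<oplus>\<^bsub>A\<^esub> a', b) \<ominus>\<^bsub>F\<^esub> (delta K (a, b) \<oplus>\<^bsub>F\<^esub> delta K (a', b)) | a a' b.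
        a \<in> carrier A \<and> a' \<in> carrier A \<and> b \<in> carrier B} \<union>
     {delta K (a, b \<oplus>\<^bsub>B\<^esub> b') \<ominus>\<^bsub>F\<^esub> (delta K (a, b) \<oplus>\<^bsub>F\<^esub> delta K (a, b')) | a b b'.
        a \<in> carrier A \<and> b \<in> carrier B \<and> b' \<in> carrier B} \<union>
     {delta K (c \<odot>\<^bsub>A\<^esub> a, b) \<ominus>\<^bsub>F\<^esub> (c \<odot>\<^bsub>F\<^esub> delta K (a, b)) | c a b.
        c \<in> carrier K \<and> a \<in> carrier A \<and> b \<in> carrier B} \<union>
     {delta K (a, c \<odot>\<^bsub>B\<^esub> b) \<ominus>\<^bsub>F\<^esub> (c \<odot>\<^bsub>F\<^esub> delta K (a, b)) | c a b.
        c \<in> carrier K \<and> a \<in> carrier A \<and> b \<in> carrier B})"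

text \<open>The tensor product module \<open>A \<otimes> B\<close>, with the product induced by a bilinear product on the free
  module over pairs with values \<open>\<mu> (a, b) (a', b')\<close> on the basis; the class of \<open>delta K (a, b)\<close> is
  the pure tensor of \<open>a\<close> and \<open>b\<close>.\<close>

definition tensor_with_product ::
  "('k, 'm) ring_scheme \<Rightarrow> ('k, 'a, 'n) module_scheme \<Rightarrow> ('k, 'b, 'o) module_scheme
     \<Rightarrow> ('a \<times> 'b \<Rightarrow> 'a \<times> 'b \<Rightarrow> 'a \<times> 'b \<Rightarrow> 'k) \<Rightarrow> ('k, ('a \<times> 'b \<Rightarrow> 'k) set) module" where
  "tensor_with_product K A B \<mu> = (let F = free_module K (carrier A \<times> carrier B) in
     quotient_algebra
       (F\<lparr>monoid.mult := bilin_ext K F \<mu>, one := delta K (\<one>\<^bsub>A\<^esub>, \<one>\<^bsub>B\<^esub>)\<rparr>)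
       (generated_submodule K F (tensor_relations K A B)))"

definition tensor_algebra ::
  "('k, 'm) ring_scheme \<Rightarrow> ('k, 'a, 'n) module_scheme \<Rightarrow> ('k, 'b, 'o) module_scheme
     \<Rightarrow> ('k, ('a \<times> 'b \<Rightarrow> 'k) set) module" where
  "tensor_algebra K A B = tensor_with_product K A B
     (\<lambda>(a, b) (a', b'). delta K (a \<otimes>\<^bsub>A\<^esub> a', b \<otimes>\<^bsub>B\<^esub> b'))"

text \<open>For a grading \<open>A = P 0 \<oplus> P 1\<close>, the component of \<open>x\<close> in degree \<open>k \<in> {0, 1}\<close>.\<close>

definition homogeneous_component ::
  "('k, 'a, 'n) module_scheme \<Rightarrow> (nat \<Rightarrow> 'a set) \<Rightarrow> nat \<Rightarrow> 'a \<Rightarrow> 'a" where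
  "homogeneous_component A P k x = (THE y. y \<in> P k \<and> (\<exists>z \<in> P (1 - k). x = y \<oplus>\<^bsub>A\<^esub> z))"

text \<open>For homogeneous elements the product of \<open>a \<otimes> b\<close> and \<open>a' \<otimes> b'\<close> is
  \<open>(-1)\<^sup>k\<^sup>l a a' \<otimes> b b'\<close>, where \<open>b\<close> has degree \<open>k\<close> and \<open>a'\<close> has degree \<open>l\<close>. For general elements this
  is extended by splitting \<open>b\<close> and \<open>a'\<close> into their homogeneous components.\<close>

definition graded_tensor_algebra ::
  "('k, 'm) ring_scheme \<Rightarrow> ('k, 'a, 'n) module_scheme \<Rightarrow> (nat \<Rightarrow> 'a set)
     \<Rightarrow> ('k, 'b, 'o) module_scheme \<Rightarrow> (nat \<Rightarrow> 'b set) \<Rightarrow> ('k, ('a \<times> 'b \<Rightarrow> 'k) set) module" where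
  "graded_tensor_algebra K A P B R = (let F = free_module K (carrier A \<times> carrier B) in
     tensor_with_product K A B
       (\<lambda>(a, b) (a', b'). \<Oplus>\<^bsub>F\<^esub>k\<in>{0, 1}. \<Oplus>\<^bsub>F\<^esub>l\<in>{0, 1}.
          ((\<ominus>\<^bsub>K\<^esub> \<one>\<^bsub>K\<^esub>) [^]\<^bsub>K\<^esub> (k * l)) \<odot>\<^bsub>F\<^esub>
            delta K (a \<otimes>\<^bsub>A\<^esub> homogeneous_component A P l a', homogeneous_component B R k b \<otimes>\<^bsub>B\<^esub> b')))"


section \<open>Clifford algebras\<close>

definition words :: "'a set \<Rightarrow> 'a list monoid" where
  "words X = \<lparr>carrier = lists X, monoid.mult = (@), one = []\<rparr>"

text \<open>The Clifford algebra is the free algebra on (the set) \<open>V\<close> modulo the relations saying that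
  the inclusion \<open>j\<close> of \<open>V\<close> is linear and satisfies \<open>j(v)\<^sup>2 = q(v) 1\<close>; its universal property is
  \<open>clifford_algebra_universal\<close> below.\<close>

definition clifford_relations ::
  "('k, 'm) ring_scheme \<Rightarrow> ('k, 'v, 'n) module_scheme \<Rightarrow> ('v \<Rightarrow> 'k) \<Rightarrow> ('v list \<Rightarrow> 'k) set" where
  "clifford_relations K V q = (let T = monoid_algebra K (words (carrier V)) in
     {delta K [v \<oplus>\<^bsub>V\<^esub> w] \<ominus>\<^bsub>T\<^esub> (delta K [v] \<oplus>\<^bsub>T\<^esub> delta K [w]) | v w. v \<in> carrier V \<and> w \<in> carrier V} \<union>
     {delta K [c \<odot>\<^bsub>V\<^esub> v] \<ominus>\<^bsub>T\<^esub> (c \<odot>\<^bsub>T\<^esub> delta K [v]) | c v. c \<in> carrier K \<and> v \<in> carrier V} \<union>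
     {(delta K [v] \<otimes>\<^bsub>T\<^esub> delta K [v]) \<ominus>\<^bsub>T\<^esub> (q v \<odot>\<^bsub>T\<^esub> \<one>\<^bsub>T\<^esub>) | v. v \<in> carrier V})"

definition clifford_algebra ::
  "('k, 'm) ring_scheme \<Rightarrow> ('k, 'v, 'n) module_scheme \<Rightarrow> ('v \<Rightarrow> 'k)
     \<Rightarrow> ('k, ('v list \<Rightarrow> 'k) set) module" where
  "clifford_algebra K V q = (let T = monoid_algebra K (words (carrier V)) in
     quotient_algebra T (Idl\<^bsub>T\<^esub> (clifford_relations K V q)))"

definition clifford_map ::
  "('k, 'm) ring_scheme \<Rightarrow> ('k, 'v, 'n) module_scheme \<Rightarrow> ('v \<Rightarrow> 'k) \<Rightarrow> 'v \<Rightarrow> ('v list \<Rightarrow> 'k) set" where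
  "clifford_map K V q v = (let T = monoid_algebra K (words (carrier V)) in
     Idl\<^bsub>T\<^esub> (clifford_relations K V q) +>\<^bsub>T\<^esub> delta K [v])"

subsection \<open>The universal property\<close>

lemma free_simps [simp]:
  "zero (free_module K X) = (\<lambda>x. \<zero>\<^bsub>K\<^esub>)"
  "add (free_module K X) = (\<lambda>f g x. f x \<oplus>\<^bsub>K\<^esub> g x)"
  "smult (free_module K X) = (\<lambda>c f x. c \<otimes>\<^bsub>K\<^esub> f x)"
  by (simp_all add: free_module_def)

lemma free_carrier:
  "f \<in> carrier (free_module K X) \<longleftrightarrow> (\<forall>x. f x \<in> carrier K) \<and> supp K f \<subseteq> X \<and> finite (supp K f)"
  by (auto simp: free_module_def)

lemma free_module_module:
  assumes "cring K" shows "module K (free_module K X)"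
proof -
  interpret K: cring K by fact
  have add_cl: "(\<lambda>x. f x \<oplus>\<^bsub>K\<^esub> g x) \<in> carrier (free_module K X)"
    if "f \<in> carrier (free_module K X)" "g \<in> carrier (free_module K X)" for f g
  proof -
    have "supp K (\<lambda>x. f x \<oplus>\<^bsub>K\<^esub> g x) \<subseteq> supp K f \<union> supp K g"
      using that by (auto simp: supp_def)
    with that show ?thesis
      unfolding free_carrier by (meson K.add.m_closed Un_least finite_UnI finite_subset order_trans)
  qed
  have smult_cl: "(\<lambda>x. c \<otimes>\<^bsub>K\<^esub> f x) \<in> carrier (free_module K X)"
    if "c \<in> carrier K" "f \<in> carrier (free_module K X)" for c f
  proof -
    have "supp K (\<lambda>x. c \<otimes>\<^bsub>K\<^esub> f x) \<subseteq> supp K f"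
      using that by (auto simp: supp_def free_carrier)
    with that show ?thesis
      unfolding free_carrier by (meson K.m_closed finite_subset order_trans)
  qed
  have zero_cl: "(\<lambda>x. \<zero>\<^bsub>K\<^esub>) \<in> carrier (free_module K X)"
    by (simp add: free_carrier supp_def)
  show ?thesis
  proof (rule moduleI)
    show "abelian_group (free_module K X)"
    proof (rule abelian_groupI)
      fix f assume f: "f \<in> carrier (free_module K X)"
      show "\<exists>y\<in>carrier (free_module K X). y \<oplus>\<^bsub>free_module K X\<^esub> f = \<zero>\<^bsub>free_module K X\<^esub>"
      proof
        show "(\<lambda>x. (\<ominus>\<^bsub>K\<^esub> \<one>\<^bsub>K\<^esub>) \<otimes>\<^bsub>K\<^esub> f x) \<in> carrier (free_module K X)"
          by (rule smult_cl[OF _ f]) simp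
        show "(\<lambda>x. (\<ominus>\<^bsub>K\<^esub> \<one>\<^bsub>K\<^esub>) \<otimes>\<^bsub>K\<^esub> f x) \<oplus>\<^bsub>free_module K X\<^esub> f = \<zero>\<^bsub>free_module K X\<^esub>"
          using f by (auto simp: free_carrier K.l_minus K.l_neg)
      qed
    next
      fix f g assume f: "f \<in> carrier (free_module K X)" and g: "g \<in> carrier (free_module K X)"
      then show "f \<oplus>\<^bsub>free_module K X\<^esub> g \<in> carrier (free_module K X)" using add_cl by simp
      show "f \<oplus>\<^bsub>free_module K X\<^esub> g = g \<oplus>\<^bsub>free_module K X\<^esub> f"
        using f g by (auto simp: free_carrier K.a_comm)
    qed (use zero_cl in \<open>auto simp: free_carrier K.a_assoc\<close>)
  qed (use add_cl smult_cl in \<open>auto simp: free_carrier K.m_assoc K.l_distr K.r_distr assms\<close>)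
qed

lemma delta_free:
  assumes "cring K" "x \<in> X" shows "delta K x \<in> carrier (free_module K X)"
proof -
  interpret K: cring K by fact
  have "supp K (delta K x) \<subseteq> {x}" by (auto simp: supp_def delta_def)
  then show ?thesis using assms(2) unfolding free_carrier
    by (auto simp: delta_def intro: finite_subset)
qed

lemma free_induct:
  assumes K: "cring K" and f: "f \<in> carrier (free_module K X)"
    and zero: "P (\<lambda>x. \<zero>\<^bsub>K\<^esub>)"
    and step: "\<And>c x g. \<lbrakk>c \<in> carrier K; x \<in> X; g \<in> carrier (free_module K X); P g\<rbrakk>
      \<Longrightarrow> P ((c \<odot>\<^bsub>free_module K X\<^esub> delta K x) \<oplus>\<^bsub>free_module K X\<^esub> g)"
  shows "P f"
proof -
  interpret K: cring K by fact
  have "finite S \<Longrightarrow> \<forall>f \<in> carrier (free_module K X). supp K f \<subseteq> S \<longrightarrow> P f" for S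
  proof (induction S rule: finite_induct)
    case empty
    show ?case
    proof (intro ballI impI)
      fix f assume "f \<in> carrier (free_module K X)" "supp K f \<subseteq> {}"
      then have "f = (\<lambda>x. \<zero>\<^bsub>K\<^esub>)" by (auto simp: supp_def)
      with zero show "P f" by simp
    qed
  next
    case (insert x S)
    show ?case
    proof (intro ballI impI)
      fix f assume f: "f \<in> carrier (free_module K X)" and sub: "supp K f \<subseteq> insert x S"
      show "P f"
      proof (cases "x \<in> supp K f")
        case False
        then show ?thesis using insert.IH f sub by blast
      next
        case True
        define g where "g = f(x := \<zero>\<^bsub>K\<^esub>)"
        have sg: "supp K g = supp K f - {x}" by (auto simp: g_def supp_def)
        have g: "g \<in> carrier (free_module K X)"
          using f unfolding free_carrier sg by (auto simp: g_def)
        have "P g" using insert.IH g sg sub by blast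
        moreover have "f = (f x \<odot>\<^bsub>free_module K X\<^esub> delta K x) \<oplus>\<^bsub>free_module K X\<^esub> g"
          using f by (auto simp: g_def delta_def free_carrier)
        ultimately show ?thesis
          using step[of "f x" x g] f g True by (auto simp: free_carrier)
      qed
    qed
  qed
  then show ?thesis using f by (auto simp: free_carrier)
qed

lemma lin_ext_eq:
  assumes M: "module K M" and f: "f \<in> carrier (free_module K X)" and \<phi>: "\<phi> \<in> X \<rightarrow> carrier M"
    and S: "finite S" "supp K f \<subseteq> S" "S \<subseteq> X"
  shows "lin_ext K M \<phi> f = (\<Oplus>\<^bsub>M\<^esub>x\<in>S. f x \<odot>\<^bsub>M\<^esub> \<phi> x)"
proof -
  interpret M: module K M by fact
  show ?thesis unfolding lin_ext_def
  proof (rule M.add.finprod_mono_neutral_cong_left)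
    show "f x \<odot>\<^bsub>M\<^esub> \<phi> x = \<zero>\<^bsub>M\<^esub>" if "x \<in> S - supp K f" for x
      using that \<phi> S by (auto simp: supp_def Pi_iff intro!: M.smult_l_null)
  qed (use assms in \<open>auto simp: free_carrier Pi_iff\<close>)
qed

lemma lin_ext_linear:
  assumes M: "module K M" and \<phi>: "\<phi> \<in> X \<rightarrow> carrier M"
  shows "lin_ext K M \<phi> \<in> linear_map K (free_module K X) M"
proof -
  interpret M: module K M by fact
  interpret F: module K "free_module K X" by (rule free_module_module) (rule M.R.is_cring)
  have cl: "lin_ext K M \<phi> f \<in> carrier M" if "f \<in> carrier (free_module K X)" for f
    unfolding lin_ext_def using that \<phi> by (auto simp: free_carrier Pi_iff intro!: M.finsum_closed)
  show ?thesis unfolding linear_map_def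
  proof (intro CollectI conjI ballI)
    show "lin_ext K M \<phi> \<in> carrier (free_module K X) \<rightarrow> carrier M" using cl by blast
  next
    fix f g assume f: "f \<in> carrier (free_module K X)" and g: "g \<in> carrier (free_module K X)"
    let ?h = "f \<oplus>\<^bsub>free_module K X\<^esub> g"
    let ?S = "supp K f \<union> supp K g"
    have h: "?h \<in> carrier (free_module K X)" by (rule F.M.a_closed[OF f g])
    have S: "finite ?S" "?S \<subseteq> X" "supp K f \<subseteq> ?S" "supp K g \<subseteq> ?S" using f g by (auto simp: free_carrier)
    have hS: "supp K ?h \<subseteq> ?S" by (auto simp: supp_def)
    have *: "f x \<in> carrier K" "g x \<in> carrier K" for x using f g by (auto simp: free_carrier)
    have ph: "x \<in> supp K f \<Longrightarrow> \<phi> x \<in> carrier M" "x \<in> supp K g \<Longrightarrow> \<phi> x \<in> carrier M" for x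
      using S \<phi> by auto
    show "lin_ext K M \<phi> ?h = lin_ext K M \<phi> f \<oplus>\<^bsub>M\<^esub> lin_ext K M \<phi> g"
      unfolding lin_ext_eq[OF M h \<phi> S(1) hS S(2)] lin_ext_eq[OF M f \<phi> S(1) S(3) S(2)]
        lin_ext_eq[OF M g \<phi> S(1) S(4) S(2)]
      apply (subst M.finsum_addf[symmetric])
        apply (use * ph in auto)[2]
      apply (rule M.finsum_cong')
      using * ph by (auto simp: M.smult_l_distr)
  next
    fix c f assume c: "c \<in> carrier K" and f: "f \<in> carrier (free_module K X)"
    let ?h = "c \<odot>\<^bsub>free_module K X\<^esub> f"
    have h: "?h \<in> carrier (free_module K X)" by (rule F.smult_closed[OF c f])
    have S: "finite (supp K f)" "supp K f \<subseteq> X" using f by (auto simp: free_carrier)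
    have hS: "supp K ?h \<subseteq> supp K f" using c by (auto simp: supp_def)
    have *: "f x \<in> carrier K" for x using f by (auto simp: free_carrier)
    have ph: "\<phi> x \<in> carrier M" if "x \<in> supp K f" for x using that S \<phi> by auto
    show "lin_ext K M \<phi> ?h = c \<odot>\<^bsub>M\<^esub> lin_ext K M \<phi> f"
      unfolding lin_ext_eq[OF M h \<phi> S(1) hS S(2)] lin_ext_eq[OF M f \<phi> S(1) subset_refl S(2)]
      by (subst M.finsum_smult_ldistr)
         (use * ph c S in \<open>auto simp: M.smult_assoc1 intro!: M.finsum_cong'\<close>)
  qed
qed

lemma lin_ext_delta:
  assumes M: "module K M" and \<phi>: "\<phi> \<in> X \<rightarrow> carrier M" and x: "x \<in> X"
  shows "lin_ext K M \<phi> (delta K x) = \<phi> x"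
proof -
  interpret M: module K M by fact
  have s: "supp K (delta K x) \<subseteq> {x}" by (auto simp: supp_def delta_def)
  have "lin_ext K M \<phi> (delta K x) = (\<Oplus>\<^bsub>M\<^esub>y\<in>{x}. delta K x y \<odot>\<^bsub>M\<^esub> \<phi> y)"
    by (rule lin_ext_eq[OF M delta_free[OF M.R.is_cring x] \<phi> _ s]) (use x in auto)
  also have "\<dots> = \<phi> x" using \<phi> x by (subst M.finsum_insert) (auto simp: delta_def Pi_iff)
  finally show ?thesis .
qed

lemma linear_mapD:
  assumes "f \<in> linear_map K V W"
  shows "x \<in> carrier V \<Longrightarrow> f x \<in> carrier W"
    and "\<lbrakk>x \<in> carrier V; y \<in> carrier V\<rbrakk> \<Longrightarrow> f (x \<oplus>\<^bsub>V\<^esub> y) = f x \<oplus>\<^bsub>W\<^esub> f y"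
    and "\<lbrakk>c \<in> carrier K; x \<in> carrier V\<rbrakk> \<Longrightarrow> f (c \<odot>\<^bsub>V\<^esub> x) = c \<odot>\<^bsub>W\<^esub> f x"
  using assms by (auto simp: linear_map_def)

lemma linear_map_zero:
  assumes "module K V" "module K W" "f \<in> linear_map K V W"
  shows "f \<zero>\<^bsub>V\<^esub> = \<zero>\<^bsub>W\<^esub>"
proof -
  interpret V: module K V by fact
  interpret W: module K W by fact
  have "f (\<zero>\<^bsub>K\<^esub> \<odot>\<^bsub>V\<^esub> \<zero>\<^bsub>V\<^esub>) = \<zero>\<^bsub>K\<^esub> \<odot>\<^bsub>W\<^esub> f \<zero>\<^bsub>V\<^esub>"
    by (rule linear_mapD(3)[OF assms(3)]) auto
  then show ?thesis using linear_mapD(1)[OF assms(3), of "\<zero>\<^bsub>V\<^esub>"] by simp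
qed

lemma linear_map_eqI:
  assumes M: "module K M" and h: "h \<in> linear_map K (free_module K X) M" "h' \<in> linear_map K (free_module K X) M"
    and eq: "\<And>x. x \<in> X \<Longrightarrow> h (delta K x) = h' (delta K x)"
    and f: "f \<in> carrier (free_module K X)"
  shows "h f = h' f"
proof -
  interpret M: module K M by fact
  interpret F: module K "free_module K X" by (rule free_module_module) (rule M.R.is_cring)
  show ?thesis
  proof (rule free_induct[OF M.R.is_cring f])
    show "h (\<lambda>x. \<zero>\<^bsub>K\<^esub>) = h' (\<lambda>x. \<zero>\<^bsub>K\<^esub>)"
      using linear_map_zero[OF F.module_axioms M h(1)] linear_map_zero[OF F.module_axioms M h(2)] by simp
  next
    fix c x g
    assume c: "c \<in> carrier K" and x: "x \<in> X" and g: "g \<in> carrier (free_module K X)" and IH: "h g = h' g"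
    have d: "delta K x \<in> carrier (free_module K X)" by (rule delta_free[OF M.R.is_cring x])
    show "h (c \<odot>\<^bsub>free_module K X\<^esub> delta K x \<oplus>\<^bsub>free_module K X\<^esub> g)
        = h' (c \<odot>\<^bsub>free_module K X\<^esub> delta K x \<oplus>\<^bsub>free_module K X\<^esub> g)"
      unfolding linear_mapD(2)[OF h(1) F.smult_closed[OF c d] g] linear_mapD(3)[OF h(1) c d]
        linear_mapD(2)[OF h(2) F.smult_closed[OF c d] g] linear_mapD(3)[OF h(2) c d]
      using eq[OF x] IH by simp
  qed
qed

lemma linear_mapI:
  assumes "\<And>x. x \<in> carrier V \<Longrightarrow> f x \<in> carrier W"
    and "\<And>x y. \<lbrakk>x \<in> carrier V; y \<in> carrier V\<rbrakk> \<Longrightarrow> f (x \<oplus>\<^bsub>V\<^esub> y) = f x \<oplus>\<^bsub>W\<^esub> f y"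
    and "\<And>c x. \<lbrakk>c \<in> carrier K; x \<in> carrier V\<rbrakk> \<Longrightarrow> f (c \<odot>\<^bsub>V\<^esub> x) = c \<odot>\<^bsub>W\<^esub> f x"
  shows "f \<in> linear_map K V W"
  using assms by (auto simp: linear_map_def)

lemma bilin_ext_bilinear:
  assumes M: "module K M" and \<beta>: "\<And>x y. \<lbrakk>x \<in> X; y \<in> Y\<rbrakk> \<Longrightarrow> \<beta> x y \<in> carrier M"
  shows "g \<in> carrier (free_module K Y) \<Longrightarrow> (\<lambda>f. bilin_ext K M \<beta> f g) \<in> linear_map K (free_module K X) M"
    and "f \<in> carrier (free_module K X) \<Longrightarrow> bilin_ext K M \<beta> f \<in> linear_map K (free_module K Y) M"
    and "\<lbrakk>x \<in> X; y \<in> Y\<rbrakk> \<Longrightarrow> bilin_ext K M \<beta> (delta K x) (delta K y) = \<beta> x y"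
proof -
  interpret M: module K M by fact
  interpret F: module K "free_module K X" by (rule free_module_module) (rule M.R.is_cring)
  interpret F': module K "free_module K Y" by (rule free_module_module) (rule M.R.is_cring)
  have lin: "lin_ext K M (\<beta> x) \<in> linear_map K (free_module K Y) M" if "x \<in> X" for x
    by (rule lin_ext_linear[OF M]) (use \<beta> that in auto)
  have cl: "(\<lambda>x. lin_ext K M (\<beta> x) g) \<in> X \<rightarrow> carrier M" if "g \<in> carrier (free_module K Y)" for g
    using linear_mapD(1)[OF lin] that by auto
  show "(\<lambda>f. bilin_ext K M \<beta> f g) \<in> linear_map K (free_module K X) M"
    if "g \<in> carrier (free_module K Y)" for g
    unfolding bilin_ext_def by (rule lin_ext_linear[OF M cl[OF that]])
  show "bilin_ext K M \<beta> (delta K x) (delta K y) = \<beta> x y" if "x \<in> X" "y \<in> Y" for x y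
    unfolding bilin_ext_def
    apply (subst lin_ext_delta[OF M cl[OF delta_free[OF M.R.is_cring that(2)]] that(1)])
    apply (rule lin_ext_delta[OF M _ that(2)])
    using that \<beta> by auto
  show "bilin_ext K M \<beta> f \<in> linear_map K (free_module K Y) M"
    if f: "f \<in> carrier (free_module K X)" for f
  proof (rule linear_mapI)
    have S: "finite (supp K f)" "supp K f \<subseteq> X" using f by (auto simp: free_carrier)
    have fK: "f x \<in> carrier K" for x using f by (auto simp: free_carrier)
    have cl': "lin_ext K M (\<beta> x) g \<in> carrier M" if "x \<in> supp K f" "g \<in> carrier (free_module K Y)" for x g
      using cl that S by blast
    fix g assume g: "g \<in> carrier (free_module K Y)"
    show "bilin_ext K M \<beta> f g \<in> carrier M"
      unfolding bilin_ext_def by (rule linear_mapD(1)[OF lin_ext_linear[OF M cl[OF g]] f])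
    { fix h assume h: "h \<in> carrier (free_module K Y)"
      have "bilin_ext K M \<beta> f (g \<oplus>\<^bsub>free_module K Y\<^esub> h)
          = (\<Oplus>\<^bsub>M\<^esub>x\<in>supp K f. (f x \<odot>\<^bsub>M\<^esub> lin_ext K M (\<beta> x) g) \<oplus>\<^bsub>M\<^esub> (f x \<odot>\<^bsub>M\<^esub> lin_ext K M (\<beta> x) h))"
        unfolding bilin_ext_def lin_ext_def[of K M "\<lambda>x. lin_ext K M (\<beta> x) _"]
      proof (rule M.finsum_cong'[OF refl])
        show "(\<lambda>x. (f x \<odot>\<^bsub>M\<^esub> lin_ext K M (\<beta> x) g) \<oplus>\<^bsub>M\<^esub> (f x \<odot>\<^bsub>M\<^esub> lin_ext K M (\<beta> x) h))
          \<in> supp K f \<rightarrow> carrier M" using fK cl' g h by auto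
        fix x assume x: "x \<in> supp K f"
        then have "x \<in> X" using S by auto
        show "f x \<odot>\<^bsub>M\<^esub> lin_ext K M (\<beta> x) (g \<oplus>\<^bsub>free_module K Y\<^esub> h)
          = (f x \<odot>\<^bsub>M\<^esub> lin_ext K M (\<beta> x) g) \<oplus>\<^bsub>M\<^esub> (f x \<odot>\<^bsub>M\<^esub> lin_ext K M (\<beta> x) h)"
          unfolding linear_mapD(2)[OF lin[OF \<open>x \<in> X\<close>] g h]
          by (rule M.smult_r_distr[OF fK cl'[OF x g] cl'[OF x h]])
      qed
      also have "\<dots> = bilin_ext K M \<beta> f g \<oplus>\<^bsub>M\<^esub> bilin_ext K M \<beta> f h"
        unfolding bilin_ext_def lin_ext_def[of K M "\<lambda>x. lin_ext K M (\<beta> x) _"]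
        by (rule M.finsum_addf) (use fK cl' g h in auto)
      finally show "bilin_ext K M \<beta> f (g \<oplus>\<^bsub>free_module K Y\<^esub> h)
        = bilin_ext K M \<beta> f g \<oplus>\<^bsub>M\<^esub> bilin_ext K M \<beta> f h" . }
    { fix c assume c: "c \<in> carrier K"
      have "bilin_ext K M \<beta> f (c \<odot>\<^bsub>free_module K Y\<^esub> g)
          = (\<Oplus>\<^bsub>M\<^esub>x\<in>supp K f. c \<odot>\<^bsub>M\<^esub> (f x \<odot>\<^bsub>M\<^esub> lin_ext K M (\<beta> x) g))"
        unfolding bilin_ext_def lin_ext_def[of K M "\<lambda>x. lin_ext K M (\<beta> x) _"]
      proof (rule M.finsum_cong'[OF refl])
        show "(\<lambda>x. c \<odot>\<^bsub>M\<^esub> (f x \<odot>\<^bsub>M\<^esub> lin_ext K M (\<beta> x) g)) \<in> supp K f \<rightarrow> carrier M"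
          using fK cl' g c by auto
        fix x assume x: "x \<in> supp K f"
        then have "x \<in> X" using S by auto
        show "f x \<odot>\<^bsub>M\<^esub> lin_ext K M (\<beta> x) (c \<odot>\<^bsub>free_module K Y\<^esub> g)
          = c \<odot>\<^bsub>M\<^esub> (f x \<odot>\<^bsub>M\<^esub> lin_ext K M (\<beta> x) g)"
          unfolding linear_mapD(3)[OF lin[OF \<open>x \<in> X\<close>] c g]
          using M.smult_assoc1[OF fK c cl'[OF x g]] M.smult_assoc1[OF c fK cl'[OF x g]]
            M.R.m_comm[OF c fK] by metis
      qed
      also have "\<dots> = c \<odot>\<^bsub>M\<^esub> bilin_ext K M \<beta> f g"
        unfolding bilin_ext_def lin_ext_def[of K M "\<lambda>x. lin_ext K M (\<beta> x) _"]
        by (rule M.finsum_smult_ldistr[symmetric]) (use fK cl' g c S in auto)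
      finally show "bilin_ext K M \<beta> f (c \<odot>\<^bsub>free_module K Y\<^esub> g) = c \<odot>\<^bsub>M\<^esub> bilin_ext K M \<beta> f g" . }
  qed
qed


lemma module_update:
  assumes "module K M" shows "module K (M\<lparr>monoid.mult := m, one := e\<rparr>)"
proof -
  interpret M: module K M by fact
  have "abelian_group (M\<lparr>monoid.mult := m, one := e\<rparr>)"
    using M.abelian_group_axioms
    by (simp add: abelian_group_def abelian_monoid_def abelian_group_axioms_def)
  then show ?thesis
    by (rule moduleI[OF M.R.is_cring])
       (auto simp: M.smult_l_distr M.smult_r_distr M.smult_assoc1)
qed

lemma linear_map_update:
  "linear_map K (M\<lparr>monoid.mult := m, one := e\<rparr>) N = linear_map K M N"
  "linear_map K M (N\<lparr>monoid.mult := m', one := e'\<rparr>) = linear_map K M N"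
  by (simp_all add: linear_map_def)

lemma linear_map_comp:
  assumes "f \<in> linear_map K U V" "g \<in> linear_map K V W"
  shows "(\<lambda>x. g (f x)) \<in> linear_map K U W"
  using linear_mapD[OF assms(1)] linear_mapD[OF assms(2)] by (intro linear_mapI) auto

lemma monoid_algebra_eq:
  "monoid_algebra K G = (free_module K (carrier G))
     \<lparr>monoid.mult := bilin_ext K (free_module K (carrier G)) (\<lambda>x y. delta K (x \<otimes>\<^bsub>G\<^esub> y)), one := delta K \<one>\<^bsub>G\<^esub>\<rparr>"
  by (simp add: monoid_algebra_def Let_def)

context
  fixes K :: "('k, 'm) ring_scheme" and G :: "('g, 'n) monoid_scheme"
  assumes K: "cring K" and G: "monoid G"
begin

private abbreviation "F \<equiv> free_module K (carrier G)"
private abbreviation "\<beta> \<equiv> (\<lambda>x y. delta K (x \<otimes>\<^bsub>G\<^esub> y))"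

interpretation K: cring K by (rule K)
interpretation G: monoid G by (rule G)
interpretation F: module K F by (rule free_module_module[OF K])

private lemma beta: "\<lbrakk>x \<in> carrier G; y \<in> carrier G\<rbrakk> \<Longrightarrow> \<beta> x y \<in> carrier F"
  by (simp add: delta_free[OF K])

private abbreviation "mul \<equiv> bilin_ext K F \<beta>"

private lemma mult_left: "g \<in> carrier F \<Longrightarrow> (\<lambda>f. mul f g) \<in> linear_map K F F"
  using bilin_ext_bilinear(1)[where \<beta> = \<beta>, OF F.module_axioms beta] by blast

private lemma mult_right: "f \<in> carrier F \<Longrightarrow> mul f \<in> linear_map K F F"
  using bilin_ext_bilinear(2)[where \<beta> = \<beta>, OF F.module_axioms beta] by blast

private lemma mult_delta: "\<lbrakk>x \<in> carrier G; y \<in> carrier G\<rbrakk> \<Longrightarrow> mul (delta K x) (delta K y) = \<beta> x y"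
  using bilin_ext_bilinear(3)[where \<beta> = \<beta>, OF F.module_axioms beta] by blast

private lemmas dcl = delta_free[OF K]

private lemma mul_closed: "\<lbrakk>f \<in> carrier F; g \<in> carrier F\<rbrakk> \<Longrightarrow> mul f g \<in> carrier F"
  by (rule linear_mapD(1)[OF mult_left])

private lemma mul_assoc:
  assumes f: "f \<in> carrier F" and g: "g \<in> carrier F" and h: "h \<in> carrier F"
  shows "mul (mul f g) h = mul f (mul g h)"
proof (rule linear_map_eqI[OF F.module_axioms _ _ _ f, of "\<lambda>f. mul (mul f g) h" "\<lambda>f. mul f (mul g h)"])
  show "(\<lambda>f. mul (mul f g) h) \<in> linear_map K F F"
    by (rule linear_map_comp[OF mult_left[OF g] mult_left[OF h]])
  show "(\<lambda>f. mul f (mul g h)) \<in> linear_map K F F"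
    by (rule mult_left[OF mul_closed[OF g h]])
  fix x assume x: "x \<in> carrier G"
  show "mul (mul (delta K x) g) h = mul (delta K x) (mul g h)"
  proof (rule linear_map_eqI[OF F.module_axioms _ _ _ g, of "\<lambda>g. mul (mul (delta K x) g) h" "\<lambda>g. mul (delta K x) (mul g h)"])
    show "(\<lambda>g. mul (mul (delta K x) g) h) \<in> linear_map K F F"
      by (rule linear_map_comp[OF mult_right[OF dcl[OF x]] mult_left[OF h]])
    show "(\<lambda>g. mul (delta K x) (mul g h)) \<in> linear_map K F F"
      by (rule linear_map_comp[OF mult_left[OF h] mult_right[OF dcl[OF x]]])
    fix y assume y: "y \<in> carrier G"
    show "mul (mul (delta K x) (delta K y)) h = mul (delta K x) (mul (delta K y) h)"
    proof (rule linear_map_eqI[OF F.module_axioms _ _ _ h, of "mul (mul (delta K x) (delta K y))" "\<lambda>h. mul (delta K x) (mul (delta K y) h)"])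
      show "mul (mul (delta K x) (delta K y)) \<in> linear_map K F F"
        by (rule mult_right[OF mul_closed[OF dcl[OF x] dcl[OF y]]])
      show "(\<lambda>h. mul (delta K x) (mul (delta K y) h)) \<in> linear_map K F F"
        by (rule linear_map_comp[OF mult_right[OF dcl[OF y]] mult_right[OF dcl[OF x]]])
      fix z assume z: "z \<in> carrier G"
      show "mul (mul (delta K x) (delta K y)) (delta K z) = mul (delta K x) (mul (delta K y) (delta K z))"
        by (simp add: mult_delta x y z G.m_assoc)
    qed
  qed
qed

private lemma id_linear: "(\<lambda>f. f) \<in> linear_map K F F"
  by (rule linear_mapI) auto

private lemma mul_one:
  assumes f: "f \<in> carrier F"
  shows "mul (delta K \<one>\<^bsub>G\<^esub>) f = f" "mul f (delta K \<one>\<^bsub>G\<^esub>) = f"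
proof -
  note d1 = dcl[OF G.one_closed]
  show "mul (delta K \<one>\<^bsub>G\<^esub>) f = f"
    by (rule linear_map_eqI[OF F.module_axioms mult_right[OF d1] id_linear _ f]) (simp add: mult_delta)
  show "mul f (delta K \<one>\<^bsub>G\<^esub>) = f"
    by (rule linear_map_eqI[OF F.module_axioms mult_left[OF d1] id_linear _ f]) (simp add: mult_delta)
qed

lemma monoid_algebra_assoc_algebra: "assoc_algebra K (monoid_algebra K G)"
proof -
  have mod: "module K (monoid_algebra K G)"
    unfolding monoid_algebra_eq by (rule module_update[OF F.module_axioms])
  interpret M: module K "monoid_algebra K G" by (rule mod)
  have [simp]: "carrier (monoid_algebra K G) = carrier F" "add (monoid_algebra K G) = add F"
    "monoid.mult (monoid_algebra K G) = mul" "one (monoid_algebra K G) = delta K \<one>\<^bsub>G\<^esub>"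
    "smult (monoid_algebra K G) = smult F"
    unfolding monoid_algebra_eq by simp_all
  have "ring (monoid_algebra K G)"
  proof (rule ringI)
    show "abelian_group (monoid_algebra K G)" ..
    show "monoid (monoid_algebra K G)"
      by (rule monoidI) (simp_all add: mul_closed mul_assoc mul_one dcl del: free_simps)
  qed (simp_all add: linear_mapD(2)[OF mult_left] linear_mapD(2)[OF mult_right] del: free_simps)
  then show ?thesis
    by (intro assoc_algebra.intro[OF mod] assoc_algebra_axioms.intro)
       (simp_all add: linear_mapD(3)[OF mult_left] linear_mapD(3)[OF mult_right] del: free_simps)
qed

lemma delta_mult:
  "\<lbrakk>x \<in> carrier G; y \<in> carrier G\<rbrakk>
    \<Longrightarrow> delta K x \<otimes>\<^bsub>monoid_algebra K G\<^esub> delta K y = delta K (x \<otimes>\<^bsub>G\<^esub> y)"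
  by (simp add: monoid_algebra_eq mult_delta)

lemma delta_closed: "x \<in> carrier G \<Longrightarrow> delta K x \<in> carrier (monoid_algebra K G)"
  by (simp add: monoid_algebra_eq dcl)

lemma lin_ext_algebra_hom:
  assumes A: "assoc_algebra K A" and \<phi>: "\<phi> \<in> carrier G \<rightarrow> carrier A"
    and mult: "\<And>x y. \<lbrakk>x \<in> carrier G; y \<in> carrier G\<rbrakk> \<Longrightarrow> \<phi> (x \<otimes>\<^bsub>G\<^esub> y) = \<phi> x \<otimes>\<^bsub>A\<^esub> \<phi> y"
    and one: "\<phi> \<one>\<^bsub>G\<^esub> = \<one>\<^bsub>A\<^esub>"
  shows "lin_ext K A \<phi> \<in> algebra_hom K (monoid_algebra K G) A"
proof -
  interpret A: assoc_algebra K A by fact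
  note A' = A.module_axioms
  note lin = lin_ext_linear[OF A' \<phi>]
  have ld: "lin_ext K A \<phi> (delta K x) = \<phi> x" if "x \<in> carrier G" for x
    by (rule lin_ext_delta[OF A' \<phi> that])
  have lmul: "(\<lambda>g. a \<otimes>\<^bsub>A\<^esub> lin_ext K A \<phi> g) \<in> linear_map K F A" if "a \<in> carrier A" for a
    using linear_mapD[OF lin] that
    by (intro linear_mapI) (simp_all add: A.r_distr A.smult_mult_right del: free_simps)
  have rmul: "(\<lambda>g. lin_ext K A \<phi> g \<otimes>\<^bsub>A\<^esub> a) \<in> linear_map K F A" if "a \<in> carrier A" for a
    using linear_mapD[OF lin] that
    by (intro linear_mapI) (simp_all add: A.l_distr A.smult_mult_left del: free_simps)
  have "lin_ext K A \<phi> (mul f g) = lin_ext K A \<phi> f \<otimes>\<^bsub>A\<^esub> lin_ext K A \<phi> g"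
    if f: "f \<in> carrier F" and g: "g \<in> carrier F" for f g
  proof (rule linear_map_eqI[OF A' linear_map_comp[OF mult_left[OF g] lin] rmul[OF linear_mapD(1)[OF lin g]] _ f])
    fix x assume x: "x \<in> carrier G"
    show "lin_ext K A \<phi> (mul (delta K x) g) = lin_ext K A \<phi> (delta K x) \<otimes>\<^bsub>A\<^esub> lin_ext K A \<phi> g"
      by (rule linear_map_eqI[OF A' linear_map_comp[OF mult_right[OF dcl[OF x]] lin]
            lmul[OF linear_mapD(1)[OF lin dcl[OF x]]] _ g])
         (simp add: mult_delta x ld mult)
  qed
  then have "lin_ext K A \<phi> \<in> ring_hom (monoid_algebra K G) A"
    using linear_mapD[OF lin] ld[OF G.one_closed] one
    by (intro ring_hom_memI) (simp_all add: monoid_algebra_eq del: free_simps)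
  then show ?thesis
    using lin by (simp add: algebra_hom_def monoid_algebra_eq linear_map_update)
qed

end


lemma mem_coset: "y \<in> I +>\<^bsub>A\<^esub> x \<longleftrightarrow> (\<exists>i\<in>I. y = i \<oplus>\<^bsub>A\<^esub> x)"
  by (auto simp: a_r_coset_def r_coset_def)

lemma ring_cong:
  assumes "ring R" "carrier S = carrier R" "add S = add R" "zero S = zero R"
    "monoid.mult S = monoid.mult R" "one S = one R"
  shows "ring S"
proof -
  interpret R: ring R by fact
  show ?thesis
  proof (rule ringI)
    show "abelian_group S"
      by (rule abelian_groupI) (use R.l_neg in \<open>auto simp: assms(2-) R.a_ac\<close>)
    show "monoid S"
      by (rule monoidI) (auto simp: assms(2-) R.m_assoc)
  qed (auto simp: assms(2-) R.l_distr R.r_distr)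
qed

lemma quotient_algebra_simps:
  "carrier (quotient_algebra A I) = carrier (A Quot I)"
  "add (quotient_algebra A I) = add (A Quot I)"
  "zero (quotient_algebra A I) = zero (A Quot I)"
  "monoid.mult (quotient_algebra A I) = monoid.mult (A Quot I)"
  "one (quotient_algebra A I) = one (A Quot I)"
  by (simp_all add: quotient_algebra_def ring.extend_def module.fields_def)

lemma quotient_algebra_smult:
  "c \<odot>\<^bsub>quotient_algebra A I\<^esub> X = (\<Union>x\<in>X. I +>\<^bsub>A\<^esub> (c \<odot>\<^bsub>A\<^esub> x))"
  by (simp add: quotient_algebra_def ring.extend_def module.fields_def)

context
  fixes K :: "('k, 'm) ring_scheme" and A :: "('k, 'a, 'n) module_scheme" and I
  assumes A: "assoc_algebra K A" and I: "ideal I A"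
begin

interpretation A: assoc_algebra K A by (rule A)
interpretation I: ideal I A by (rule I)

private abbreviation "C \<equiv> quotient_algebra A I"

lemma quotient_algebra_carrier: "carrier C = (\<lambda>x. I +>\<^bsub>A\<^esub> x) ` carrier A"
  by (auto simp: quotient_algebra_simps FactRing_def A_RCOSETS_def' image_def)

lemma quotient_algebra_ops:
  "\<lbrakk>x \<in> carrier A; y \<in> carrier A\<rbrakk> \<Longrightarrow> (I +>\<^bsub>A\<^esub> x) \<oplus>\<^bsub>C\<^esub> (I +>\<^bsub>A\<^esub> y) = I +>\<^bsub>A\<^esub> (x \<oplus>\<^bsub>A\<^esub> y)"
  "\<lbrakk>x \<in> carrier A; y \<in> carrier A\<rbrakk> \<Longrightarrow> (I +>\<^bsub>A\<^esub> x) \<otimes>\<^bsub>C\<^esub> (I +>\<^bsub>A\<^esub> y) = I +>\<^bsub>A\<^esub> (x \<otimes>\<^bsub>A\<^esub> y)"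
  "\<lbrakk>c \<in> carrier K; x \<in> carrier A\<rbrakk> \<Longrightarrow> c \<odot>\<^bsub>C\<^esub> (I +>\<^bsub>A\<^esub> x) = I +>\<^bsub>A\<^esub> (c \<odot>\<^bsub>A\<^esub> x)"
  "\<one>\<^bsub>C\<^esub> = I +>\<^bsub>A\<^esub> \<one>\<^bsub>A\<^esub>"
proof -
  show "(I +>\<^bsub>A\<^esub> x) \<oplus>\<^bsub>C\<^esub> (I +>\<^bsub>A\<^esub> y) = I +>\<^bsub>A\<^esub> (x \<oplus>\<^bsub>A\<^esub> y)" if "x \<in> carrier A" "y \<in> carrier A" for x y
    using that by (simp add: quotient_algebra_simps FactRing_def I.a_rcos_sum)
  show "(I +>\<^bsub>A\<^esub> x) \<otimes>\<^bsub>C\<^esub> (I +>\<^bsub>A\<^esub> y) = I +>\<^bsub>A\<^esub> (x \<otimes>\<^bsub>A\<^esub> y)" if "x \<in> carrier A" "y \<in> carrier A" for x y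
    using that by (simp add: quotient_algebra_simps FactRing_def I.rcoset_mult_add)
  show "\<one>\<^bsub>C\<^esub> = I +>\<^bsub>A\<^esub> \<one>\<^bsub>A\<^esub>"
    by (simp add: quotient_algebra_simps FactRing_def)
  show "c \<odot>\<^bsub>C\<^esub> (I +>\<^bsub>A\<^esub> x) = I +>\<^bsub>A\<^esub> (c \<odot>\<^bsub>A\<^esub> x)" if c: "c \<in> carrier K" and x: "x \<in> carrier A" for c x
  proof -
    have "I +>\<^bsub>A\<^esub> (c \<odot>\<^bsub>A\<^esub> y) = I +>\<^bsub>A\<^esub> (c \<odot>\<^bsub>A\<^esub> x)" if yx: "y \<in> I +>\<^bsub>A\<^esub> x" for y
    proof -
      obtain i where i: "i \<in> I" and y: "y = i \<oplus>\<^bsub>A\<^esub> x" using yx unfolding mem_coset by blast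
      have iA: "i \<in> carrier A" using i I.a_subset by blast
      have "c \<odot>\<^bsub>A\<^esub> i = (c \<odot>\<^bsub>A\<^esub> \<one>\<^bsub>A\<^esub>) \<otimes>\<^bsub>A\<^esub> i"
        using A.smult_mult_left[OF c A.one_closed iA] iA by simp
      then have "c \<odot>\<^bsub>A\<^esub> i \<in> I" using I.I_l_closed[OF i, of "c \<odot>\<^bsub>A\<^esub> \<one>\<^bsub>A\<^esub>"] c by simp
      moreover have "c \<odot>\<^bsub>A\<^esub> y = (c \<odot>\<^bsub>A\<^esub> i) \<oplus>\<^bsub>A\<^esub> (c \<odot>\<^bsub>A\<^esub> x)"
        unfolding y by (rule A.smult_r_distr[OF c iA x])
      ultimately have m: "c \<odot>\<^bsub>A\<^esub> y \<in> I +>\<^bsub>A\<^esub> (c \<odot>\<^bsub>A\<^esub> x)" unfolding mem_coset by (rule bexI[rotated])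
      show ?thesis by (rule I.a_repr_independence'[OF m A.smult_closed[OF c x], symmetric])
    qed
    moreover have "x \<in> I +>\<^bsub>A\<^esub> x" using I.a_rcos_self[OF x] .
    ultimately show ?thesis unfolding quotient_algebra_smult by blast
  qed
qed

lemma quotient_algebra_assoc_algebra: "assoc_algebra K C"
proof -
  have "ring (A Quot I)" by (rule I.quotient_is_ring)
  then have ring: "ring C"
    by (rule ring_cong) (simp_all only: quotient_algebra_simps)
  interpret C: ring C by (rule ring)
  have "module K C"
  proof (rule moduleI[OF A.R.is_cring])
    show "abelian_group C" ..
  qed (auto simp: quotient_algebra_carrier quotient_algebra_ops A.smult_l_distr A.smult_r_distr A.smult_assoc1)
  then show ?thesis
    by (rule assoc_algebra.intro[OF _ ring])
       (auto intro!: assoc_algebra_axioms.intro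
          simp: quotient_algebra_carrier quotient_algebra_ops A.smult_mult_left A.smult_mult_right)
qed

lemma quotient_algebra_lift:
  assumes B: "assoc_algebra K B" and h: "h \<in> algebra_hom K A B" and ker: "\<And>i. i \<in> I \<Longrightarrow> h i = \<zero>\<^bsub>B\<^esub>"
  shows "\<exists>g \<in> algebra_hom K C B. \<forall>x \<in> carrier A. g (I +>\<^bsub>A\<^esub> x) = h x"
proof -
  interpret B: assoc_algebra K B by (rule B)
  have hr: "h \<in> ring_hom A B" and hl: "h \<in> linear_map K A B" using h by (auto simp: algebra_hom_def)
  define g where "g = (\<lambda>X. the_elem (h ` X))"
  have g: "g (I +>\<^bsub>A\<^esub> x) = h x" if x: "x \<in> carrier A" for x
  proof -
    have "h y = h x" if yx: "y \<in> I +>\<^bsub>A\<^esub> x" for y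
    proof -
      obtain i where i: "i \<in> I" and y: "y = i \<oplus>\<^bsub>A\<^esub> x" using yx unfolding mem_coset by blast
      have iA: "i \<in> carrier A" using i I.a_subset by blast
      show ?thesis unfolding y linear_mapD(2)[OF hl iA x] ker[OF i]
        using linear_mapD(1)[OF hl x] by simp
    qed
    moreover have "x \<in> I +>\<^bsub>A\<^esub> x" using I.a_rcos_self[OF x] .
    ultimately have "h ` (I +>\<^bsub>A\<^esub> x) = {h x}" by blast
    then show ?thesis by (simp add: g_def)
  qed
  have "g \<in> ring_hom C B"
    using ring_hom_closed[OF hr] ring_hom_mult[OF hr] ring_hom_add[OF hr] ring_hom_one[OF hr]
    by (intro ring_hom_memI) (auto simp: quotient_algebra_carrier quotient_algebra_ops g)
  moreover have "g \<in> linear_map K C B"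
    using linear_mapD[OF hl]
    by (intro linear_mapI) (auto simp: quotient_algebra_carrier quotient_algebra_ops g)
  ultimately show ?thesis using g by (auto simp: algebra_hom_def)
qed

end

lemma words_monoid: "monoid (words X)"
  by (rule monoidI) (auto simp: words_def)

theorem clifford_algebra_universal:
  fixes K :: "('k, 'm) ring_scheme" and V :: "('k, 'v, 'n) module_scheme"
  assumes V: "module K V" and q: "q \<in> carrier V \<rightarrow> carrier K"
  shows "assoc_algebra K (clifford_algebra K V q)"
    and "clifford_map K V q \<in> linear_map K V (clifford_algebra K V q)"
    and "v \<in> carrier V \<Longrightarrow> clifford_map K V q v \<otimes>\<^bsub>clifford_algebra K V q\<^esub> clifford_map K V q v
           = q v \<odot>\<^bsub>clifford_algebra K V q\<^esub> \<one>\<^bsub>clifford_algebra K V q\<^esub>"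
    and "\<lbrakk>assoc_algebra K A; f \<in> linear_map K V A;
          \<And>v. v \<in> carrier V \<Longrightarrow> f v \<otimes>\<^bsub>A\<^esub> f v = q v \<odot>\<^bsub>A\<^esub> \<one>\<^bsub>A\<^esub>\<rbrakk>
       \<Longrightarrow> \<exists>h \<in> algebra_hom K (clifford_algebra K V q) A.
             (\<forall>v \<in> carrier V. h (clifford_map K V q v) = f v) \<and>
             (\<forall>h' \<in> algebra_hom K (clifford_algebra K V q) A.
                (\<forall>v \<in> carrier V. h' (clifford_map K V q v) = f v) \<longrightarrow>
                (\<forall>x \<in> carrier (clifford_algebra K V q). h' x = h x))"
proof -
  interpret V: module K V by (rule V)
  define T where "T = monoid_algebra K (words (carrier V))"
  define I where "I = Idl\<^bsub>T\<^esub> (clifford_relations K V q)"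
  let ?C = "quotient_algebra T I"
  let ?j = "\<lambda>v. I +>\<^bsub>T\<^esub> delta K [v]"
  have C_eq: "clifford_algebra K V q = ?C" by (simp add: clifford_algebra_def T_def I_def Let_def)
  have j_eq: "clifford_map K V q = ?j" by (simp add: clifford_map_def T_def I_def Let_def fun_eq_iff)
  have Talg: "assoc_algebra K T"
    unfolding T_def by (rule monoid_algebra_assoc_algebra[OF V.R.is_cring words_monoid])
  interpret T: assoc_algebra K T by (rule Talg)
  have dT: "delta K w \<in> carrier T" if "w \<in> lists (carrier V)" for w
    unfolding T_def by (rule delta_closed[OF V.R.is_cring words_monoid]) (use that in \<open>simp add: words_def\<close>)
  have d1: "delta K [v] \<in> carrier T" if "v \<in> carrier V" for v using dT[of "[v]"] that by simp
  have qK: "q v \<in> carrier K" if "v \<in> carrier V" for v using q that by blast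
  have dmult: "delta K (v # w) = delta K [v] \<otimes>\<^bsub>T\<^esub> delta K w" if "v \<in> carrier V" "w \<in> lists (carrier V)" for v w
    unfolding T_def
    by (subst delta_mult[OF V.R.is_cring words_monoid]) (use that in \<open>auto simp: words_def\<close>)
  have dempty: "delta K [] = \<one>\<^bsub>T\<^esub>" by (simp add: T_def monoid_algebra_eq words_def)
  have rels: "clifford_relations K V q =
     {delta K [v \<oplus>\<^bsub>V\<^esub> w] \<ominus>\<^bsub>T\<^esub> (delta K [v] \<oplus>\<^bsub>T\<^esub> delta K [w]) | v w. v \<in> carrier V \<and> w \<in> carrier V} \<union>
     {delta K [c \<odot>\<^bsub>V\<^esub> v] \<ominus>\<^bsub>T\<^esub> (c \<odot>\<^bsub>T\<^esub> delta K [v]) | c v. c \<in> carrier K \<and> v \<in> carrier V} \<union>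
     {(delta K [v] \<otimes>\<^bsub>T\<^esub> delta K [v]) \<ominus>\<^bsub>T\<^esub> (q v \<odot>\<^bsub>T\<^esub> \<one>\<^bsub>T\<^esub>) | v. v \<in> carrier V}"
    by (simp add: clifford_relations_def T_def Let_def)
  have rels_sub: "clifford_relations K V q \<subseteq> carrier T"
    unfolding rels using d1 qK by (auto intro!: T.minus_closed)
  have I: "ideal I T" unfolding I_def by (rule T.genideal_ideal[OF rels_sub])
  interpret I: ideal I T by (rule I)
  have rels_I: "clifford_relations K V q \<subseteq> I" unfolding I_def by (rule T.genideal_self[OF rels_sub])
  have r1: "delta K [v \<oplus>\<^bsub>V\<^esub> w] \<ominus>\<^bsub>T\<^esub> (delta K [v] \<oplus>\<^bsub>T\<^esub> delta K [w]) \<in> I"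
    if "v \<in> carrier V" "w \<in> carrier V" for v w
    using that by (intro subsetD[OF rels_I]) (unfold rels, blast)
  have r2: "delta K [c \<odot>\<^bsub>V\<^esub> v] \<ominus>\<^bsub>T\<^esub> (c \<odot>\<^bsub>T\<^esub> delta K [v]) \<in> I"
    if "c \<in> carrier K" "v \<in> carrier V" for c v
    using that by (intro subsetD[OF rels_I]) (unfold rels, blast)
  have r3: "(delta K [v] \<otimes>\<^bsub>T\<^esub> delta K [v]) \<ominus>\<^bsub>T\<^esub> (q v \<odot>\<^bsub>T\<^esub> \<one>\<^bsub>T\<^esub>) \<in> I"
    if "v \<in> carrier V" for v
    using that by (intro subsetD[OF rels_I]) (unfold rels, blast)
  note ops = quotient_algebra_ops[OF Talg I]
  note Ccar = quotient_algebra_carrier[OF Talg I]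
  have eqI: "I +>\<^bsub>T\<^esub> x = I +>\<^bsub>T\<^esub> y" if "x \<ominus>\<^bsub>T\<^esub> y \<in> I" "x \<in> carrier T" "y \<in> carrier T" for x y
    using T.quotient_eq_iff_same_a_r_cos[OF I that(2,3)] that(1) by blast
  show "assoc_algebra K (clifford_algebra K V q)"
    unfolding C_eq by (rule quotient_algebra_assoc_algebra[OF Talg I])
  show "clifford_map K V q \<in> linear_map K V (clifford_algebra K V q)"
    unfolding C_eq j_eq
  proof (rule linear_mapI)
    fix v assume v: "v \<in> carrier V"
    show "?j v \<in> carrier ?C" using d1[OF v] by (auto simp: Ccar)
    { fix w assume w: "w \<in> carrier V"
      have "I +>\<^bsub>T\<^esub> delta K [v \<oplus>\<^bsub>V\<^esub> w] = I +>\<^bsub>T\<^esub> (delta K [v] \<oplus>\<^bsub>T\<^esub> delta K [w])"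
        by (rule eqI[OF r1]) (use v w d1 in auto)
      then show "?j (v \<oplus>\<^bsub>V\<^esub> w) = ?j v \<oplus>\<^bsub>?C\<^esub> ?j w" using d1 v w by (simp add: ops) }
    { fix c assume c: "c \<in> carrier K"
      have "I +>\<^bsub>T\<^esub> delta K [c \<odot>\<^bsub>V\<^esub> v] = I +>\<^bsub>T\<^esub> (c \<odot>\<^bsub>T\<^esub> delta K [v])"
        by (rule eqI[OF r2]) (use v c d1 in auto)
      then show "?j (c \<odot>\<^bsub>V\<^esub> v) = c \<odot>\<^bsub>?C\<^esub> ?j v" using d1 v c by (simp add: ops) }
  qed
  show "clifford_map K V q v \<otimes>\<^bsub>clifford_algebra K V q\<^esub> clifford_map K V q v
      = q v \<odot>\<^bsub>clifford_algebra K V q\<^esub> \<one>\<^bsub>clifford_algebra K V q\<^esub>" if v: "v \<in> carrier V"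
  proof -
    have "I +>\<^bsub>T\<^esub> (delta K [v] \<otimes>\<^bsub>T\<^esub> delta K [v]) = I +>\<^bsub>T\<^esub> (q v \<odot>\<^bsub>T\<^esub> \<one>\<^bsub>T\<^esub>)"
      by (rule eqI[OF r3]) (use v d1 qK in auto)
    then show ?thesis unfolding C_eq j_eq using d1 v qK by (simp add: ops)
  qed
  show "\<exists>h \<in> algebra_hom K (clifford_algebra K V q) A.
             (\<forall>v \<in> carrier V. h (clifford_map K V q v) = f v) \<and>
             (\<forall>h' \<in> algebra_hom K (clifford_algebra K V q) A.
                (\<forall>v \<in> carrier V. h' (clifford_map K V q v) = f v) \<longrightarrow>
                (\<forall>x \<in> carrier (clifford_algebra K V q). h' x = h x))"
    if A: "assoc_algebra K A" and f: "f \<in> linear_map K V A"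
      and sq: "\<And>v. v \<in> carrier V \<Longrightarrow> f v \<otimes>\<^bsub>A\<^esub> f v = q v \<odot>\<^bsub>A\<^esub> \<one>\<^bsub>A\<^esub>"
  proof -
    interpret A: assoc_algebra K A by (rule A)
    define \<phi> where "\<phi> = (\<lambda>w. foldr (\<lambda>v a. f v \<otimes>\<^bsub>A\<^esub> a) w \<one>\<^bsub>A\<^esub>)"
    have \<phi>_cl: "\<phi> w \<in> carrier A" if "w \<in> lists (carrier V)" for w
      using that by (induction w) (auto simp: \<phi>_def linear_mapD(1)[OF f])
    have \<phi>_app: "\<phi> (w @ w') = \<phi> w \<otimes>\<^bsub>A\<^esub> \<phi> w'" if "w \<in> lists (carrier V)" "w' \<in> lists (carrier V)" for w w'
      using that(1)
    proof (induction w)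
      case Nil
      then show ?case using \<phi>_cl[OF that(2)] by (simp add: \<phi>_def)
    next
      case (Cons v w)
      then show ?case using \<phi>_cl[of w] \<phi>_cl[OF that(2)] linear_mapD(1)[OF f, of v]
        by (auto simp: \<phi>_def A.m_assoc)
    qed
    define h where "h = lin_ext K A \<phi>"
    have h: "h \<in> algebra_hom K T A"
      unfolding h_def T_def
      by (rule lin_ext_algebra_hom[OF V.R.is_cring words_monoid A])
         (use \<phi>_cl \<phi>_app in \<open>auto simp: words_def \<phi>_def\<close>)
    then have hr: "h \<in> ring_hom T A" and hl: "h \<in> linear_map K T A" by (auto simp: algebra_hom_def)
    have hd: "h (delta K [v]) = f v" if v: "v \<in> carrier V" for v
    proof -
      have "h (delta K [v]) = \<phi> [v]" unfolding h_def
        by (rule lin_ext_delta[OF A.module_axioms, of _ "lists (carrier V)"]) (use \<phi>_cl v in auto)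
      then show ?thesis using linear_mapD(1)[OF f v] by (simp add: \<phi>_def)
    qed
    interpret h: ring_hom_ring T A h
      by (rule ring_hom_ringI2[OF T.ring_axioms A.ring_axioms hr])
    have hminus: "h (x \<ominus>\<^bsub>T\<^esub> y) = \<zero>\<^bsub>A\<^esub>" if "h x = h y" "x \<in> carrier T" "y \<in> carrier T" for x y
      using that by (simp add: a_minus_def A.r_neg)
    have "clifford_relations K V q \<subseteq> a_kernel T A h"
    proof
      fix r assume r: "r \<in> clifford_relations K V q"
      have "h r = \<zero>\<^bsub>A\<^esub>"
        using r unfolding rels
      proof (elim UnE CollectE exE conjE)
        fix v w assume req: "r = delta K [v \<oplus>\<^bsub>V\<^esub> w] \<ominus>\<^bsub>T\<^esub> (delta K [v] \<oplus>\<^bsub>T\<^esub> delta K [w])"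
          and v: "v \<in> carrier V" and w: "w \<in> carrier V"
        have "h (delta K [v \<oplus>\<^bsub>V\<^esub> w]) = h (delta K [v] \<oplus>\<^bsub>T\<^esub> delta K [w])"
          using v w by (simp add: hd linear_mapD(2)[OF f] d1)
        then show ?thesis unfolding req by (rule hminus) (use v w d1 in auto)
      next
        fix c v assume req: "r = delta K [c \<odot>\<^bsub>V\<^esub> v] \<ominus>\<^bsub>T\<^esub> (c \<odot>\<^bsub>T\<^esub> delta K [v])"
          and c: "c \<in> carrier K" and v: "v \<in> carrier V"
        have "h (delta K [c \<odot>\<^bsub>V\<^esub> v]) = h (c \<odot>\<^bsub>T\<^esub> delta K [v])"
          using v c by (simp add: hd linear_mapD(3)[OF f] linear_mapD(3)[OF hl] d1)
        then show ?thesis unfolding req by (rule hminus) (use v c d1 in auto)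
      next
        fix v assume req: "r = (delta K [v] \<otimes>\<^bsub>T\<^esub> delta K [v]) \<ominus>\<^bsub>T\<^esub> (q v \<odot>\<^bsub>T\<^esub> \<one>\<^bsub>T\<^esub>)"
          and v: "v \<in> carrier V"
        have "h (delta K [v] \<otimes>\<^bsub>T\<^esub> delta K [v]) = h (q v \<odot>\<^bsub>T\<^esub> \<one>\<^bsub>T\<^esub>)"
          using v by (simp add: hd sq linear_mapD(3)[OF hl] d1 qK)
        then show ?thesis unfolding req by (rule hminus) (use v d1 qK in auto)
      qed
      then show "r \<in> a_kernel T A h" unfolding a_kernel_def' by (intro CollectI conjI subsetD[OF rels_sub r])
    qed
    then have "I \<subseteq> a_kernel T A h"
      unfolding I_def by (rule T.genideal_minimal[OF h.kernel_is_ideal])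
    then have ker: "h i = \<zero>\<^bsub>A\<^esub>" if "i \<in> I" for i
      using subsetD[OF _ that] unfolding a_kernel_def' by blast
    obtain g where g: "g \<in> algebra_hom K ?C A" and gh: "\<forall>x\<in>carrier T. g (I +>\<^bsub>T\<^esub> x) = h x"
      using quotient_algebra_lift[OF Talg I A h ker] by blast
    have uniq: "h' x = g x"
      if h': "h' \<in> algebra_hom K ?C A" and hj: "\<forall>v\<in>carrier V. h' (?j v) = f v" and x: "x \<in> carrier ?C" for h' x
    proof -
      have h'r: "h' \<in> ring_hom ?C A" and h'l: "h' \<in> linear_map K ?C A" using h' by (auto simp: algebra_hom_def)
      obtain t where t: "t \<in> carrier T" and xt: "x = I +>\<^bsub>T\<^esub> t" using x by (auto simp: Ccar)
      have proj: "(\<lambda>t. I +>\<^bsub>T\<^esub> t) \<in> linear_map K T ?C"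
        by (rule linear_mapI) (auto simp: Ccar ops)
      have T_free: "linear_map K T A = linear_map K (free_module K (lists (carrier V))) A"
        "carrier T = carrier (free_module K (lists (carrier V)))"
        by (simp_all add: T_def monoid_algebra_eq words_def linear_map_update)
      have "h' (I +>\<^bsub>T\<^esub> t) = h t"
      proof (rule linear_map_eqI[OF A.module_axioms, where f = t and h = "\<lambda>t. h' (I +>\<^bsub>T\<^esub> t)" and h' = h])
        show "(\<lambda>t. h' (I +>\<^bsub>T\<^esub> t)) \<in> linear_map K (free_module K (lists (carrier V))) A"
          using linear_map_comp[OF proj h'l] by (simp add: T_free)
        show "h \<in> linear_map K (free_module K (lists (carrier V))) A" using hl by (simp add: T_free)
        show "t \<in> carrier (free_module K (lists (carrier V)))" using t by (simp add: T_free)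
        fix w assume "w \<in> lists (carrier V)"
        then show "h' (I +>\<^bsub>T\<^esub> delta K w) = h (delta K w)"
        proof (induction w)
          case Nil
          then show ?case using ring_hom_one[OF h'r] by (simp add: dempty ops)
        next
          case (Cons v w)
          have v: "delta K [v] \<in> carrier T" "v \<in> carrier V" and w: "delta K w \<in> carrier T" "w \<in> lists (carrier V)"
            using Cons d1 dT by auto
          have "h' (I +>\<^bsub>T\<^esub> delta K (v # w)) = h' (?j v \<otimes>\<^bsub>?C\<^esub> (I +>\<^bsub>T\<^esub> delta K w))"
            unfolding dmult[OF v(2) w(2)] using v w by (simp add: ops)
          also have "\<dots> = f v \<otimes>\<^bsub>A\<^esub> h (delta K w)"
            using ring_hom_mult[OF h'r, of "?j v" "I +>\<^bsub>T\<^esub> delta K w"] v w hj Cons.IH by (simp add: Ccar)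
          also have "\<dots> = h (delta K (v # w))"
            unfolding dmult[OF v(2) w(2)] using v w by (simp add: hd)
          finally show ?case .
        qed
      qed
      then show ?thesis using gh t xt by simp
    qed
    show ?thesis
      unfolding C_eq j_eq
    proof (intro bexI[OF _ g] conjI ballI impI)
      show "g (?j v) = f v" if "v \<in> carrier V" for v using gh hd d1 that by simp
    qed (rule uniq)
  qed
qed


subsection \<open>The Clifford algebras of diagonal forms\<close>

text \<open>\<open>K\<^sup>n\<close> is the free module on \<open>{1..n}\<close>.\<close>

definition diagonal_form ::
  "('k, 'm) ring_scheme \<Rightarrow> nat \<Rightarrow> (nat \<Rightarrow> 'k) \<Rightarrow> (nat \<Rightarrow> 'k) \<Rightarrow> 'k" where
  "diagonal_form K n c v = (\<Oplus>\<^bsub>K\<^esub>i\<in>{1..n}. c i \<otimes>\<^bsub>K\<^esub> (v i \<otimes>\<^bsub>K\<^esub> v i))"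

definition Cl_t :: "('k, 'm) ring_scheme \<Rightarrow> one_or_Z list \<Rightarrow> ('k, ((nat \<Rightarrow> 'k) list \<Rightarrow> 'k) set) module" where
  "Cl_t K t = clifford_algebra K (free_module K {1..length t})
     (diagonal_form K (length t)
        (\<lambda>i. case t ! (i - 1) of One \<Rightarrow> \<one>\<^bsub>K\<^esub> | Zed \<Rightarrow> \<ominus>\<^bsub>K\<^esub> \<one>\<^bsub>K\<^esub>))"

definition Cl_pq :: "('k, 'm) ring_scheme \<Rightarrow> nat \<Rightarrow> nat \<Rightarrow> ('k, ((nat \<Rightarrow> 'k) list \<Rightarrow> 'k) set) module" where
  "Cl_pq K p q = clifford_algebra K (free_module K {1..p + q})
     (diagonal_form K (p + q) (\<lambda>i. if i \<le> p then \<one>\<^bsub>K\<^esub> else \<ominus>\<^bsub>K\<^esub> \<one>\<^bsub>K\<^esub>))"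

end

theory Submission
  imports Defs
begin

text \<open>
  The unit of \<open>K[G]\<^sup>s\<close>, \<open>s = \<plusminus>1\<close>, is the central idempotent \<open>u = (\<delta>\<^sub>1 + s \<delta>\<^sub>Z) / 2\<close>. The elements \<open>e g = u \<delta>\<^sub>g\<close>
  span \<open>K[G]\<^sup>s\<close> and multiply as \<open>e g e h = e (g h)\<close>, subject only to \<open>e (Z g) = s e g\<close>: a function \<open>\<phi>\<close> on \<open>G\<close>
  with \<open>\<phi> (Z g) = s \<phi> g\<close> extends to a unique linear map on \<open>K[G]\<^sup>s\<close> with \<open>e g \<mapsto> \<phi> g\<close>. Hence
  \<open>e [x, y] \<mapsto> e x \<otimes> e y\<close> and the bilinear map \<open>(e x, e y) \<mapsto> e [x, y]\<close> are well defined and inverse to each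
  other. For \<open>s = -1\<close> the element \<open>e g\<close> is homogeneous of degree \<open>d g\<close>, so the power of \<open>Z\<close> in the product of
  \<open>G\<^sub>1 \<times> G\<^sub>2\<close> becomes the sign of the graded tensor product.

  The group \<open>Q(t)\<close> is presented by a central involution \<open>Z\<close> and generators of square 1 or \<open>Z\<close> that commute up
  to \<open>Z\<close>. Modulo \<open>Z\<close> this is the power set group, which gives \<open>K[Q(t)]\<^sup>+\<close>. For \<open>K[Q(t)]\<^sup>-\<close>, where \<open>Z\<close> acts as
  \<open>-1\<close>, the presentation matches that of the Clifford algebra, and the two universal properties give mutually
  inverse homomorphisms.
\<close>

section \<open>Centrally graded groups\<close>

text \<open>The ideals K[G]^s are handled through the family of the \<open>e g\<close>, which spans
  but is not linearly independent. So no linear map is defined on it directly: maps are extended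
  from the basis of deltas and restricted, and the average (x + s (s x)) / 2 = x yields the intended
  value on \<open>e g\<close>. This is where 2 has to be invertible. The product of a graded tensor
  product is given on a free module over pairs, where it is bilinear but in general neither
  associative nor unital, so quotients of rings by ideals do not apply. Instead the free module is
  mapped onto K[G]^s, the submodule of tensor relations is recognized as the kernel, and the
  isomorphism runs from K[G]^s to the quotient by taking fibres. The ring axioms never have to be
  checked in the quotient. The elements of Q(t) are nested, relabelled classes. The locale
  \<open>graded_product_of\<close> hides this: the arguments about Q(t) see only that
  \<open>Q (t # ts)\<close> is a graded product of \<open>Q1 t\<close> and \<open>Q ts\<close>,
  where \<open>ts\<close> may be empty.\<close>

context centrally_graded_group
begin

text \<open>The exponents are sums of products of degrees, hence integers, but only their parity
  matters. With this operator every power of Z can be collected in front of a product, after which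
  \<open>zmul_cong\<close> leaves a parity check.\<close>

definition zmul :: "int \<Rightarrow> 'a \<Rightarrow> 'a" where
  "zmul k x = gelt G [^] k \<otimes> x"

lemma gdeg_cases:
  assumes "x \<in> carrier G"
  obtains "gdeg G x = 0" | "gdeg G x = 1"
proof -
  have "gdeg G x \<in> carrier (integer_mod_group 2)"
    using gdeg_hom assms by (auto simp: hom_def)
  then have "0 \<le> gdeg G x \<and> gdeg G x < 2" by (simp add: carrier_integer_mod_group)
  then have "gdeg G x = 0 \<or> gdeg G x = 1" by linarith
  then show ?thesis using that by blast
qed

lemma gdeg_mod [simp]: "x \<in> carrier G \<Longrightarrow> gdeg G x mod 2 = gdeg G x"
  by (erule gdeg_cases) auto

lemma gdeg_mult [simp]:
  "\<lbrakk>x \<in> carrier G; y \<in> carrier G\<rbrakk> \<Longrightarrow> gdeg G (x \<otimes> y) = (gdeg G x + gdeg G y) mod 2"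
  using gdeg_hom by (auto simp: hom_def)

lemma gdeg_one [simp]: "gdeg G \<one> = 0"
  using hom_one[OF gdeg_hom is_group] by simp

lemma gelt_pow: "gelt G [^] (k::int) = (if even k then \<one> else gelt G)"
proof -
  have two: "gelt G [^] (2 * m) = \<one>" for m :: int
  proof -
    have "gelt G [^] (2::int) = \<one>"
      using int_pow_mult[OF gelt_closed, of 1 1] gelt_closed gelt_square by simp
    then show ?thesis by (metis gelt_closed int_pow_one int_pow_pow)
  qed
  show ?thesis
  proof (cases "even k")
    case True
    then show ?thesis using two by (auto elim: evenE)
  next
    case False
    then obtain m where "k = 2 * m + 1" by (auto elim: oddE)
    then show ?thesis
      using int_pow_mult[OF gelt_closed, of "2 * m" 1] two gelt_closed by simp
  qed
qed

lemma zmul_closed [simp]: "x \<in> carrier G \<Longrightarrow> zmul k x \<in> carrier G"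
  using gelt_closed by (simp add: zmul_def)

lemma zmul_even: "\<lbrakk>even k; x \<in> carrier G\<rbrakk> \<Longrightarrow> zmul k x = x"
  by (simp add: zmul_def gelt_pow)

lemma zmul_0 [simp]: "x \<in> carrier G \<Longrightarrow> zmul 0 x = x"
  by (simp add: zmul_even)

lemma zmul_odd: "odd k \<Longrightarrow> zmul k x = gelt G \<otimes> x"
  by (simp add: zmul_def gelt_pow)

lemma zmul_cong: "even (k - l) \<Longrightarrow> zmul k x = zmul l x"
  by (simp add: zmul_def gelt_pow)

lemma zmul_zmul: "x \<in> carrier G \<Longrightarrow> zmul k (zmul l x) = zmul (k + l) x"
  using gelt_closed by (simp add: zmul_def int_pow_mult m_assoc)

lemma zmul_mult: "\<lbrakk>x \<in> carrier G; y \<in> carrier G\<rbrakk> \<Longrightarrow> zmul k x \<otimes> y = zmul k (x \<otimes> y)"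
  using gelt_closed by (simp add: zmul_def m_assoc)

lemma mult_zmul: "\<lbrakk>x \<in> carrier G; y \<in> carrier G\<rbrakk> \<Longrightarrow> x \<otimes> zmul k y = zmul k (x \<otimes> y)"
  using gelt_closed gelt_central[of x] by (simp add: zmul_def gelt_pow m_assoc[symmetric])

lemma gdeg_zmul [simp]: "x \<in> carrier G \<Longrightarrow> gdeg G (zmul k x) = gdeg G x"
  using gelt_closed by (simp add: zmul_def gelt_pow gdeg_gelt)

lemma zmul_one_eq_gelt: "zmul 1 \<one> = gelt G"
  using gelt_closed by (simp add: zmul_odd)

end

text \<open>A graded product up to isomorphism: \<open>q x y\<close> stands for the class \<open>[x, y]\<close>.\<close>

locale graded_product_of = G1: centrally_graded_group G1 + G2: centrally_graded_group G2
  for G1 :: "('a, 'm) graded_group_scheme" and G2 :: "('b, 'n) graded_group_scheme" +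
  fixes G :: "('c, 'o) graded_group_scheme" and q :: "'a \<Rightarrow> 'b \<Rightarrow> 'c"
  assumes nontrivial: "gelt G1 \<noteq> \<one>\<^bsub>G1\<^esub>" "gelt G2 \<noteq> \<one>\<^bsub>G2\<^esub>"
    and carrier_eq: "carrier G = (\<lambda>(x, y). q x y) ` (carrier G1 \<times> carrier G2)"
    and q_eq_iff: "\<lbrakk>x \<in> carrier G1; x' \<in> carrier G1; y \<in> carrier G2; y' \<in> carrier G2\<rbrakk> \<Longrightarrow>
      q x y = q x' y' \<longleftrightarrow> (x' = x \<and> y' = y) \<or> (x' = gelt G1 \<otimes>\<^bsub>G1\<^esub> x \<and> y' = gelt G2 \<otimes>\<^bsub>G2\<^esub> y)"
    and q_mult: "\<lbrakk>x \<in> carrier G1; x' \<in> carrier G1; y \<in> carrier G2; y' \<in> carrier G2\<rbrakk> \<Longrightarrow>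
      q x y \<otimes>\<^bsub>G\<^esub> q x' y' =
        q (gelt G1 [^]\<^bsub>G1\<^esub> (gdeg G1 x' * gdeg G2 y) \<otimes>\<^bsub>G1\<^esub> (x \<otimes>\<^bsub>G1\<^esub> x')) (y \<otimes>\<^bsub>G2\<^esub> y')"
    and one_eq: "\<one>\<^bsub>G\<^esub> = q \<one>\<^bsub>G1\<^esub> \<one>\<^bsub>G2\<^esub>"
    and gelt_eq: "gelt G = q (gelt G1) \<one>\<^bsub>G2\<^esub>"
    and gdeg_q: "\<lbrakk>x \<in> carrier G1; y \<in> carrier G2\<rbrakk> \<Longrightarrow> gdeg G (q x y) = (gdeg G1 x + gdeg G2 y) mod 2"
begin

lemma q_closed [simp]: "\<lbrakk>x \<in> carrier G1; y \<in> carrier G2\<rbrakk> \<Longrightarrow> q x y \<in> carrier G"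
  by (auto simp: carrier_eq)

lemma carrierE:
  assumes "X \<in> carrier G"
  obtains x y where "x \<in> carrier G1" "y \<in> carrier G2" "X = q x y"
  using assms by (auto simp: carrier_eq)

lemma q_mult_zmul:
  "\<lbrakk>x \<in> carrier G1; x' \<in> carrier G1; y \<in> carrier G2; y' \<in> carrier G2\<rbrakk> \<Longrightarrow>
    q x y \<otimes>\<^bsub>G\<^esub> q x' y' = q (G1.zmul (gdeg G1 x' * gdeg G2 y) (x \<otimes>\<^bsub>G1\<^esub> x')) (y \<otimes>\<^bsub>G2\<^esub> y')"
  by (simp add: q_mult G1.zmul_def)

text \<open>The axiom \<open>q_eq_iff\<close> multiplies both entries by their grading elements at
  once. Applied to (Z x, y), where Z Z x = x, it gives the one-sided form [Z x, y] =
  [x, Z y].\<close>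

lemma q_zmul:
  assumes "x \<in> carrier G1" "y \<in> carrier G2"
  shows "q x (G2.zmul k y) = q (G1.zmul k x) y"
proof (cases "even k")
  case False
  have "q (gelt G1 \<otimes>\<^bsub>G1\<^esub> x) y = q x (gelt G2 \<otimes>\<^bsub>G2\<^esub> y)"
    using assms G1.gelt_closed G2.gelt_closed
    by (simp add: q_eq_iff G1.m_assoc[symmetric] G1.gelt_square)
  then show ?thesis using False by (simp add: G1.zmul_odd G2.zmul_odd)
qed (simp add: assms G1.zmul_even G2.zmul_even)

lemma is_centrally_graded_group: "centrally_graded_group G"
proof -
  have group: "group G"
  proof (rule groupI)
    show "X \<otimes>\<^bsub>G\<^esub> Y \<in> carrier G" if "X \<in> carrier G" "Y \<in> carrier G" for X Y
      using that by (elim carrierE) (simp add: q_mult_zmul)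
    show "\<one>\<^bsub>G\<^esub> \<in> carrier G" by (simp add: one_eq)
    show "X \<otimes>\<^bsub>G\<^esub> Y \<otimes>\<^bsub>G\<^esub> W = X \<otimes>\<^bsub>G\<^esub> (Y \<otimes>\<^bsub>G\<^esub> W)"
      if X: "X \<in> carrier G" and Y: "Y \<in> carrier G" and W: "W \<in> carrier G" for X Y W
    proof -
      obtain x y where x: "x \<in> carrier G1" "y \<in> carrier G2" "X = q x y" using X by (rule carrierE)
      obtain x' y' where x': "x' \<in> carrier G1" "y' \<in> carrier G2" "Y = q x' y'" using Y by (rule carrierE)
      obtain x'' y'' where x'': "x'' \<in> carrier G1" "y'' \<in> carrier G2" "W = q x'' y''" using W by (rule carrierE)
      \<comment> \<open>Since degrees are additive modulo 2, both bracketings carry Z to a power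
        congruent to d(x')d(y) + d(x'')d(y) + d(x'')d(y').\<close>
      show ?thesis
        using x x' x''
        by (simp add: q_mult_zmul G1.zmul_mult G1.mult_zmul G1.zmul_zmul G1.m_assoc G2.m_assoc)
           (rule arg_cong2[where f = q, OF G1.zmul_cong refl],
            elim G1.gdeg_cases G2.gdeg_cases; simp)
    qed
    show "\<one>\<^bsub>G\<^esub> \<otimes>\<^bsub>G\<^esub> X = X" if "X \<in> carrier G" for X
      using that by (elim carrierE) (simp add: one_eq q_mult_zmul)
    show "\<exists>Y\<in>carrier G. Y \<otimes>\<^bsub>G\<^esub> X = \<one>\<^bsub>G\<^esub>" if X: "X \<in> carrier G" for X
    proof -
      obtain x y where x: "x \<in> carrier G1" "y \<in> carrier G2" "X = q x y" using X by (rule carrierE)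
      \<comment> \<open>This is the power of Z produced by [1/x, 1/y][x, y]. Inserting it once more
        into the candidate inverse makes the total exponent even.\<close>
      let ?k = "gdeg G1 x * gdeg G2 (inv\<^bsub>G2\<^esub> y)"
      have "q (G1.zmul ?k (inv\<^bsub>G1\<^esub> x)) (inv\<^bsub>G2\<^esub> y) \<otimes>\<^bsub>G\<^esub> X = \<one>\<^bsub>G\<^esub>"
        using x by (simp add: q_mult_zmul G1.zmul_mult G1.zmul_zmul G1.zmul_even one_eq)
      then show ?thesis using x by (meson G1.zmul_closed G1.inv_closed G2.inv_closed q_closed)
    qed
  qed
  interpret group G by (rule group)
  have gelt: "gelt G = q (G1.zmul 1 \<one>\<^bsub>G1\<^esub>) \<one>\<^bsub>G2\<^esub>" by (simp add: gelt_eq G1.zmul_one_eq_gelt)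
  show ?thesis
  proof
    show "gdeg G \<in> hom G (integer_mod_group 2)"
    proof (rule homI)
      show "gdeg G X \<in> carrier (integer_mod_group 2)" if "X \<in> carrier G" for X
        using that by (elim carrierE) (simp add: gdeg_q carrier_integer_mod_group)
      show "gdeg G (X \<otimes>\<^bsub>G\<^esub> Y) = gdeg G X \<otimes>\<^bsub>integer_mod_group 2\<^esub> gdeg G Y"
        if "X \<in> carrier G" "Y \<in> carrier G" for X Y
        using that by (elim carrierE) (simp add: q_mult_zmul gdeg_q, presburger)
    qed
    show "gelt G \<in> carrier G" by (simp add: gelt)
    show "gelt G \<otimes>\<^bsub>G\<^esub> X = X \<otimes>\<^bsub>G\<^esub> gelt G" if "X \<in> carrier G" for X
      using that by (elim carrierE) (simp add: gelt q_mult_zmul G1.zmul_mult G1.mult_zmul)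
    show "gelt G \<otimes>\<^bsub>G\<^esub> gelt G = \<one>\<^bsub>G\<^esub>"
      by (simp add: gelt q_mult_zmul G1.zmul_mult G1.zmul_zmul G1.zmul_even one_eq)
    show "gdeg G (gelt G) = 0" by (simp add: gelt gdeg_q)
  qed
qed

sublocale G: centrally_graded_group G by (rule is_centrally_graded_group)

text \<open>An equality [Z, 1] = [1, 1] would force one of the two grading elements to be trivial.
  Hence a graded product may again serve as a factor, which the recursion for Q(t) requires.\<close>

lemma gelt_neq_one: "gelt G \<noteq> \<one>\<^bsub>G\<^esub>"
  using nontrivial G1.gelt_closed G2.gelt_closed by (simp add: gelt_eq one_eq q_eq_iff)

lemma zmul_q: "\<lbrakk>x \<in> carrier G1; y \<in> carrier G2\<rbrakk> \<Longrightarrow> G.zmul k (q x y) = q (G1.zmul k x) y"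
  using G1.gelt_closed
  by (cases "even k")
     (simp_all add: G.zmul_even G1.zmul_even G.zmul_odd G1.zmul_odd gelt_eq q_mult)

lemma q_gelt:
  assumes "x \<in> carrier G1" "y \<in> carrier G2"
  shows "q (gelt G1 \<otimes>\<^bsub>G1\<^esub> x) y = gelt G \<otimes>\<^bsub>G\<^esub> q x y" "q x (gelt G2 \<otimes>\<^bsub>G2\<^esub> y) = gelt G \<otimes>\<^bsub>G\<^esub> q x y"
  using zmul_q[OF assms, of 1] q_zmul[OF assms, of 1] by (simp_all add: G.zmul_odd G1.zmul_odd G2.zmul_odd)

text \<open>Functions on G are functions of pairs that are constant on classes, and a class consists
  of (x, y) and (Z x, Z y) only.\<close>

lemma q_lift:
  assumes "\<And>x y. \<lbrakk>x \<in> carrier G1; y \<in> carrier G2\<rbrakk> \<Longrightarrow>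
    \<beta> (gelt G1 \<otimes>\<^bsub>G1\<^esub> x) (gelt G2 \<otimes>\<^bsub>G2\<^esub> y) = \<beta> x y"
  obtains \<phi> where "\<And>x y. \<lbrakk>x \<in> carrier G1; y \<in> carrier G2\<rbrakk> \<Longrightarrow> \<phi> (q x y) = \<beta> x y"
proof
  define \<phi> where "\<phi> X = (THE b. \<exists>x\<in>carrier G1. \<exists>y\<in>carrier G2. X = q x y \<and> b = \<beta> x y)" for X
  show "\<phi> (q x y) = \<beta> x y" if "x \<in> carrier G1" "y \<in> carrier G2" for x y
    unfolding \<phi>_def
  proof (rule the_equality)
    show "b = \<beta> x y" if "\<exists>x'\<in>carrier G1. \<exists>y'\<in>carrier G2. q x y = q x' y' \<and> b = \<beta> x' y'" for b
      using that assms \<open>x \<in> carrier G1\<close> \<open>y \<in> carrier G2\<close> by (auto simp: q_eq_iff)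
  qed (use that in blast)
qed

end

section \<open>The quotient set as an instance of the abstract graded product\<close>

lemma gcls_eq:
  assumes "centrally_graded_group G1" "centrally_graded_group G2" "x \<in> carrier G1" "y \<in> carrier G2"
  shows "gcls G1 G2 (x, y) = {(x, y), (gelt G1 \<otimes>\<^bsub>G1\<^esub> x, gelt G2 \<otimes>\<^bsub>G2\<^esub> y)}"
proof -
  interpret G1: centrally_graded_group G1 by fact
  interpret G2: centrally_graded_group G2 by fact
  define R where "R = gprod_rel G1 G2 \<union> (gprod_rel G1 G2)\<inverse>"
  define C where "C = {(x, y), (gelt G1 \<otimes>\<^bsub>G1\<^esub> x, gelt G2 \<otimes>\<^bsub>G2\<^esub> y)}"
  have z1: "gelt G1 \<otimes>\<^bsub>G1\<^esub> (gelt G1 \<otimes>\<^bsub>G1\<^esub> a) = a" if "a \<in> carrier G1" for a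
    using that G1.gelt_closed by (simp add: G1.m_assoc[symmetric] G1.gelt_square)
  have z2: "gelt G2 \<otimes>\<^bsub>G2\<^esub> (gelt G2 \<otimes>\<^bsub>G2\<^esub> a) = a" if "a \<in> carrier G2" for a
    using that G2.gelt_closed by (simp add: G2.m_assoc[symmetric] G2.gelt_square)
  \<comment> \<open>A generating step from (Z a, b) to (a, Z b), in either direction, multiplies
    both entries by Z because Z Z = 1. It therefore exchanges the two elements of
    \<open>C\<close>.\<close>
  have R: "p' \<in> C" if "(p, p') \<in> R" "p \<in> C" for p p'
    using that assms(3,4) G1.gelt_closed G2.gelt_closed z1 z2
    by (auto simp: R_def gprod_rel_def C_def)
  have sub: "p \<in> C" if "((x, y), p) \<in> R\<^sup>*" for p
    using that
  proof (induction rule: rtrancl_induct)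
    case base
    then show ?case by (simp add: C_def)
  next
    case (step p p')
    then show ?case using R by blast
  qed
  have "((gelt G1 \<otimes>\<^bsub>G1\<^esub> (gelt G1 \<otimes>\<^bsub>G1\<^esub> x), y), (gelt G1 \<otimes>\<^bsub>G1\<^esub> x, gelt G2 \<otimes>\<^bsub>G2\<^esub> y)) \<in> R"
    using assms(3,4) G1.gelt_closed by (auto simp: R_def gprod_rel_def)
  then have "((x, y), (gelt G1 \<otimes>\<^bsub>G1\<^esub> x, gelt G2 \<otimes>\<^bsub>G2\<^esub> y)) \<in> R" using z1 assms(3) by simp
  then have "C \<subseteq> R\<^sup>* `` {(x, y)}" by (auto simp: C_def)
  then show ?thesis using sub by (auto simp: gcls_def R_def[symmetric] C_def[symmetric])
qed

lemma graded_product_of_graded_product: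
  assumes G1: "centrally_graded_group G1" and G2: "centrally_graded_group G2"
    and nontrivial: "gelt G1 \<noteq> \<one>\<^bsub>G1\<^esub>" "gelt G2 \<noteq> \<one>\<^bsub>G2\<^esub>"
  shows "graded_product_of G1 G2 (graded_product G1 G2) (\<lambda>x y. gcls G1 G2 (x, y))"
proof -
  interpret G1: centrally_graded_group G1 by fact
  interpret G2: centrally_graded_group G2 by fact
  note cls = gcls_eq[OF G1 G2]
  have z1: "gelt G1 \<otimes>\<^bsub>G1\<^esub> (gelt G1 \<otimes>\<^bsub>G1\<^esub> a) = a" if "a \<in> carrier G1" for a
    using that G1.gelt_closed by (simp add: G1.m_assoc[symmetric] G1.gelt_square)
  have z2: "gelt G2 \<otimes>\<^bsub>G2\<^esub> (gelt G2 \<otimes>\<^bsub>G2\<^esub> a) = a" if "a \<in> carrier G2" for a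
    using that G2.gelt_closed by (simp add: G2.m_assoc[symmetric] G2.gelt_square)
  have swap1: "gcls G1 G2 (G1.zmul k x, G2.zmul l y) = gcls G1 G2 (G1.zmul (k + l) x, y)"
    if "x \<in> carrier G1" "y \<in> carrier G2" for x y k l
    using that G1.gelt_closed G2.gelt_closed
    by (cases "even k"; cases "even l")
       (auto simp: cls G1.zmul_even G2.zmul_even G1.zmul_odd G2.zmul_odd z1 z2)
  show ?thesis
  proof (rule graded_product_of.intro[OF G1 G2 graded_product_of_axioms.intro])
    show "gelt G1 \<noteq> \<one>\<^bsub>G1\<^esub>" "gelt G2 \<noteq> \<one>\<^bsub>G2\<^esub>" by fact+
    show "carrier (graded_product G1 G2) = (\<lambda>(x, y). gcls G1 G2 (x, y)) ` (carrier G1 \<times> carrier G2)"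
      by (simp add: graded_product_def)
    show "gcls G1 G2 (x, y) = gcls G1 G2 (x', y') \<longleftrightarrow>
        (x' = x \<and> y' = y) \<or> (x' = gelt G1 \<otimes>\<^bsub>G1\<^esub> x \<and> y' = gelt G2 \<otimes>\<^bsub>G2\<^esub> y)"
      if "x \<in> carrier G1" "x' \<in> carrier G1" "y \<in> carrier G2" "y' \<in> carrier G2" for x x' y y'
      using that by (auto simp: cls doubleton_eq_iff z1 z2)
    show "gcls G1 G2 (x, y) \<otimes>\<^bsub>graded_product G1 G2\<^esub> gcls G1 G2 (x', y') =
        gcls G1 G2 (gelt G1 [^]\<^bsub>G1\<^esub> (gdeg G1 x' * gdeg G2 y) \<otimes>\<^bsub>G1\<^esub> (x \<otimes>\<^bsub>G1\<^esub> x'), y \<otimes>\<^bsub>G2\<^esub> y')"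
      (is "_ = ?r")
      if c: "x \<in> carrier G1" "x' \<in> carrier G1" "y \<in> carrier G2" "y' \<in> carrier G2" for x x' y y'
    proof -
      have r: "?r = gcls G1 G2 (G1.zmul (gdeg G1 x' * gdeg G2 y) (x \<otimes>\<^bsub>G1\<^esub> x'), y \<otimes>\<^bsub>G2\<^esub> y')"
        by (simp add: G1.zmul_def)
      have cls': "gcls G1 G2 (a, b) = (\<lambda>k. (G1.zmul k a, G2.zmul k b)) ` {0, 1}"
        if "a \<in> carrier G1" "b \<in> carrier G2" for a b
        using that by (simp add: cls G1.zmul_odd G2.zmul_odd)
      \<comment> \<open>The product is a union over all representatives of both classes. Passing to
        (Z^k x, Z^k y) and (Z^l x', Z^l y') leaves the degrees alone and adds k + l to the exponent
        from each factor, an even change in total. So all sets in the union coincide.\<close>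
      have "gcls G1 G2 (G1.zmul (gdeg G1 (G1.zmul l x') * gdeg G2 (G2.zmul k y))
              (G1.zmul k x \<otimes>\<^bsub>G1\<^esub> G1.zmul l x'), G2.zmul k y \<otimes>\<^bsub>G2\<^esub> G2.zmul l y') = ?r" for k l
      proof -
        have "gcls G1 G2 (G1.zmul (gdeg G1 (G1.zmul l x') * gdeg G2 (G2.zmul k y))
              (G1.zmul k x \<otimes>\<^bsub>G1\<^esub> G1.zmul l x'), G2.zmul k y \<otimes>\<^bsub>G2\<^esub> G2.zmul l y')
          = gcls G1 G2 (G1.zmul (gdeg G1 x' * gdeg G2 y + k + l + (k + l)) (x \<otimes>\<^bsub>G1\<^esub> x'), y \<otimes>\<^bsub>G2\<^esub> y')"
          using c by (simp add: G1.zmul_mult G1.mult_zmul G2.zmul_mult G2.mult_zmul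
              G1.zmul_zmul G2.zmul_zmul swap1 ac_simps)
        also have "\<dots> = ?r" unfolding r by (subst G1.zmul_cong[where l = "gdeg G1 x' * gdeg G2 y"]) auto
        finally show ?thesis .
      qed
      then show ?thesis
        unfolding graded_product_def monoid.simps cls'[OF c(1,3)] cls'[OF c(2,4)] G1.zmul_def[symmetric]
        by (simp add: split_def)
    qed
    show "gdeg (graded_product G1 G2) (gcls G1 G2 (x, y)) = (gdeg G1 x + gdeg G2 y) mod 2"
      if "x \<in> carrier G1" "y \<in> carrier G2" for x y
      using that G1.gelt_closed G2.gelt_closed
      by (simp add: graded_product_def cls G1.gdeg_gelt G2.gdeg_gelt)
  qed (simp_all add: graded_product_def)
qed

section \<open>The sign ideals of a group algebra\<close>

text \<open>Taking \<open>s\<close> to be any square root of 1 develops both signs at once; the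
  value of \<open>s\<close> is fixed only where the two ideals behave differently.\<close>

locale sign_algebra = K: cring K + G: centrally_graded_group G
  for K :: "('k, 'm) ring_scheme" and G :: "('g, 'n) graded_group_scheme" and s :: 'k +
  assumes two_unit: "\<one>\<^bsub>K\<^esub> \<oplus>\<^bsub>K\<^esub> \<one>\<^bsub>K\<^esub> \<in> Units K"
    and s_closed [simp]: "s \<in> carrier K" and s_square: "s \<otimes>\<^bsub>K\<^esub> s = \<one>\<^bsub>K\<^esub>"
begin

abbreviation "A \<equiv> monoid_algebra K G"
abbreviation "S \<equiv> sign_ideal K s G"
abbreviation "half \<equiv> inv\<^bsub>K\<^esub> (\<one>\<^bsub>K\<^esub> \<oplus>\<^bsub>K\<^esub> \<one>\<^bsub>K\<^esub>)"

definition e :: "'g \<Rightarrow> 'g \<Rightarrow> 'k" where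
  "e g = half \<odot>\<^bsub>A\<^esub> (delta K g \<oplus>\<^bsub>A\<^esub> s \<odot>\<^bsub>A\<^esub> delta K (gelt G \<otimes>\<^bsub>G\<^esub> g))"

sublocale A: assoc_algebra K A
  by (rule monoid_algebra_assoc_algebra[OF K.is_cring G.is_monoid])

lemmas delta_A [simp] = delta_closed[OF K.is_cring G.is_monoid]
lemmas delta_mult_A = delta_mult[OF K.is_cring G.is_monoid]

lemma A_simps:
  "carrier A = carrier (free_module K (carrier G))"
  "\<one>\<^bsub>A\<^esub> = delta K \<one>\<^bsub>G\<^esub>"
  by (simp_all add: monoid_algebra_eq)

lemma linear_map_A: "linear_map K A M = linear_map K (free_module K (carrier G)) M"
  by (simp add: monoid_algebra_eq linear_map_update)

lemma A_eqI:
  assumes "module K M" "h \<in> linear_map K A M" "h' \<in> linear_map K A M"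
    and "\<And>x. x \<in> carrier G \<Longrightarrow> h (delta K x) = h' (delta K x)" and "f \<in> carrier A"
  shows "h f = h' f"
  by (rule linear_map_eqI[OF assms(1), of h "carrier G" h'])
     (use assms in \<open>simp_all add: linear_map_A A_simps\<close>)

lemma half_closed [simp]: "half \<in> carrier K"
  by (rule K.Units_inv_closed[OF two_unit])

text \<open>The averaging arguments rest on this: the idempotent acts as the identity on the ideal,
  linear extensions take the right value on \<open>e g\<close>, and homogeneous components are
  determined by twice their value.\<close>

lemma half_double:
  assumes "module K M" "x \<in> carrier M" shows "half \<odot>\<^bsub>M\<^esub> (x \<oplus>\<^bsub>M\<^esub> x) = x"
proof -
  interpret M: module K M by fact
  have "x \<oplus>\<^bsub>M\<^esub> x = (\<one>\<^bsub>K\<^esub> \<oplus>\<^bsub>K\<^esub> \<one>\<^bsub>K\<^esub>) \<odot>\<^bsub>M\<^esub> x"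
    using assms(2) by (simp add: M.smult_l_distr)
  then show ?thesis
    using assms(2) K.Units_l_inv[OF two_unit] M.smult_assoc1[of half "\<one>\<^bsub>K\<^esub> \<oplus>\<^bsub>K\<^esub> \<one>\<^bsub>K\<^esub>" x] by simp
qed

lemma s_s: "\<lbrakk>module K M; x \<in> carrier M\<rbrakk> \<Longrightarrow> s \<odot>\<^bsub>M\<^esub> (s \<odot>\<^bsub>M\<^esub> x) = x"
  using module.smult_assoc1[of K M s s x] by (simp add: s_square module.smult_one)

lemma pushforward_linear:
  "\<phi> \<in> carrier G \<rightarrow> carrier G \<Longrightarrow> pushforward K G \<phi> \<in> linear_map K A A"
  unfolding pushforward_def linear_map_A
  by (rule lin_ext_linear[OF A.module_axioms]) (auto simp: Pi_iff)

lemma pushforward_delta: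
  "\<lbrakk>\<phi> \<in> carrier G \<rightarrow> carrier G; x \<in> carrier G\<rbrakk> \<Longrightarrow> pushforward K G \<phi> (delta K x) = delta K (\<phi> x)"
  unfolding pushforward_def
  by (rule lin_ext_delta[OF A.module_axioms, of _ "carrier G"]) (auto simp: Pi_iff)

lemma A_mult_linear:
  "a \<in> carrier A \<Longrightarrow> (\<lambda>f. a \<otimes>\<^bsub>A\<^esub> f) \<in> linear_map K A A"
  "a \<in> carrier A \<Longrightarrow> (\<lambda>f. f \<otimes>\<^bsub>A\<^esub> a) \<in> linear_map K A A"
  by (auto intro!: linear_mapI simp: A.r_distr A.l_distr A.smult_mult_left A.smult_mult_right)

text \<open>It turns the condition defining the ideal into an equation in the ring K[G], so that the
  closure properties of the ideal follow from the ring laws.\<close>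

lemma pushforward_gelt:
  assumes "f \<in> carrier A"
  shows "pushforward K G (\<lambda>g. gelt G \<otimes>\<^bsub>G\<^esub> g) f = delta K (gelt G) \<otimes>\<^bsub>A\<^esub> f"
  by (rule A_eqI[OF A.module_axioms pushforward_linear A_mult_linear(1) _ assms])
     (use G.gelt_closed in \<open>auto simp: pushforward_delta delta_mult_A\<close>)

lemma delta_gelt_central:
  assumes "f \<in> carrier A"
  shows "f \<otimes>\<^bsub>A\<^esub> delta K (gelt G) = delta K (gelt G) \<otimes>\<^bsub>A\<^esub> f"
  by (rule A_eqI[OF A.module_axioms A_mult_linear(2) A_mult_linear(1) _ assms])
     (use G.gelt_closed in \<open>auto simp: delta_mult_A G.gelt_central\<close>)

lemma S_simps:
  "\<zero>\<^bsub>S\<^esub> = \<zero>\<^bsub>A\<^esub>" "add S = add A" "smult S = smult A" "monoid.mult S = monoid.mult A"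
  by (simp_all add: sign_ideal_def Let_def)

lemma S_carrier_iff:
  "f \<in> carrier S \<longleftrightarrow> f \<in> carrier A \<and> delta K (gelt G) \<otimes>\<^bsub>A\<^esub> f = s \<odot>\<^bsub>A\<^esub> f"
  using pushforward_gelt[of f] by (auto simp: sign_ideal_def Let_def)

lemma S_subset: "f \<in> carrier S \<Longrightarrow> f \<in> carrier A"
  by (simp add: S_carrier_iff)

lemma gelt_left: "g \<in> carrier G \<Longrightarrow> gelt G \<otimes>\<^bsub>G\<^esub> (gelt G \<otimes>\<^bsub>G\<^esub> g) = g"
  using G.gelt_closed by (simp add: G.m_assoc[symmetric] G.gelt_square)

lemma e_closed_A: "g \<in> carrier G \<Longrightarrow> e g \<in> carrier A"
  using G.gelt_closed by (simp add: e_def)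

lemma one_S: "\<one>\<^bsub>S\<^esub> = e \<one>\<^bsub>G\<^esub>"
  using G.gelt_closed by (simp add: sign_ideal_def Let_def e_def)

lemma e_gelt: "g \<in> carrier G \<Longrightarrow> e (gelt G \<otimes>\<^bsub>G\<^esub> g) = s \<odot>\<^bsub>A\<^esub> e g"
  using G.gelt_closed A.smult_assoc1[of s half] A.smult_assoc1[of half s]
  by (simp add: e_def gelt_left A.smult_r_distr K.m_comm[of s half] s_s[OF A.module_axioms] A.a_comm)

lemma e_eq: "g \<in> carrier G \<Longrightarrow> e g = e \<one>\<^bsub>G\<^esub> \<otimes>\<^bsub>A\<^esub> delta K g"
  using G.gelt_closed by (simp add: e_def A.smult_mult_left A.l_distr delta_mult_A)

lemma e_closed [simp]:
  assumes "g \<in> carrier G" shows "e g \<in> carrier S"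
proof -
  have "delta K (gelt G) \<otimes>\<^bsub>A\<^esub> e g = e (gelt G \<otimes>\<^bsub>G\<^esub> g)"
    using G.gelt_closed assms
    by (simp add: e_def A.smult_mult_right A.r_distr delta_mult_A)
  then show ?thesis using assms by (simp add: S_carrier_iff e_closed_A e_gelt)
qed

text \<open>On the ideal, multiplication by the delta of Z is multiplication by \<open>s\<close>, so
  (1 + s Z) / 2 acts as (1 + s s) / 2 = 1. The right-hand version uses that Z is central.\<close>

lemma e_one_mult:
  assumes "f \<in> carrier S"
  shows "e \<one>\<^bsub>G\<^esub> \<otimes>\<^bsub>A\<^esub> f = f" and "f \<otimes>\<^bsub>A\<^esub> e \<one>\<^bsub>G\<^esub> = f"
proof -
  have f: "f \<in> carrier A" "delta K (gelt G) \<otimes>\<^bsub>A\<^esub> f = s \<odot>\<^bsub>A\<^esub> f"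
    using assms by (auto simp: S_carrier_iff)
  note h = half_double[OF A.module_axioms f(1)] s_s[OF A.module_axioms f(1)]
  show "e \<one>\<^bsub>G\<^esub> \<otimes>\<^bsub>A\<^esub> f = f"
    using f h G.gelt_closed
    by (simp add: e_def A.smult_mult_left A.l_distr A_simps(2)[symmetric])
  show "f \<otimes>\<^bsub>A\<^esub> e \<one>\<^bsub>G\<^esub> = f"
    using f h G.gelt_closed
    by (simp add: e_def A.smult_mult_right A.r_distr A_simps(2)[symmetric] delta_gelt_central)
qed

lemma e_mult:
  assumes "x \<in> carrier G" "y \<in> carrier G" shows "e x \<otimes>\<^bsub>A\<^esub> e y = e (x \<otimes>\<^bsub>G\<^esub> y)"
proof -
  have "e x \<otimes>\<^bsub>A\<^esub> e y = (e x \<otimes>\<^bsub>A\<^esub> e \<one>\<^bsub>G\<^esub>) \<otimes>\<^bsub>A\<^esub> delta K y"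
    using assms by (simp add: e_eq[of y] A.m_assoc e_closed_A)
  also have "\<dots> = e \<one>\<^bsub>G\<^esub> \<otimes>\<^bsub>A\<^esub> delta K x \<otimes>\<^bsub>A\<^esub> delta K y"
    using assms by (simp add: e_one_mult e_eq[of x, symmetric])
  also have "\<dots> = e (x \<otimes>\<^bsub>G\<^esub> y)"
    using assms by (simp add: A.m_assoc e_closed_A delta_mult_A e_eq[of "x \<otimes>\<^bsub>G\<^esub> y"])
  finally show ?thesis .
qed

lemma S_mult_closed: "\<lbrakk>f \<in> carrier S; g \<in> carrier S\<rbrakk> \<Longrightarrow> f \<otimes>\<^bsub>A\<^esub> g \<in> carrier S"
  using G.gelt_closed by (auto simp: S_carrier_iff A.m_assoc[symmetric] A.smult_mult_left)

lemma S_add_closed: "\<lbrakk>f \<in> carrier S; g \<in> carrier S\<rbrakk> \<Longrightarrow> f \<oplus>\<^bsub>A\<^esub> g \<in> carrier S"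
  using G.gelt_closed by (auto simp: S_carrier_iff A.r_distr A.smult_r_distr)

lemma S_smult_closed: "\<lbrakk>c \<in> carrier K; f \<in> carrier S\<rbrakk> \<Longrightarrow> c \<odot>\<^bsub>A\<^esub> f \<in> carrier S"
  using G.gelt_closed
  by (auto simp: S_carrier_iff A.smult_mult_right A.smult_assoc1[symmetric] K.m_comm)

lemma S_uminus_closed: "f \<in> carrier S \<Longrightarrow> \<ominus>\<^bsub>A\<^esub> f \<in> carrier S"
  using G.gelt_closed by (auto simp: S_carrier_iff A.r_minus A.smult_r_minus)

lemma S_assoc_algebra: "assoc_algebra K S"
proof -
  note cl = S_add_closed S_mult_closed S_smult_closed
  have zero: "\<zero>\<^bsub>A\<^esub> \<in> carrier S" using G.gelt_closed by (simp add: S_carrier_iff)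
  have ab: "abelian_group S"
  proof (rule abelian_groupI)
    show "\<exists>g\<in>carrier S. g \<oplus>\<^bsub>S\<^esub> f = \<zero>\<^bsub>S\<^esub>" if "f \<in> carrier S" for f
      using S_uminus_closed[OF that] S_subset[OF that] A.l_neg by (auto simp: S_simps)
  qed (use S_subset in \<open>auto simp: S_simps zero cl A.a_ac\<close>)
  have "ring S"
  proof (rule ringI[OF ab])
    show "monoid S"
      by (rule monoidI) (use S_subset in \<open>auto simp: S_simps cl one_S e_one_mult A.m_assoc\<close>)
  qed (use S_subset in \<open>auto simp: S_simps A.l_distr A.r_distr\<close>)
  moreover have "module K S"
    by (rule moduleI[OF K.is_cring ab])
       (use S_subset in \<open>auto simp: S_simps cl A.smult_l_distr A.smult_r_distr A.smult_assoc1\<close>)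
  ultimately show ?thesis
    by (intro assoc_algebra.intro assoc_algebra_axioms.intro)
       (use S_subset in \<open>auto simp: S_simps A.smult_mult_left A.smult_mult_right\<close>)
qed

sublocale S: assoc_algebra K S by (rule S_assoc_algebra)

lemma e_mult_S [simp]: "\<lbrakk>x \<in> carrier G; y \<in> carrier G\<rbrakk> \<Longrightarrow> e x \<otimes>\<^bsub>S\<^esub> e y = e (x \<otimes>\<^bsub>G\<^esub> y)"
  by (simp add: S_simps e_mult)

lemma e_gelt_S: "g \<in> carrier G \<Longrightarrow> e (gelt G \<otimes>\<^bsub>G\<^esub> g) = s \<odot>\<^bsub>S\<^esub> e g"
  by (simp add: S_simps e_gelt)

lemma linear_map_restrict: "h \<in> linear_map K A M \<Longrightarrow> h \<in> linear_map K S M"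
  using S_subset by (auto simp: linear_map_def S_simps)

text \<open>Multiplication by the unit \<open>e \<one>\<close> of the ideal maps K[G] to the ideal,
  fixes the ideal, and takes the delta of g to \<open>e g\<close>. Composing with it reduces the
  claim to the basis of K[G].\<close>

lemma S_eqI:
  assumes M: "module K M" and h: "h \<in> linear_map K S M" and h': "h' \<in> linear_map K S M"
    and eq: "\<And>g. g \<in> carrier G \<Longrightarrow> h (e g) = h' (e g)" and f: "f \<in> carrier S"
  shows "h f = h' f"
proof -
  have P: "(\<lambda>f. e \<one>\<^bsub>G\<^esub> \<otimes>\<^bsub>A\<^esub> f) \<in> linear_map K A S"
  proof (rule linear_mapI)
    fix x assume x: "x \<in> carrier A"
    show "e \<one>\<^bsub>G\<^esub> \<otimes>\<^bsub>A\<^esub> x \<in> carrier S"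
      using x G.gelt_closed e_closed[of "\<one>\<^bsub>G\<^esub>"]
      by (simp add: S_carrier_iff A.m_assoc[symmetric] A.smult_mult_left)
  qed (auto simp: S_simps e_closed_A A.r_distr A.smult_mult_right)
  have "h (e \<one>\<^bsub>G\<^esub> \<otimes>\<^bsub>A\<^esub> f) = h' (e \<one>\<^bsub>G\<^esub> \<otimes>\<^bsub>A\<^esub> f)"
    by (rule A_eqI[OF M linear_map_comp[OF P h] linear_map_comp[OF P h'] _ S_subset[OF f]])
       (simp add: e_eq[symmetric] eq)
  then show ?thesis using f by (simp add: e_one_mult)
qed

lemma lin_ext_linear_S:
  assumes "module K M" "\<phi> \<in> carrier G \<rightarrow> carrier M"
  shows "lin_ext K M \<phi> \<in> linear_map K S M"
  using lin_ext_linear[OF assms] by (intro linear_map_restrict) (simp add: linear_map_A)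

text \<open>The extension is made on all of K[G], from \<phi> on the deltas. Its value at
  \<open>e g\<close> is (\<phi> g + s (s \<phi> g)) / 2, by the equivariance of \<phi> under
  Z.\<close>

lemma lin_ext_e:
  assumes M: "module K M" and \<phi>: "\<phi> \<in> carrier G \<rightarrow> carrier M"
    and \<phi>_gelt: "\<And>x. x \<in> carrier G \<Longrightarrow> \<phi> (gelt G \<otimes>\<^bsub>G\<^esub> x) = s \<odot>\<^bsub>M\<^esub> \<phi> x"
    and g: "g \<in> carrier G"
  shows "lin_ext K M \<phi> (e g) = \<phi> g"
proof -
  interpret M: module K M by fact
  have l: "lin_ext K M \<phi> \<in> linear_map K A M"
    using lin_ext_linear[OF M \<phi>] by (simp add: linear_map_A)
  have d: "lin_ext K M \<phi> (delta K x) = \<phi> x" if "x \<in> carrier G" for x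
    by (rule lin_ext_delta[OF M \<phi> that])
  have x: "\<phi> g \<in> carrier M" using \<phi> g by blast
  show ?thesis
    using g G.gelt_closed x
    by (simp add: e_def linear_mapD[OF l] d \<phi>_gelt s_s[OF M] half_double[OF M])
qed

end

section \<open>Tensor products\<close>

lemma linear_map_add:
  assumes "module K W" "f \<in> linear_map K V W" "g \<in> linear_map K V W"
  shows "(\<lambda>x. f x \<oplus>\<^bsub>W\<^esub> g x) \<in> linear_map K V W"
proof -
  interpret W: module K W by fact
  note f = linear_mapD[OF assms(2)] and g = linear_mapD[OF assms(3)]
  show ?thesis by (rule linear_mapI) (simp_all add: f g W.a_ac W.smult_r_distr)
qed

lemma linear_map_smult:
  assumes "module K W" "f \<in> linear_map K V W" "c \<in> carrier K"
  shows "(\<lambda>x. c \<odot>\<^bsub>W\<^esub> f x) \<in> linear_map K V W"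
proof -
  interpret W: module K W by fact
  note f = linear_mapD[OF assms(2)]
  show ?thesis
    by (rule linear_mapI)
       (use assms(3) in \<open>simp_all add: f W.smult_r_distr W.smult_assoc1[symmetric] W.R.m_comm\<close>)
qed

lemma linear_map_id: "(\<lambda>x. x) \<in> linear_map K V V"
  by (rule linear_mapI) auto

lemma linear_map_mult:
  assumes "assoc_algebra K W" "f \<in> linear_map K V W" "a \<in> carrier W"
  shows "(\<lambda>x. a \<otimes>\<^bsub>W\<^esub> f x) \<in> linear_map K V W" and "(\<lambda>x. f x \<otimes>\<^bsub>W\<^esub> a) \<in> linear_map K V W"
proof -
  interpret W: assoc_algebra K W by fact
  note f = linear_mapD[OF assms(2)]
  show "(\<lambda>x. a \<otimes>\<^bsub>W\<^esub> f x) \<in> linear_map K V W" "(\<lambda>x. f x \<otimes>\<^bsub>W\<^esub> a) \<in> linear_map K V W"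
    by (rule linear_mapI;
        use assms(3) in \<open>simp add: f W.l_distr W.r_distr W.smult_mult_left W.smult_mult_right\<close>)+
qed

section \<open>Quotient modules and the first isomorphism theorem\<close>

context
  fixes K :: "('k, 'm) ring_scheme" and M :: "('k, 'a, 'n) module_scheme" and I
  assumes M: "module K M" and I: "submodule I K M"
begin

interpretation M: module K M by (rule M)
interpretation I: submodule I K M by (rule I)
interpretation I': abelian_subgroup I M
  by (rule abelian_subgroupI3[OF additive_subgroup.intro[OF I.subgroup_axioms] M.abelian_group_axioms])

private abbreviation "C \<equiv> quotient_algebra M I"

lemma quotient_module_carrier: "carrier C = (\<lambda>x. I +>\<^bsub>M\<^esub> x) ` carrier M"
  by (auto simp: quotient_algebra_simps FactRing_def A_RCOSETS_def' image_def)

lemma quotient_module_ops: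
  "\<lbrakk>x \<in> carrier M; y \<in> carrier M\<rbrakk> \<Longrightarrow> (I +>\<^bsub>M\<^esub> x) \<oplus>\<^bsub>C\<^esub> (I +>\<^bsub>M\<^esub> y) = I +>\<^bsub>M\<^esub> (x \<oplus>\<^bsub>M\<^esub> y)"
  "\<lbrakk>c \<in> carrier K; x \<in> carrier M\<rbrakk> \<Longrightarrow> c \<odot>\<^bsub>C\<^esub> (I +>\<^bsub>M\<^esub> x) = I +>\<^bsub>M\<^esub> (c \<odot>\<^bsub>M\<^esub> x)"
  "\<zero>\<^bsub>C\<^esub> = I +>\<^bsub>M\<^esub> \<zero>\<^bsub>M\<^esub>"
proof -
  show "(I +>\<^bsub>M\<^esub> x) \<oplus>\<^bsub>C\<^esub> (I +>\<^bsub>M\<^esub> y) = I +>\<^bsub>M\<^esub> (x \<oplus>\<^bsub>M\<^esub> y)" if "x \<in> carrier M" "y \<in> carrier M" for x y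
    using that by (simp add: quotient_algebra_simps FactRing_def I'.a_rcos_sum)
  show "\<zero>\<^bsub>C\<^esub> = I +>\<^bsub>M\<^esub> \<zero>\<^bsub>M\<^esub>"
    using I'.a_subset by (simp add: quotient_algebra_simps FactRing_def)
  show "c \<odot>\<^bsub>C\<^esub> (I +>\<^bsub>M\<^esub> x) = I +>\<^bsub>M\<^esub> (c \<odot>\<^bsub>M\<^esub> x)" if c: "c \<in> carrier K" and x: "x \<in> carrier M" for c x
  proof -
    have "I +>\<^bsub>M\<^esub> (c \<odot>\<^bsub>M\<^esub> y) = I +>\<^bsub>M\<^esub> (c \<odot>\<^bsub>M\<^esub> x)" if yx: "y \<in> I +>\<^bsub>M\<^esub> x" for y
    proof -
      obtain i where i: "i \<in> I" and y: "y = i \<oplus>\<^bsub>M\<^esub> x" using yx unfolding mem_coset by blast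
      have "c \<odot>\<^bsub>M\<^esub> y = (c \<odot>\<^bsub>M\<^esub> i) \<oplus>\<^bsub>M\<^esub> (c \<odot>\<^bsub>M\<^esub> x)"
        unfolding y by (rule M.smult_r_distr[OF c _ x]) (use i I'.a_subset in blast)
      then have "c \<odot>\<^bsub>M\<^esub> y \<in> I +>\<^bsub>M\<^esub> (c \<odot>\<^bsub>M\<^esub> x)"
        unfolding mem_coset using I.smult_closed[OF c i] by (rule bexI)
      then show ?thesis
        by (rule I'.a_repr_independence'[OF _ M.smult_closed[OF c x], symmetric])
    qed
    moreover have "x \<in> I +>\<^bsub>M\<^esub> x" using I'.a_rcos_self[OF x] .
    ultimately show ?thesis unfolding quotient_algebra_smult by blast
  qed
qed

lemma quotient_module: "module K C"
proof (rule moduleI[OF M.R.is_cring])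
  show "abelian_group C"
  proof (rule abelian_groupI)
    show "\<exists>Y\<in>carrier C. Y \<oplus>\<^bsub>C\<^esub> X = \<zero>\<^bsub>C\<^esub>" if "X \<in> carrier C" for X
    proof -
      obtain x where x: "x \<in> carrier M" "X = I +>\<^bsub>M\<^esub> x" using \<open>X \<in> carrier C\<close> by (auto simp: quotient_module_carrier)
      have "(I +>\<^bsub>M\<^esub> (\<ominus>\<^bsub>M\<^esub> x)) \<oplus>\<^bsub>C\<^esub> X = \<zero>\<^bsub>C\<^esub>" using x by (simp add: quotient_module_ops M.l_neg)
      then show ?thesis using x by (auto simp: quotient_module_carrier)
    qed
  qed (auto simp: quotient_module_carrier quotient_module_ops M.a_ac)
qed (auto simp: quotient_module_carrier quotient_module_ops M.smult_l_distr M.smult_r_distr M.smult_assoc1)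

lemma quotient_module_proj: "(\<lambda>x. I +>\<^bsub>M\<^esub> x) \<in> linear_map K M C"
  by (rule linear_mapI) (auto simp: quotient_module_carrier quotient_module_ops)

lemma quotient_module_eq_iff:
  "\<lbrakk>x \<in> carrier M; y \<in> carrier M\<rbrakk> \<Longrightarrow> I +>\<^bsub>M\<^esub> x = I +>\<^bsub>M\<^esub> y \<longleftrightarrow> x \<ominus>\<^bsub>M\<^esub> y \<in> I"
  using I'.a_rcos_module[of y x] I'.a_rcos_self[of x] I'.a_repr_independence'[of x y]
  by (auto simp: a_minus_def)

end

text \<open>The first isomorphism theorem, with the ring laws known only in the target:
  \<open>F\<close> is just a module with a closed product and a distinguished element. The map goes
  from \<open>B\<close> to the quotient, so that no structure has to be established on the quotient
  beforehand.\<close>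

lemma quotient_algebra_isomorphic:
  assumes F: "module K F" and B: "module K B" and \<Psi>: "\<Psi> \<in> linear_map K F B"
    and surj: "\<Psi> ` carrier F = carrier B"
    and mult: "\<And>x y. \<lbrakk>x \<in> carrier F; y \<in> carrier F\<rbrakk> \<Longrightarrow> x \<otimes>\<^bsub>F\<^esub> y \<in> carrier F"
      "\<And>x y. \<lbrakk>x \<in> carrier F; y \<in> carrier F\<rbrakk> \<Longrightarrow> \<Psi> (x \<otimes>\<^bsub>F\<^esub> y) = \<Psi> x \<otimes>\<^bsub>B\<^esub> \<Psi> y"
    and one: "\<one>\<^bsub>F\<^esub> \<in> carrier F" "\<Psi> \<one>\<^bsub>F\<^esub> = \<one>\<^bsub>B\<^esub>"
    and ker: "I = {x \<in> carrier F. \<Psi> x = \<zero>\<^bsub>B\<^esub>}"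
  shows "algebra_isomorphic K B (quotient_algebra F I)"
proof -
  interpret F: module K F by fact
  interpret B: module K B by fact
  note lin = linear_mapD[OF \<Psi>]
  have neg: "\<Psi> (\<ominus>\<^bsub>F\<^esub> x) = \<ominus>\<^bsub>B\<^esub> \<Psi> x" if "x \<in> carrier F" for x
    using that lin(1) lin(2)[of "\<ominus>\<^bsub>F\<^esub> x" x] linear_map_zero[OF F B \<Psi>]
    by (simp add: F.l_neg B.minus_equality)
  have I: "submodule I K F"
    unfolding ker by (rule F.submoduleI) (use linear_map_zero[OF F B \<Psi>] neg in \<open>auto simp: lin\<close>)
  \<comment> \<open>The fibres of \<Psi> are exactly the cosets of its kernel, so the inverse of the
    induced map needs no choice of representatives.\<close>
  define h where "h b = {x \<in> carrier F. \<Psi> x = b}" for b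
  have coset: "I +>\<^bsub>F\<^esub> x = h (\<Psi> x)" if x: "x \<in> carrier F" for x
  proof (intro subset_antisym subsetI)
    fix y assume "y \<in> I +>\<^bsub>F\<^esub> x"
    then show "y \<in> h (\<Psi> x)" using x by (auto simp: mem_coset ker h_def lin)
  next
    fix y assume y: "y \<in> h (\<Psi> x)"
    then have "y \<ominus>\<^bsub>F\<^esub> x \<in> I" using x by (auto simp: h_def ker a_minus_def lin neg B.r_neg)
    moreover have "y = (y \<ominus>\<^bsub>F\<^esub> x) \<oplus>\<^bsub>F\<^esub> x"
      using x y by (simp add: h_def a_minus_def F.a_assoc F.l_neg)
    ultimately show "y \<in> I +>\<^bsub>F\<^esub> x" unfolding mem_coset by blast
  qed
  have ex: "\<exists>x\<in>carrier F. b = \<Psi> x" if "b \<in> carrier B" for b using that surj by blast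
  let ?C = "quotient_algebra F I"
  have car: "carrier ?C = h ` carrier B"
    unfolding quotient_module_carrier[OF F I] surj[symmetric] image_image by (rule image_cong) (simp_all add: coset)
  have "h \<in> ring_hom B ?C"
  proof (rule ring_hom_memI)
    show "h b \<in> carrier ?C" if "b \<in> carrier B" for b using that car by blast
    show "h (b \<oplus>\<^bsub>B\<^esub> b') = h b \<oplus>\<^bsub>?C\<^esub> h b'" if b: "b \<in> carrier B" "b' \<in> carrier B" for b b'
      using ex[OF b(1)] ex[OF b(2)] quotient_module_ops(1)[OF F I] by (auto simp: coset lin)
    show "h (b \<otimes>\<^bsub>B\<^esub> b') = h b \<otimes>\<^bsub>?C\<^esub> h b'" if b: "b \<in> carrier B" "b' \<in> carrier B" for b b'
    proof -
      obtain x where x: "x \<in> carrier F" "b = \<Psi> x" using ex[OF b(1)] by blast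
      obtain y where y: "y \<in> carrier F" "b' = \<Psi> y" using ex[OF b(2)] by blast
      \<comment> \<open>Multiplication of cosets is a union over all pairs of representatives. As
        \<Psi> is multiplicative, every coset in this union is the fibre over the product; that the
        kernel is an ideal is not invoked.\<close>
      have "h b \<otimes>\<^bsub>?C\<^esub> h b' = (\<Union>x'\<in>h b. \<Union>y'\<in>h b'. I +>\<^bsub>F\<^esub> (x' \<otimes>\<^bsub>F\<^esub> y'))"
        by (simp add: quotient_algebra_simps FactRing_def rcoset_mult_def)
      also have "\<dots> = (\<Union>x'\<in>h b. \<Union>y'\<in>h b'. h (b \<otimes>\<^bsub>B\<^esub> b'))"
        using mult by (intro SUP_cong refl) (auto simp: h_def coset)
      also have "\<dots> = h (b \<otimes>\<^bsub>B\<^esub> b')" using x y by (auto simp: h_def)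
      finally show ?thesis by simp
    qed
    show "h \<one>\<^bsub>B\<^esub> = \<one>\<^bsub>?C\<^esub>"
      using one by (simp add: quotient_algebra_simps FactRing_def coset)
  qed
  moreover have "h \<in> linear_map K B ?C"
  proof (rule linear_mapI)
    show "h b \<in> carrier ?C" if "b \<in> carrier B" for b using that car by blast
    show "h (b \<oplus>\<^bsub>B\<^esub> b') = h b \<oplus>\<^bsub>?C\<^esub> h b'" if b: "b \<in> carrier B" "b' \<in> carrier B" for b b'
      using ex[OF b(1)] ex[OF b(2)] quotient_module_ops(1)[OF F I] by (auto simp: coset lin)
    show "h (c \<odot>\<^bsub>B\<^esub> b) = c \<odot>\<^bsub>?C\<^esub> h b" if c: "c \<in> carrier K" "b \<in> carrier B" for c b
    proof -
      obtain x where x: "x \<in> carrier F" "b = \<Psi> x" using ex[OF c(2)] by blast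
      show ?thesis
        using quotient_module_ops(2)[OF F I c(1) x(1)] x c lin(3)[OF c(1) x(1)] by (simp add: coset)
    qed
  qed
  moreover have "bij_betw h (carrier B) (carrier ?C)"
    unfolding bij_betw_def car
    by (intro conjI inj_onI refl) (use ex in \<open>auto simp: h_def\<close>)
  ultimately show ?thesis by (auto simp: algebra_isomorphic_def algebra_hom_def)
qed

lemma (in module) generated_submodule_props:
  assumes "X \<subseteq> carrier M"
  shows "submodule (generated_submodule R M X) R M" "X \<subseteq> generated_submodule R M X"
    "\<And>H. \<lbrakk>submodule H R M; X \<subseteq> H\<rbrakk> \<Longrightarrow> generated_submodule R M X \<subseteq> H"
proof -
  have all: "carrier M \<in> {H. submodule H R M \<and> X \<subseteq> H}" using carrier_is_submodule assms by simp
  show "submodule (generated_submodule R M X) R M"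
  proof (rule submoduleI)
    show "generated_submodule R M X \<subseteq> carrier M"
      unfolding generated_submodule_def using all by (rule Inter_lower)
    show "\<zero>\<^bsub>M\<^esub> \<in> generated_submodule R M X"
      unfolding generated_submodule_def
      using subgroup.one_closed[OF submodule.axioms(1)] by fastforce
  qed (use submoduleE in \<open>auto simp: generated_submodule_def\<close>)
qed (auto simp: generated_submodule_def)

section \<open>Recognizing an algebra as a tensor product\<close>

context
  fixes K :: "('k, 'm) ring_scheme" and A :: "('k, 'a, 'n) module_scheme" and B :: "('k, 'b, 'o) module_scheme"
  assumes A: "module K A" and B: "module K B"
begin

interpretation A: module K A by (rule A)
interpretation B: module K B by (rule B)

private abbreviation "F \<equiv> free_module K (carrier A \<times> carrier B)"
private abbreviation "I \<equiv> generated_submodule K F (tensor_relations K A B)"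

interpretation F: module K F by (rule free_module_module[OF A.R.is_cring])

private lemma dF: "\<lbrakk>a \<in> carrier A; b \<in> carrier B\<rbrakk> \<Longrightarrow> delta K (a, b) \<in> carrier F"
  by (rule delta_free[OF A.R.is_cring]) auto

private lemma relations_subset: "tensor_relations K A B \<subseteq> carrier F"
  unfolding tensor_relations_def Let_def
  by (auto simp del: free_simps intro!: F.minus_closed F.M.add.m_closed F.smult_closed dF)

lemmas tensor_submodule = F.generated_submodule_props(1)[OF relations_subset]

lemma tensor_class_bilinear:
  "b \<in> carrier B \<Longrightarrow> (\<lambda>a. I +>\<^bsub>F\<^esub> delta K (a, b)) \<in> linear_map K A (quotient_algebra F I)"
  "a \<in> carrier A \<Longrightarrow> (\<lambda>b. I +>\<^bsub>F\<^esub> delta K (a, b)) \<in> linear_map K B (quotient_algebra F I)"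
proof -
  note I = tensor_submodule
  note rel = subsetD[OF F.generated_submodule_props(2)[OF relations_subset]]
  note ops = quotient_module_ops[OF F.module_axioms I]
  note eq = quotient_module_eq_iff[OF F.module_axioms I, THEN iffD2]
  note car = quotient_module_carrier[OF F.module_axioms I]
  show "(\<lambda>a. I +>\<^bsub>F\<^esub> delta K (a, b)) \<in> linear_map K A (quotient_algebra F I)" if b: "b \<in> carrier B"
  proof (rule linear_mapI)
    fix a assume a: "a \<in> carrier A"
    show "I +>\<^bsub>F\<^esub> delta K (a, b) \<in> carrier (quotient_algebra F I)" using dF[OF a b] by (auto simp: car)
    show "I +>\<^bsub>F\<^esub> delta K (a \<oplus>\<^bsub>A\<^esub> a', b) = (I +>\<^bsub>F\<^esub> delta K (a, b)) \<oplus>\<^bsub>quotient_algebra F I\<^esub> (I +>\<^bsub>F\<^esub> delta K (a', b))"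
      if a': "a' \<in> carrier A" for a'
      unfolding ops(1)[OF dF[OF a b] dF[OF a' b]]
    proof (rule eq[OF dF F.M.add.m_closed rel])
      show "delta K (a \<oplus>\<^bsub>A\<^esub> a', b) \<ominus>\<^bsub>F\<^esub> (delta K (a, b) \<oplus>\<^bsub>F\<^esub> delta K (a', b)) \<in> tensor_relations K A B"
        unfolding tensor_relations_def Let_def using a a' b by blast
    qed (use a a' b dF in auto)
    show "I +>\<^bsub>F\<^esub> delta K (c \<odot>\<^bsub>A\<^esub> a, b) = c \<odot>\<^bsub>quotient_algebra F I\<^esub> (I +>\<^bsub>F\<^esub> delta K (a, b))"
      if c: "c \<in> carrier K" for c
      unfolding ops(2)[OF c dF[OF a b]]
    proof (rule eq[OF dF F.smult_closed rel])
      show "delta K (c \<odot>\<^bsub>A\<^esub> a, b) \<ominus>\<^bsub>F\<^esub> (c \<odot>\<^bsub>F\<^esub> delta K (a, b)) \<in> tensor_relations K A B"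
        unfolding tensor_relations_def Let_def using a b c by blast
    qed (use a b c dF in auto)
  qed
  show "(\<lambda>b. I +>\<^bsub>F\<^esub> delta K (a, b)) \<in> linear_map K B (quotient_algebra F I)" if a: "a \<in> carrier A"
  proof (rule linear_mapI)
    fix b assume b: "b \<in> carrier B"
    show "I +>\<^bsub>F\<^esub> delta K (a, b) \<in> carrier (quotient_algebra F I)" using dF[OF a b] by (auto simp: car)
    show "I +>\<^bsub>F\<^esub> delta K (a, b \<oplus>\<^bsub>B\<^esub> b') = (I +>\<^bsub>F\<^esub> delta K (a, b)) \<oplus>\<^bsub>quotient_algebra F I\<^esub> (I +>\<^bsub>F\<^esub> delta K (a, b'))"
      if b': "b' \<in> carrier B" for b'
      unfolding ops(1)[OF dF[OF a b] dF[OF a b']]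
    proof (rule eq[OF dF F.M.add.m_closed rel])
      show "delta K (a, b \<oplus>\<^bsub>B\<^esub> b') \<ominus>\<^bsub>F\<^esub> (delta K (a, b) \<oplus>\<^bsub>F\<^esub> delta K (a, b')) \<in> tensor_relations K A B"
        unfolding tensor_relations_def Let_def using a b b' by blast
    qed (use a b b' dF in auto)
    show "I +>\<^bsub>F\<^esub> delta K (a, c \<odot>\<^bsub>B\<^esub> b) = c \<odot>\<^bsub>quotient_algebra F I\<^esub> (I +>\<^bsub>F\<^esub> delta K (a, b))"
      if c: "c \<in> carrier K" for c
      unfolding ops(2)[OF c dF[OF a b]]
    proof (rule eq[OF dF F.smult_closed rel])
      show "delta K (a, c \<odot>\<^bsub>B\<^esub> b) \<ominus>\<^bsub>F\<^esub> (c \<odot>\<^bsub>F\<^esub> delta K (a, b)) \<in> tensor_relations K A B"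
        unfolding tensor_relations_def Let_def using a b c by blast
    qed (use a b c dF in auto)
  qed
qed

text \<open>The point is that the tensor relations generate exactly the kernel of the linear
  extension \<Psi> of \<beta>. Bilinearity of \<beta> puts them into the kernel. Conversely, \<Phi>
  after \<Psi> agrees with the projection to the quotient on all pairs, hence everywhere, so \<Psi>
  x = 0 makes the class of x zero.\<close>

lemma tensor_with_product_isomorphic:
  assumes M: "assoc_algebra K M"
    and \<beta>: "\<And>b. b \<in> carrier B \<Longrightarrow> (\<lambda>a. \<beta> a b) \<in> linear_map K A M"
      "\<And>a. a \<in> carrier A \<Longrightarrow> \<beta> a \<in> linear_map K B M"
    and \<Phi>: "\<Phi> \<in> linear_map K M (quotient_algebra F I)"
      "\<And>a b. \<lbrakk>a \<in> carrier A; b \<in> carrier B\<rbrakk> \<Longrightarrow> \<Phi> (\<beta> a b) = I +>\<^bsub>F\<^esub> delta K (a, b)"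
    and surj: "carrier M \<subseteq> lin_ext K M (\<lambda>(a, b). \<beta> a b) ` carrier F"
    and \<mu>: "\<And>x y. \<lbrakk>x \<in> carrier A \<times> carrier B; y \<in> carrier A \<times> carrier B\<rbrakk> \<Longrightarrow> \<mu> x y \<in> carrier F"
      "\<And>a b a' b'. \<lbrakk>a \<in> carrier A; b \<in> carrier B; a' \<in> carrier A; b' \<in> carrier B\<rbrakk> \<Longrightarrow>
        lin_ext K M (\<lambda>(a, b). \<beta> a b) (\<mu> (a, b) (a', b')) = \<beta> a b \<otimes>\<^bsub>M\<^esub> \<beta> a' b'"
    and one: "\<one>\<^bsub>A\<^esub> \<in> carrier A" "\<one>\<^bsub>B\<^esub> \<in> carrier B" "\<beta> \<one>\<^bsub>A\<^esub> \<one>\<^bsub>B\<^esub> = \<one>\<^bsub>M\<^esub>"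
  shows "algebra_isomorphic K M (tensor_with_product K A B \<mu>)"
proof -
  interpret M: assoc_algebra K M by fact
  let ?F = "F\<lparr>monoid.mult := bilin_ext K F \<mu>, one := delta K (\<one>\<^bsub>A\<^esub>, \<one>\<^bsub>B\<^esub>)\<rparr>"
  define \<Psi> where "\<Psi> = lin_ext K M (\<lambda>(a, b). \<beta> a b)"
  have \<beta>_cl: "\<beta> a b \<in> carrier M" if "a \<in> carrier A" "b \<in> carrier B" for a b
    using linear_mapD(1)[OF \<beta>(1)[OF that(2)] that(1)] .
  have \<Psi>: "\<Psi> \<in> linear_map K F M"
    unfolding \<Psi>_def by (rule lin_ext_linear[OF M.module_axioms]) (auto simp: \<beta>_cl)
  note \<Psi>_lin = linear_mapD[OF \<Psi>]
  have \<Psi>_delta: "\<Psi> (delta K (a, b)) = \<beta> a b" if "a \<in> carrier A" "b \<in> carrier B" for a b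
    unfolding \<Psi>_def using that
    by (subst lin_ext_delta[OF M.module_axioms, of _ "carrier A \<times> carrier B"]) (auto simp: \<beta>_cl)
  note I = tensor_submodule
  have Q: "module K (quotient_algebra F I)" by (rule quotient_module[OF F.module_axioms I])
  note bilin = bilin_ext_bilinear[of K F "carrier A \<times> carrier B" "carrier A \<times> carrier B" \<mu>,
      OF F.module_axioms \<mu>(1)]
  have mult_cl: "bilin_ext K F \<mu> x y \<in> carrier F" if "x \<in> carrier F" "y \<in> carrier F" for x y
    using linear_mapD(1)[OF bilin(2)[OF _ _ that(1)] that(2)] by blast
  have mult: "\<Psi> (bilin_ext K F \<mu> x y) = \<Psi> x \<otimes>\<^bsub>M\<^esub> \<Psi> y" if x: "x \<in> carrier F" and y: "y \<in> carrier F" for x y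
  proof (rule linear_map_eqI[OF M.module_axioms linear_map_comp[OF bilin(1)[OF _ _ y] \<Psi>]
        linear_map_mult(2)[OF M \<Psi> \<Psi>_lin(1)[OF y]] _ x])
    fix p assume p: "p \<in> carrier A \<times> carrier B"
    then have dp: "delta K p \<in> carrier F" using dF by auto
    show "\<Psi> (bilin_ext K F \<mu> (delta K p) y) = \<Psi> (delta K p) \<otimes>\<^bsub>M\<^esub> \<Psi> y"
    proof (rule linear_map_eqI[OF M.module_axioms linear_map_comp[OF bilin(2)[OF _ _ dp] \<Psi>]
          linear_map_mult(1)[OF M \<Psi> \<Psi>_lin(1)[OF dp]] _ y])
      fix p' assume p': "p' \<in> carrier A \<times> carrier B"
      have "\<Psi> (\<mu> p p') = \<Psi> (delta K p) \<otimes>\<^bsub>M\<^esub> \<Psi> (delta K p')"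
        using p p' \<mu>(2) by (auto simp: \<Psi>_delta \<Psi>_def[symmetric])
      then show "\<Psi> (bilin_ext K F \<mu> (delta K p) (delta K p')) = \<Psi> (delta K p) \<otimes>\<^bsub>M\<^esub> \<Psi> (delta K p')"
        by (subst bilin(3)[OF _ _ p p'])
    qed
  qed
  have "I \<subseteq> {x \<in> carrier F. \<Psi> x = \<zero>\<^bsub>M\<^esub>}"
  proof (rule F.generated_submodule_props(3)[OF relations_subset])
    have zero: "\<Psi> \<zero>\<^bsub>F\<^esub> = \<zero>\<^bsub>M\<^esub>" by (rule linear_map_zero[OF F.module_axioms M.module_axioms \<Psi>])
    have neg: "\<Psi> (\<ominus>\<^bsub>F\<^esub> x) = \<ominus>\<^bsub>M\<^esub> \<Psi> x" if "x \<in> carrier F" for x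
      using that \<Psi>_lin(1) \<Psi>_lin(2)[of "\<ominus>\<^bsub>F\<^esub> x" x] zero
      by (simp add: F.M.l_neg M.minus_equality del: free_simps)
    show "submodule {x \<in> carrier F. \<Psi> x = \<zero>\<^bsub>M\<^esub>} K F"
      by (rule F.submoduleI) (use zero neg in \<open>auto simp: \<Psi>_lin simp del: free_simps\<close>)
    have minus: "\<Psi> (x \<ominus>\<^bsub>F\<^esub> y) = \<zero>\<^bsub>M\<^esub>" if "\<Psi> x = \<Psi> y" "x \<in> carrier F" "y \<in> carrier F" for x y
      using that \<Psi>_lin(1) by (simp add: a_minus_def \<Psi>_lin(2) neg M.r_neg del: free_simps)
    note \<beta>_lin = linear_mapD(2,3)[OF \<beta>(1)] linear_mapD(2,3)[OF \<beta>(2)]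
    have "\<Psi> r = \<zero>\<^bsub>M\<^esub>" if "r \<in> tensor_relations K A B" for r
      using that unfolding tensor_relations_def Let_def
      by (elim UnE CollectE exE conjE; hypsubst, intro minus;
          simp add: \<Psi>_lin \<Psi>_delta dF \<beta>_lin del: free_simps)
    then show "tensor_relations K A B \<subseteq> {x \<in> carrier F. \<Psi> x = \<zero>\<^bsub>M\<^esub>}" using relations_subset by blast
  qed
  moreover have "x \<in> I" if x: "x \<in> carrier F" "\<Psi> x = \<zero>\<^bsub>M\<^esub>" for x
  proof -
    have "I +>\<^bsub>F\<^esub> x = \<Phi> (\<Psi> x)"
      by (rule linear_map_eqI[OF Q quotient_module_proj[OF F.module_axioms I] linear_map_comp[OF \<Psi> \<Phi>(1)] _ x(1)])
         (auto simp: \<Psi>_delta \<Phi>(2))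
    also have "\<dots> = I +>\<^bsub>F\<^esub> \<zero>\<^bsub>F\<^esub>"
      using x(2) linear_map_zero[OF M.module_axioms Q \<Phi>(1)]
      by (simp add: quotient_module_ops(3)[OF F.module_axioms I] del: free_simps)
    finally have "x \<ominus>\<^bsub>F\<^esub> \<zero>\<^bsub>F\<^esub> \<in> I"
      using quotient_module_eq_iff[OF F.module_axioms I x(1) F.M.zero_closed] by blast
    moreover have "\<ominus>\<^bsub>F\<^esub> \<zero>\<^bsub>F\<^esub> = \<zero>\<^bsub>F\<^esub>"
      by (rule F.M.minus_equality) (simp_all del: free_simps)
    ultimately show ?thesis using x(1) by (simp add: a_minus_def del: free_simps)
  qed
  ultimately have ker: "I = {x \<in> carrier ?F. \<Psi> x = \<zero>\<^bsub>M\<^esub>}" by auto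
  show ?thesis
    unfolding tensor_with_product_def Let_def
  proof (rule quotient_algebra_isomorphic[OF module_update[OF F.module_axioms] M.module_axioms _ _ _ _ _ _ ker])
    show "\<Psi> \<in> linear_map K ?F M" using \<Psi> by (simp add: linear_map_update)
    show "\<Psi> ` carrier ?F = carrier M" using surj \<Psi>_lin(1) by (auto simp: \<Psi>_def)
  qed (use mult_cl mult one dF \<Psi>_delta in auto)
qed

end

section \<open>Group algebras of graded products\<close>

context sign_algebra
begin

text \<open>The projection to degree \<open>k\<close>. Multiplication by Z preserves the degree, so
  the prescribed values are compatible with the relation between \<open>e (Z g)\<close> and
  \<open>e g\<close>, and \<open>lin_ext_e\<close> applies. For s = -1 it agrees with the abstract
  \<open>homogeneous_component\<close>.\<close>

definition component :: "nat \<Rightarrow> ('g \<Rightarrow> 'k) \<Rightarrow> ('g \<Rightarrow> 'k)" where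
  "component k = lin_ext K S (\<lambda>g. if gdeg G g = int k then e g else \<zero>\<^bsub>S\<^esub>)"

lemma e_zmul: "g \<in> carrier G \<Longrightarrow> e (G.zmul k g) = (if even k then e g else s \<odot>\<^bsub>S\<^esub> e g)"
  by (simp add: G.zmul_even G.zmul_odd e_gelt_S)

lemma component_linear: "component k \<in> linear_map K S S"
  unfolding component_def by (rule lin_ext_linear_S[OF S.module_axioms]) auto

lemma component_e: "g \<in> carrier G \<Longrightarrow> component k (e g) = (if gdeg G g = int k then e g else \<zero>\<^bsub>S\<^esub>)"
  unfolding component_def using G.gelt_closed
  by (subst lin_ext_e[OF S.module_axioms]) (auto simp: G.gdeg_gelt e_gelt_S)

lemma component_sum:
  assumes "f \<in> carrier S" shows "f = component 0 f \<oplus>\<^bsub>S\<^esub> component 1 f"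
  by (rule S_eqI[OF S.module_axioms linear_map_id
        linear_map_add[OF S.module_axioms component_linear component_linear] _ assms])
     (auto simp: component_e elim: G.gdeg_cases)

abbreviation \<alpha> :: "('g \<Rightarrow> 'k) \<Rightarrow> ('g \<Rightarrow> 'k)" where
  "\<alpha> \<equiv> pushforward K G (\<lambda>g. gelt G [^]\<^bsub>G\<^esub> gdeg G g \<otimes>\<^bsub>G\<^esub> g)"

lemma \<alpha>_linear: "\<alpha> \<in> linear_map K A A"
  by (rule pushforward_linear) (use G.gelt_closed in auto)

text \<open>Since g and Z g have the same degree, \<alpha> multiplies both deltas in
  \<open>e g\<close> by the same power of Z. By \<open>e_zmul\<close> the result is
  \<open>e g\<close> times s to the power d(g).\<close>

lemma \<alpha>_e:
  assumes g: "g \<in> carrier G" shows "\<alpha> (e g) = e (G.zmul (gdeg G g) g)"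
proof -
  have "\<alpha> (delta K x) = delta K (G.zmul (gdeg G x) x)" if "x \<in> carrier G" for x
    using that G.gelt_closed by (subst pushforward_delta) (auto simp: G.zmul_def)
  then show ?thesis
    using g G.gelt_closed G.zmul_mult G.mult_zmul[of "gelt G" g "gdeg G g"]
    by (simp add: e_def linear_mapD[OF \<alpha>_linear] G.gdeg_gelt)
qed

end

locale minus_algebra = sign_algebra K G "\<ominus>\<^bsub>K\<^esub> \<one>\<^bsub>K\<^esub>" for K G
begin

lemma component_mem_part:
  assumes f: "f \<in> carrier S" and k: "k \<in> {0, 1}"
  shows "component k f \<in> group_algebra_minus_part K G k"
proof -
  have "\<alpha> (component k f) = ((\<ominus>\<^bsub>K\<^esub> \<one>\<^bsub>K\<^esub>) [^]\<^bsub>K\<^esub> k) \<odot>\<^bsub>S\<^esub> component k f"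
  proof (rule S_eqI[OF A.module_axioms _ _ _ f])
    show "(\<lambda>f. \<alpha> (component k f)) \<in> linear_map K S A"
      by (rule linear_map_comp[OF component_linear linear_map_restrict[OF \<alpha>_linear]])
    show "(\<lambda>f. ((\<ominus>\<^bsub>K\<^esub> \<one>\<^bsub>K\<^esub>) [^]\<^bsub>K\<^esub> k) \<odot>\<^bsub>S\<^esub> component k f) \<in> linear_map K S A"
      using linear_map_smult[OF S.module_axioms component_linear, of "(\<ominus>\<^bsub>K\<^esub> \<one>\<^bsub>K\<^esub>) [^]\<^bsub>K\<^esub> k" k]
      by (auto simp: linear_map_def S_simps intro: S_subset)
    fix g assume g: "g \<in> carrier G"
    have "\<alpha> \<zero>\<^bsub>A\<^esub> = \<zero>\<^bsub>A\<^esub>" by (rule linear_map_zero[OF A.module_axioms A.module_axioms \<alpha>_linear])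
    then show "\<alpha> (component k (e g)) = ((\<ominus>\<^bsub>K\<^esub> \<one>\<^bsub>K\<^esub>) [^]\<^bsub>K\<^esub> k) \<odot>\<^bsub>S\<^esub> component k (e g)"
      using g k e_closed_A[OF g] by (auto simp: component_e \<alpha>_e e_zmul S_simps)
  qed
  then show ?thesis
    using linear_mapD(1)[OF component_linear f] by (simp add: sign_ideal_part_def S_simps)
qed

text \<open>The description by \<open>THE\<close> requires a unique decomposition. Existence is
  \<open>component_sum\<close>; uniqueness holds because \<alpha> acts by opposite signs on the two
  parts, so f and \<alpha> f determine twice each component, and 2 can be divided out.\<close>

lemma homogeneous_component_eq:
  assumes f: "f \<in> carrier S" and k: "k \<in> {0, 1}"
  shows "homogeneous_component S (group_algebra_minus_part K G) k f = component k f"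
  unfolding homogeneous_component_def
proof (rule the_equality)
  have k': "1 - k \<in> {0, 1}" using k by auto
  have cl: "component k f \<in> carrier S" "component (1 - k) f \<in> carrier S"
    using linear_mapD(1)[OF component_linear f] by auto
  have sum: "f = component k f \<oplus>\<^bsub>S\<^esub> component (1 - k) f"
    using component_sum[OF f] k cl S.a_comm by auto
  show "component k f \<in> group_algebra_minus_part K G k \<and>
      (\<exists>z\<in>group_algebra_minus_part K G (1 - k). f = component k f \<oplus>\<^bsub>S\<^esub> z)"
    using component_mem_part[OF f k] component_mem_part[OF f k'] sum by blast
  fix y assume "y \<in> group_algebra_minus_part K G k \<and>
      (\<exists>z\<in>group_algebra_minus_part K G (1 - k). f = y \<oplus>\<^bsub>S\<^esub> z)"
  then obtain z where y: "y \<in> group_algebra_minus_part K G k"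
    and z: "z \<in> group_algebra_minus_part K G (1 - k)" and f_eq: "f = y \<oplus>\<^bsub>S\<^esub> z" by blast
  let ?\<sigma> = "(\<ominus>\<^bsub>K\<^esub> \<one>\<^bsub>K\<^esub>) [^]\<^bsub>K\<^esub> k"
  \<comment> \<open>Twice the component of degree \<open>k\<close> is \<open>f + (-1)\<^sup>k \<alpha>\<^sub>* f\<close>.\<close>
  have double: "f \<oplus>\<^bsub>A\<^esub> ?\<sigma> \<odot>\<^bsub>A\<^esub> \<alpha> f = y \<oplus>\<^bsub>A\<^esub> y"
    if y: "y \<in> group_algebra_minus_part K G k"
      and z: "z \<in> group_algebra_minus_part K G (1 - k)" and f_eq: "f = y \<oplus>\<^bsub>S\<^esub> z" for y z
  proof -
    have yz: "y \<in> carrier A" "z \<in> carrier A" "\<alpha> y = ?\<sigma> \<odot>\<^bsub>A\<^esub> y"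
      "\<alpha> z = ((\<ominus>\<^bsub>K\<^esub> \<one>\<^bsub>K\<^esub>) [^]\<^bsub>K\<^esub> (1 - k)) \<odot>\<^bsub>A\<^esub> z"
      using y z S_subset by (auto simp: sign_ideal_part_def)
    have "?\<sigma> \<odot>\<^bsub>A\<^esub> \<alpha> f = y \<oplus>\<^bsub>A\<^esub> (\<ominus>\<^bsub>A\<^esub> z)"
    proof -
      have neg: "(\<ominus>\<^bsub>K\<^esub> \<one>\<^bsub>K\<^esub>) \<odot>\<^bsub>A\<^esub> w = \<ominus>\<^bsub>A\<^esub> w" if "w \<in> carrier A" for w
        using that by (simp add: A.smult_l_minus)
      show ?thesis using k yz(1,2) unfolding f_eq S_simps linear_mapD(2)[OF \<alpha>_linear yz(1,2)] yz(3,4)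
        by (auto simp: A.smult_r_distr neg A.minus_add)
    qed
    then show ?thesis using yz(1,2) unfolding f_eq S_simps
      by (simp add: A.a_assoc A.a_lcomm[of z]) (simp add: A.r_neg)
  qed
  have "y \<oplus>\<^bsub>A\<^esub> y = component k f \<oplus>\<^bsub>A\<^esub> component k f"
    using double[OF y z f_eq] double[OF component_mem_part[OF f k] component_mem_part[OF f k'] sum] by simp
  then have "half \<odot>\<^bsub>A\<^esub> (y \<oplus>\<^bsub>A\<^esub> y) = half \<odot>\<^bsub>A\<^esub> (component k f \<oplus>\<^bsub>A\<^esub> component k f)" by simp
  moreover have "y \<in> carrier A" using y S_subset by (simp add: sign_ideal_part_def)
  ultimately show "y = component k f"
    using S_subset[OF cl(1)] by (simp add: half_double[OF A.module_axioms])
qed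

end

section \<open>The bilinear pairing between the two factors\<close>

locale graded_product_algebra = graded_product_of G1 G2 G q + sign_algebra K G s
  for G1 :: "('a, 'm) graded_group_scheme" and G2 :: "('b, 'n) graded_group_scheme"
    and G :: "('c, 'o) graded_group_scheme" and q and K :: "('k, 'p) ring_scheme" and s
begin

sublocale A1: sign_algebra K G1 s by unfold_locales (simp_all add: two_unit s_square)
sublocale A2: sign_algebra K G2 s by unfold_locales (simp_all add: two_unit s_square)

text \<open>Prescribed on the deltas of K[G1] and K[G2], which are bases, and only afterwards
  restricted to the ideals.\<close>

definition \<beta> :: "('a \<Rightarrow> 'k) \<Rightarrow> ('b \<Rightarrow> 'k) \<Rightarrow> ('c \<Rightarrow> 'k)" where
  "\<beta> = bilin_ext K S (\<lambda>x y. e (q x y))"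

lemma \<beta>_linear1: "b \<in> carrier A2.S \<Longrightarrow> (\<lambda>a. \<beta> a b) \<in> linear_map K A1.S S"
  unfolding \<beta>_def
  using bilin_ext_bilinear(1)[where X = "carrier G1" and Y = "carrier G2", OF S.module_axioms]
  by (intro A1.linear_map_restrict) (simp add: A1.linear_map_A A2.S_subset A2.A_simps(1)[symmetric])

lemma \<beta>_linear2: "a \<in> carrier A1.S \<Longrightarrow> \<beta> a \<in> linear_map K A2.S S"
  unfolding \<beta>_def
  using bilin_ext_bilinear(2)[where X = "carrier G1" and Y = "carrier G2", OF S.module_axioms]
  by (intro A2.linear_map_restrict) (simp add: A2.linear_map_A A1.S_subset A1.A_simps(1)[symmetric])

lemma \<beta>_closed [simp]: "\<lbrakk>a \<in> carrier A1.S; b \<in> carrier A2.S\<rbrakk> \<Longrightarrow> \<beta> a b \<in> carrier S"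
  using linear_mapD(1)[OF \<beta>_linear2] .

text \<open>Both [Z x, y] and [x, Z y] equal Z [x, y], so in each variable the values are
  equivariant under Z and \<open>lin_ext_e\<close> can be applied to one variable after the
  other.\<close>

lemma \<beta>_e:
  assumes x: "x \<in> carrier G1" and y: "y \<in> carrier G2"
  shows "\<beta> (A1.e x) (A2.e y) = e (q x y)"
proof -
  have inner: "lin_ext K S (\<lambda>y. e (q x y)) (A2.e y) = e (q x y)" if "x \<in> carrier G1" for x
    by (rule A2.lin_ext_e[OF S.module_axioms _ _ y]) (use that in \<open>auto simp: q_gelt e_gelt_S\<close>)
  have "\<beta> (A1.e x) (A2.e y) = lin_ext K S (\<lambda>y. e (q x y)) (A2.e y)"
    unfolding \<beta>_def bilin_ext_def
    by (rule A1.lin_ext_e[OF S.module_axioms _ _ x])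
       (use G1.gelt_closed y in \<open>auto simp: inner q_gelt e_gelt_S\<close>)
  then show ?thesis using inner[OF x] by simp
qed

text \<open>The product \<mu> on pairs stays a parameter, so that the ungraded and the graded tensor
  product differ only in the verification of multiplicativity.\<close>

lemma tensor_isomorphic:
  fixes \<mu>
  defines "F \<equiv> free_module K (carrier A1.S \<times> carrier A2.S)"
  assumes \<mu>: "\<And>x y. \<lbrakk>x \<in> carrier A1.S \<times> carrier A2.S; y \<in> carrier A1.S \<times> carrier A2.S\<rbrakk> \<Longrightarrow> \<mu> x y \<in> carrier F"
      "\<And>a b a' b'. \<lbrakk>a \<in> carrier A1.S; b \<in> carrier A2.S; a' \<in> carrier A1.S; b' \<in> carrier A2.S\<rbrakk> \<Longrightarrow>
        lin_ext K S (\<lambda>(a, b). \<beta> a b) (\<mu> (a, b) (a', b')) = \<beta> a b \<otimes>\<^bsub>S\<^esub> \<beta> a' b'"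
  shows "algebra_isomorphic K S (tensor_with_product K A1.S A2.S \<mu>)"
proof -
  note mods = A1.S.module_axioms A2.S.module_axioms
  define I where "I = generated_submodule K F (tensor_relations K A1.S A2.S)"
  define t where "t a b = I +>\<^bsub>F\<^esub> delta K (a, b)" for a b
  let ?C = "quotient_algebra F I"
  have F: "module K F" unfolding F_def by (rule free_module_module[OF K.is_cring])
  have C: "module K ?C"
    unfolding I_def F_def by (rule quotient_module[OF F[unfolded F_def] tensor_submodule[OF mods]])
  interpret C: module K ?C by (rule C)
  have t1: "(\<lambda>a. t a b) \<in> linear_map K A1.S ?C" if "b \<in> carrier A2.S" for b
    unfolding t_def I_def F_def by (rule tensor_class_bilinear(1)[OF mods that])
  have t2: "t a \<in> linear_map K A2.S ?C" if "a \<in> carrier A1.S" for a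
    unfolding t_def I_def F_def by (rule tensor_class_bilinear(2)[OF mods that])
  have t_cl: "t a b \<in> carrier ?C" if "a \<in> carrier A1.S" "b \<in> carrier A2.S" for a b
    by (rule linear_mapD(1)[OF t2[OF that(1)] that(2)])
  have te1: "t (A1.e (gelt G1 \<otimes>\<^bsub>G1\<^esub> x)) (A2.e y) = s \<odot>\<^bsub>?C\<^esub> t (A1.e x) (A2.e y)"
    if "x \<in> carrier G1" "y \<in> carrier G2" for x y
    using that linear_mapD(3)[OF t1] by (simp add: A1.e_gelt_S)
  have te2: "t (A1.e x) (A2.e (gelt G2 \<otimes>\<^bsub>G2\<^esub> y)) = s \<odot>\<^bsub>?C\<^esub> t (A1.e x) (A2.e y)"
    if "x \<in> carrier G1" "y \<in> carrier G2" for x y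
    using that linear_mapD(3)[OF t2] by (simp add: A2.e_gelt_S)
  \<comment> \<open>The two factors \<open>s\<close> cancel, so the tensor of \<open>e x\<close> and
    \<open>e y\<close> depends only on the class [x, y]. This defines \<phi> on G.\<close>
  have "t (A1.e (gelt G1 \<otimes>\<^bsub>G1\<^esub> x)) (A2.e (gelt G2 \<otimes>\<^bsub>G2\<^esub> y)) = t (A1.e x) (A2.e y)"
    if "x \<in> carrier G1" "y \<in> carrier G2" for x y
    using that G1.gelt_closed G2.gelt_closed by (simp add: te1 te2 t_cl s_s[OF C])
  then obtain \<phi> where \<phi>: "\<And>x y. \<lbrakk>x \<in> carrier G1; y \<in> carrier G2\<rbrakk> \<Longrightarrow> \<phi> (q x y) = t (A1.e x) (A2.e y)"
    by (rule q_lift[where \<beta> = "\<lambda>x y. t (A1.e x) (A2.e y)"]) blast+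
  have \<phi>_cl: "\<phi> \<in> carrier G \<rightarrow> carrier ?C" by (auto elim!: carrierE simp: \<phi> t_cl)
  have \<phi>_gelt: "\<phi> (gelt G \<otimes>\<^bsub>G\<^esub> X) = s \<odot>\<^bsub>?C\<^esub> \<phi> X" if X: "X \<in> carrier G" for X
  proof -
    obtain x y where x: "x \<in> carrier G1" "y \<in> carrier G2" "X = q x y" using X by (rule carrierE)
    then show ?thesis using G1.gelt_closed by (simp add: q_gelt(1)[symmetric] \<phi> te1)
  qed
  define \<Phi> where "\<Phi> = lin_ext K ?C \<phi>"
  have \<Phi>: "\<Phi> \<in> linear_map K S ?C" unfolding \<Phi>_def by (rule lin_ext_linear_S[OF C \<phi>_cl])
  have \<Phi>_e: "\<Phi> (e g) = \<phi> g" if "g \<in> carrier G" for g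
    unfolding \<Phi>_def by (rule lin_ext_e[OF C \<phi>_cl \<phi>_gelt that])
  have \<Phi>_\<beta>: "\<Phi> (\<beta> a b) = t a b" if a: "a \<in> carrier A1.S" and b: "b \<in> carrier A2.S" for a b
  proof (rule A1.S_eqI[OF C linear_map_comp[OF \<beta>_linear1[OF b] \<Phi>] t1[OF b] _ a])
    fix x assume x: "x \<in> carrier G1"
    show "\<Phi> (\<beta> (A1.e x) b) = t (A1.e x) b"
      by (rule A2.S_eqI[OF C linear_map_comp[OF \<beta>_linear2 \<Phi>] t2 _ b])
         (use x in \<open>auto simp: \<beta>_e \<Phi>_e \<phi>\<close>)
  qed
  have \<beta>_S: "(\<lambda>(a, b). \<beta> a b) \<in> carrier A1.S \<times> carrier A2.S \<rightarrow> carrier S" by auto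
  have \<Psi>: "lin_ext K S (\<lambda>(a, b). \<beta> a b) \<in> linear_map K F S"
    unfolding F_def by (rule lin_ext_linear[OF S.module_axioms \<beta>_S])
  \<comment> \<open>Surjectivity needs a linear lift of each f. For every group element X a pair
    \<open>r X\<close> is chosen that \<beta> sends to \<open>e X\<close>, and the lift extends the
    map from X to the delta of \<open>r X\<close>. The choice need not respect Z because the lift is
    built on all of K[G].\<close>
  have "\<exists>p. X \<in> carrier G \<longrightarrow> p \<in> carrier A1.S \<times> carrier A2.S \<and> e X = (\<lambda>(a, b). \<beta> a b) p" for X
  proof (cases "X \<in> carrier G")
    case True
    then obtain x y where "x \<in> carrier G1" "y \<in> carrier G2" "X = q x y" by (rule carrierE)
    then show ?thesis by (intro exI[of _ "(A1.e x, A2.e y)"]) (auto simp: \<beta>_e)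
  qed simp
  then obtain r where r: "\<And>X. X \<in> carrier G \<Longrightarrow>
      r X \<in> carrier A1.S \<times> carrier A2.S \<and> e X = (\<lambda>(a, b). \<beta> a b) (r X)"
    by metis
  have dr: "(\<lambda>X. delta K (r X)) \<in> carrier G \<rightarrow> carrier F"
    unfolding F_def by (intro funcsetI delta_free[OF K.is_cring] conjunct1[OF r])
  have surj: "carrier S \<subseteq> lin_ext K S (\<lambda>(a, b). \<beta> a b) ` carrier F"
  proof
    fix f assume f: "f \<in> carrier S"
    have \<rho>: "lin_ext K F (\<lambda>X. delta K (r X)) \<in> linear_map K A F"
      using lin_ext_linear[OF F dr] by (simp add: linear_map_A)
    have P: "lin_ext K S e \<in> linear_map K A S"
      using lin_ext_linear[OF S.module_axioms, of e "carrier G"] by (simp add: linear_map_A)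
    have "lin_ext K S (\<lambda>(a, b). \<beta> a b) (lin_ext K F (\<lambda>X. delta K (r X)) f) = lin_ext K S e f"
    proof (rule A_eqI[OF S.module_axioms linear_map_comp[OF \<rho> \<Psi>] P _ S_subset[OF f]])
      fix X assume X: "X \<in> carrier G"
      have "lin_ext K F (\<lambda>X. delta K (r X)) (delta K X) = delta K (r X)"
        by (rule lin_ext_delta[OF F dr X])
      moreover have "lin_ext K S (\<lambda>(a, b). \<beta> a b) (delta K (r X)) = e X"
        using lin_ext_delta[OF S.module_axioms \<beta>_S, of "r X"] r[OF X] by simp
      moreover have "lin_ext K S e (delta K X) = e X"
        by (rule lin_ext_delta[OF S.module_axioms _ X]) auto
      ultimately show "lin_ext K S (\<lambda>(a, b). \<beta> a b) (lin_ext K F (\<lambda>X. delta K (r X)) (delta K X))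
          = lin_ext K S e (delta K X)" by simp
    qed
    also have "\<dots> = f"
    proof (rule S_eqI[OF S.module_axioms lin_ext_linear_S[OF S.module_axioms] linear_map_id _ f])
      show "lin_ext K S e (e g) = e g" if "g \<in> carrier G" for g
        by (rule lin_ext_e[OF S.module_axioms _ _ that]) (auto simp: e_gelt_S)
    qed auto
    finally show "f \<in> lin_ext K S (\<lambda>(a, b). \<beta> a b) ` carrier F"
      using linear_mapD(1)[OF \<rho> S_subset[OF f]] by force
  qed
  show ?thesis
  proof (rule tensor_with_product_isomorphic[OF mods S_assoc_algebra \<beta>_linear1 \<beta>_linear2])
    show "\<Phi> \<in> linear_map K S (quotient_algebra (free_module K (carrier A1.S \<times> carrier A2.S))
        (generated_submodule K (free_module K (carrier A1.S \<times> carrier A2.S)) (tensor_relations K A1.S A2.S)))"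
      using \<Phi> unfolding I_def F_def .
  qed (use \<Phi>_\<beta> surj \<mu> \<beta>_e[of "\<one>\<^bsub>G1\<^esub>" "\<one>\<^bsub>G2\<^esub>"] in
        \<open>auto simp: F_def I_def t_def one_S A1.one_S A2.one_S one_eq\<close>)
qed

lemma \<beta>_eqI:
  assumes M: "module K M"
    and h: "\<And>b. b \<in> carrier A2.S \<Longrightarrow> (\<lambda>a. h a b) \<in> linear_map K A1.S M"
      "\<And>a. a \<in> carrier A1.S \<Longrightarrow> h a \<in> linear_map K A2.S M"
    and h': "\<And>b. b \<in> carrier A2.S \<Longrightarrow> (\<lambda>a. h' a b) \<in> linear_map K A1.S M"
      "\<And>a. a \<in> carrier A1.S \<Longrightarrow> h' a \<in> linear_map K A2.S M"
    and eq: "\<And>x y. \<lbrakk>x \<in> carrier G1; y \<in> carrier G2\<rbrakk> \<Longrightarrow> h (A1.e x) (A2.e y) = h' (A1.e x) (A2.e y)"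
    and a: "a \<in> carrier A1.S" and b: "b \<in> carrier A2.S"
  shows "h a b = h' a b"
proof (rule A1.S_eqI[OF M h(1)[OF b] h'(1)[OF b] _ a])
  fix x assume x: "x \<in> carrier G1"
  show "h (A1.e x) b = h' (A1.e x) b"
    by (rule A2.S_eqI[OF M h(2) h'(2) _ b]) (use x eq in auto)
qed

end

lemma (in abelian_monoid) finsum_zero_one:
  "\<lbrakk>f 0 \<in> carrier G; f 1 \<in> carrier G\<rbrakk> \<Longrightarrow> (\<Oplus>k\<in>{0, 1::nat}. f k) = f 0 \<oplus> f 1"
  by (subst finsum_insert) auto

section \<open>Multiplicativity of the pairing\<close>

context graded_product_algebra
begin

lemma \<beta>_comp1: "\<lbrakk>f \<in> linear_map K V A1.S; b \<in> carrier A2.S\<rbrakk> \<Longrightarrow> (\<lambda>v. \<beta> (f v) b) \<in> linear_map K V S"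
  using linear_map_comp[OF _ \<beta>_linear1] .

lemma \<beta>_comp2: "\<lbrakk>f \<in> linear_map K V A2.S; a \<in> carrier A1.S\<rbrakk> \<Longrightarrow> (\<lambda>v. \<beta> a (f v)) \<in> linear_map K V S"
  using linear_map_comp[OF _ \<beta>_linear2] .

lemma \<beta>_zero:
  "b \<in> carrier A2.S \<Longrightarrow> \<beta> \<zero>\<^bsub>A1.S\<^esub> b = \<zero>\<^bsub>S\<^esub>" "a \<in> carrier A1.S \<Longrightarrow> \<beta> a \<zero>\<^bsub>A2.S\<^esub> = \<zero>\<^bsub>S\<^esub>"
  using linear_map_zero[OF A1.S.module_axioms S.module_axioms \<beta>_linear1]
    linear_map_zero[OF A2.S.module_axioms S.module_axioms \<beta>_linear2] by blast+

lemmas linear_intros =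
  \<beta>_comp1 \<beta>_comp2 linear_map_add[OF S.module_axioms] linear_map_smult[OF S.module_axioms]
  linear_map_mult[OF A1.S_assoc_algebra] linear_map_mult[OF A2.S_assoc_algebra]
  linear_map_mult[OF S_assoc_algebra] linear_map_id A1.component_linear A2.component_linear

text \<open>Both sides are linear in each of the four arguments, which reduces multiplicativity to
  the group law of G on the elements \<open>e [x, y]\<close>.\<close>

lemma mult_eqI:
  assumes lin: "\<And>b a' b'. \<lbrakk>b \<in> carrier A2.S; a' \<in> carrier A1.S; b' \<in> carrier A2.S\<rbrakk>
        \<Longrightarrow> (\<lambda>a. h a b a' b') \<in> linear_map K A1.S S"
      "\<And>a a' b'. \<lbrakk>a \<in> carrier A1.S; a' \<in> carrier A1.S; b' \<in> carrier A2.S\<rbrakk>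
        \<Longrightarrow> (\<lambda>b. h a b a' b') \<in> linear_map K A2.S S"
      "\<And>a b b'. \<lbrakk>a \<in> carrier A1.S; b \<in> carrier A2.S; b' \<in> carrier A2.S\<rbrakk>
        \<Longrightarrow> (\<lambda>a'. h a b a' b') \<in> linear_map K A1.S S"
      "\<And>a b a'. \<lbrakk>a \<in> carrier A1.S; b \<in> carrier A2.S; a' \<in> carrier A1.S\<rbrakk>
        \<Longrightarrow> (\<lambda>b'. h a b a' b') \<in> linear_map K A2.S S"
    and eq: "\<And>x y x' y'. \<lbrakk>x \<in> carrier G1; y \<in> carrier G2; x' \<in> carrier G1; y' \<in> carrier G2\<rbrakk>
        \<Longrightarrow> h (A1.e x) (A2.e y) (A1.e x') (A2.e y') = e (q x y \<otimes>\<^bsub>G\<^esub> q x' y')"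
    and a: "a \<in> carrier A1.S" "b \<in> carrier A2.S" "a' \<in> carrier A1.S" "b' \<in> carrier A2.S"
  shows "h a b a' b' = \<beta> a b \<otimes>\<^bsub>S\<^esub> \<beta> a' b'"
proof (rule \<beta>_eqI[OF S.module_axioms lin(1) lin(2) _ _ _ a(1,2)])
  fix x y assume x: "x \<in> carrier G1" and y: "y \<in> carrier G2"
  show "h (A1.e x) (A2.e y) a' b' = \<beta> (A1.e x) (A2.e y) \<otimes>\<^bsub>S\<^esub> \<beta> a' b'"
    by (rule \<beta>_eqI[OF S.module_axioms lin(3) lin(4) _ _ _ a(3,4)])
       (use x y in \<open>auto simp: \<beta>_e eq intro!: linear_intros\<close>)
qed (use a in \<open>auto intro!: linear_intros\<close>)

lemma \<beta>_delta:
  assumes "a \<in> carrier A1.S" "b \<in> carrier A2.S"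
  shows "lin_ext K S (\<lambda>(a, b). \<beta> a b) (delta K (a, b)) = \<beta> a b"
  using assms by (subst lin_ext_delta[OF S.module_axioms, of _ "carrier A1.S \<times> carrier A2.S"]) auto

text \<open>The twist of the group law survives as the scalar s to the power d(x')d(y): trivial for
  s = 1, and for s = -1 the sign rule of graded algebra.\<close>

lemma e_q_mult:
  assumes "x \<in> carrier G1" "y \<in> carrier G2" "x' \<in> carrier G1" "y' \<in> carrier G2"
  shows "e (q x y \<otimes>\<^bsub>G\<^esub> q x' y') =
    (if even (gdeg G1 x' * gdeg G2 y) then e (q (x \<otimes>\<^bsub>G1\<^esub> x') (y \<otimes>\<^bsub>G2\<^esub> y'))
     else s \<odot>\<^bsub>S\<^esub> e (q (x \<otimes>\<^bsub>G1\<^esub> x') (y \<otimes>\<^bsub>G2\<^esub> y')))"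
  using assms by (simp add: q_mult_zmul zmul_q[symmetric] e_zmul)

lemma tensor_algebra_isomorphic:
  assumes s: "s = \<one>\<^bsub>K\<^esub>"
  shows "algebra_isomorphic K S (tensor_algebra K A1.S A2.S)"
  unfolding tensor_algebra_def
proof (rule tensor_isomorphic)
  have one: "s \<odot>\<^bsub>S\<^esub> f = f" if "f \<in> carrier S" for f using S.smult_one[OF that] by (simp add: s)
  fix a b a' b'
  assume a: "a \<in> carrier A1.S" "b \<in> carrier A2.S" "a' \<in> carrier A1.S" "b' \<in> carrier A2.S"
  have "\<beta> (a \<otimes>\<^bsub>A1.S\<^esub> a') (b \<otimes>\<^bsub>A2.S\<^esub> b') = \<beta> a b \<otimes>\<^bsub>S\<^esub> \<beta> a' b'"
  proof (rule mult_eqI[where h = "\<lambda>a b a' b'. \<beta> (a \<otimes>\<^bsub>A1.S\<^esub> a') (b \<otimes>\<^bsub>A2.S\<^esub> b')", OF _ _ _ _ _ a])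
    show "\<beta> (A1.e x \<otimes>\<^bsub>A1.S\<^esub> A1.e x') (A2.e y \<otimes>\<^bsub>A2.S\<^esub> A2.e y') = e (q x y \<otimes>\<^bsub>G\<^esub> q x' y')"
      if "x \<in> carrier G1" "y \<in> carrier G2" "x' \<in> carrier G1" "y' \<in> carrier G2" for x y x' y'
      using that one by (simp add: \<beta>_e e_q_mult)
  qed (auto intro!: linear_intros)
  then show "lin_ext K S (\<lambda>(a, b). \<beta> a b) ((\<lambda>(a, b) (a', b'). delta K (a \<otimes>\<^bsub>A1.S\<^esub> a', b \<otimes>\<^bsub>A2.S\<^esub> b')) (a, b) (a', b'))
      = \<beta> a b \<otimes>\<^bsub>S\<^esub> \<beta> a' b'"
    using a by (simp add: \<beta>_delta)
qed (auto intro!: delta_free[OF K.is_cring])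

end

section \<open>The graded tensor product\<close>

locale graded_product_minus_algebra = graded_product_algebra G1 G2 G q K "\<ominus>\<^bsub>K\<^esub> \<one>\<^bsub>K\<^esub>" for G1 G2 G q K
begin

sublocale A1: minus_algebra K G1 by unfold_locales
sublocale A2: minus_algebra K G2 by unfold_locales

lemma graded_tensor_algebra_isomorphic:
  "algebra_isomorphic K S (graded_tensor_algebra K
     A1.S (group_algebra_minus_part K G1) A2.S (group_algebra_minus_part K G2))"
  unfolding graded_tensor_algebra_def Let_def
proof (rule tensor_isomorphic)
  let ?F = "free_module K (carrier A1.S \<times> carrier A2.S)"
  interpret F: module K ?F by (rule free_module_module[OF K.is_cring])
  let ?\<mu> = "\<lambda>(a, b) (a', b'). \<Oplus>\<^bsub>?F\<^esub>k\<in>{0, 1}. \<Oplus>\<^bsub>?F\<^esub>l\<in>{0, 1}.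
      ((\<ominus>\<^bsub>K\<^esub> \<one>\<^bsub>K\<^esub>) [^]\<^bsub>K\<^esub> (k * l)) \<odot>\<^bsub>?F\<^esub>
        delta K (a \<otimes>\<^bsub>A1.S\<^esub> homogeneous_component A1.S (group_algebra_minus_part K G1) l a',
          homogeneous_component A2.S (group_algebra_minus_part K G2) k b \<otimes>\<^bsub>A2.S\<^esub> b')"
  \<comment> \<open>The four terms belong to the possible degrees of b and a'; only the pair of odd
    components carries a sign. On spanning elements both arguments are homogeneous, so exactly one
    term is left, with the sign found in \<open>e_q_mult\<close>.\<close>
  let ?h = "\<lambda>a b a' b'.
      (\<beta> (a \<otimes>\<^bsub>A1.S\<^esub> A1.component 0 a') (A2.component 0 b \<otimes>\<^bsub>A2.S\<^esub> b')
        \<oplus>\<^bsub>S\<^esub> \<beta> (a \<otimes>\<^bsub>A1.S\<^esub> A1.component 1 a') (A2.component 0 b \<otimes>\<^bsub>A2.S\<^esub> b'))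
      \<oplus>\<^bsub>S\<^esub> (\<beta> (a \<otimes>\<^bsub>A1.S\<^esub> A1.component 0 a') (A2.component 1 b \<otimes>\<^bsub>A2.S\<^esub> b')
        \<oplus>\<^bsub>S\<^esub> (\<ominus>\<^bsub>K\<^esub> \<one>\<^bsub>K\<^esub>) \<odot>\<^bsub>S\<^esub> \<beta> (a \<otimes>\<^bsub>A1.S\<^esub> A1.component 1 a') (A2.component 1 b \<otimes>\<^bsub>A2.S\<^esub> b'))"
  have d: "delta K (a, b) \<in> carrier ?F" if "a \<in> carrier A1.S" "b \<in> carrier A2.S" for a b
    by (rule delta_free[OF K.is_cring]) (use that in simp)
  note [simp] = linear_mapD(1)[OF A1.component_linear] linear_mapD(1)[OF A2.component_linear]
  have \<mu>_eq: "?\<mu> (a, b) (a', b') =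
      (delta K (a \<otimes>\<^bsub>A1.S\<^esub> A1.component 0 a', A2.component 0 b \<otimes>\<^bsub>A2.S\<^esub> b')
        \<oplus>\<^bsub>?F\<^esub> delta K (a \<otimes>\<^bsub>A1.S\<^esub> A1.component 1 a', A2.component 0 b \<otimes>\<^bsub>A2.S\<^esub> b'))
      \<oplus>\<^bsub>?F\<^esub> (delta K (a \<otimes>\<^bsub>A1.S\<^esub> A1.component 0 a', A2.component 1 b \<otimes>\<^bsub>A2.S\<^esub> b')
        \<oplus>\<^bsub>?F\<^esub> (\<ominus>\<^bsub>K\<^esub> \<one>\<^bsub>K\<^esub>) \<odot>\<^bsub>?F\<^esub> delta K (a \<otimes>\<^bsub>A1.S\<^esub> A1.component 1 a', A2.component 1 b \<otimes>\<^bsub>A2.S\<^esub> b'))"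
    if "a \<in> carrier A1.S" "b \<in> carrier A2.S" "a' \<in> carrier A1.S" "b' \<in> carrier A2.S" for a b a' b'
    using that
    by (simp add: F.M.finsum_zero_one A1.homogeneous_component_eq A2.homogeneous_component_eq d
        del: free_simps)
  show "?\<mu> x y \<in> carrier ?F" if "x \<in> carrier A1.S \<times> carrier A2.S" "y \<in> carrier A1.S \<times> carrier A2.S" for x y
  proof -
    obtain a b a' b' where xy: "x = (a, b)" "y = (a', b')" by (cases x, cases y)
    with that have "a \<in> carrier A1.S" "b \<in> carrier A2.S" "a' \<in> carrier A1.S" "b' \<in> carrier A2.S" by auto
    then show ?thesis unfolding xy by (subst \<mu>_eq) (simp_all add: d del: free_simps)
  qed
  fix a b a' b'
  assume a: "a \<in> carrier A1.S" "b \<in> carrier A2.S" "a' \<in> carrier A1.S" "b' \<in> carrier A2.S"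
  have \<Psi>: "lin_ext K S (\<lambda>(a, b). \<beta> a b) \<in> linear_map K ?F S"
    by (rule lin_ext_linear[OF S.module_axioms]) auto
  have "lin_ext K S (\<lambda>(a, b). \<beta> a b) (?\<mu> (a, b) (a', b')) = ?h a b a' b'"
    unfolding \<mu>_eq[OF a] using a
    by (simp add: linear_mapD(2,3)[OF \<Psi>] d \<beta>_delta del: free_simps)
  also have "\<dots> = \<beta> a b \<otimes>\<^bsub>S\<^esub> \<beta> a' b'"
  proof (rule mult_eqI[where h = ?h, OF _ _ _ _ _ a])
    show "?h (A1.e x) (A2.e y) (A1.e x') (A2.e y') = e (q x y \<otimes>\<^bsub>G\<^esub> q x' y')"
      if x: "x \<in> carrier G1" "y \<in> carrier G2" "x' \<in> carrier G1" "y' \<in> carrier G2" for x y x' y'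
      by (rule G1.gdeg_cases[OF x(3)]; rule G2.gdeg_cases[OF x(2)])
         (use x in \<open>simp_all add: A1.component_e A2.component_e \<beta>_zero \<beta>_e e_q_mult\<close>)
  qed (auto intro!: linear_intros)
  finally show "lin_ext K S (\<lambda>(a, b). \<beta> a b) (?\<mu> (a, b) (a', b')) = \<beta> a b \<otimes>\<^bsub>S\<^esub> \<beta> a' b'" .
qed

end

theorem group_algebra_graded_product:
  assumes K: "cring K" "\<one>\<^bsub>K\<^esub> \<oplus>\<^bsub>K\<^esub> \<one>\<^bsub>K\<^esub> \<in> Units K"
    and G: "centrally_graded_group G1" "centrally_graded_group G2"
      "gelt G1 \<noteq> \<one>\<^bsub>G1\<^esub>" "gelt G2 \<noteq> \<one>\<^bsub>G2\<^esub>"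
  shows "algebra_isomorphic K (group_algebra_plus K (graded_product G1 G2))
      (tensor_algebra K (group_algebra_plus K G1) (group_algebra_plus K G2))"
    and "algebra_isomorphic K (group_algebra_minus K (graded_product G1 G2))
      (graded_tensor_algebra K
         (group_algebra_minus K G1) (group_algebra_minus_part K G1)
         (group_algebra_minus K G2) (group_algebra_minus_part K G2))"
proof -
  interpret K: cring K by fact
  interpret P: graded_product_of G1 G2 "graded_product G1 G2" "\<lambda>x y. gcls G1 G2 (x, y)"
    by (rule graded_product_of_graded_product[OF G])
  have sign: "graded_product_algebra G1 G2 (graded_product G1 G2) (\<lambda>x y. gcls G1 G2 (x, y)) K s"
    if "s \<in> carrier K" "s \<otimes>\<^bsub>K\<^esub> s = \<one>\<^bsub>K\<^esub>" for s
    using that K by unfold_locales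
  show "algebra_isomorphic K (group_algebra_plus K (graded_product G1 G2))
      (tensor_algebra K (group_algebra_plus K G1) (group_algebra_plus K G2))"
    by (rule graded_product_algebra.tensor_algebra_isomorphic[OF sign]) simp_all
  show "algebra_isomorphic K (group_algebra_minus K (graded_product G1 G2))
      (graded_tensor_algebra K
         (group_algebra_minus K G1) (group_algebra_minus_part K G1)
         (group_algebra_minus K G2) (group_algebra_minus_part K G2))"
    by (rule graded_product_minus_algebra.graded_tensor_algebra_isomorphic)
       (rule graded_product_minus_algebra.intro, rule sign, simp_all add: K.l_minus)
qed

section \<open>The groups \<open>Q(t)\<close>\<close>

lemma transport_simps:
  assumes "inj_on f (carrier G)"
  shows "carrier (transport_graded_group f G) = f ` carrier G"
    and "\<one>\<^bsub>transport_graded_group f G\<^esub> = f \<one>\<^bsub>G\<^esub>"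
    and "gelt (transport_graded_group f G) = f (gelt G)"
    and "\<lbrakk>x \<in> carrier G; y \<in> carrier G\<rbrakk> \<Longrightarrow> f x \<otimes>\<^bsub>transport_graded_group f G\<^esub> f y = f (x \<otimes>\<^bsub>G\<^esub> y)"
    and "x \<in> carrier G \<Longrightarrow> gdeg (transport_graded_group f G) (f x) = gdeg G x"
  using assms by (simp_all add: transport_graded_group_def)

lemma transport_centrally_graded_group:
  assumes G: "centrally_graded_group G" and f: "inj_on f (carrier G)"
  shows "centrally_graded_group (transport_graded_group f G)"
proof -
  interpret centrally_graded_group G by fact
  note simps = transport_simps[OF f]
  have "group (transport_graded_group f G)"
  proof (rule groupI)
    show "\<exists>y\<in>carrier (transport_graded_group f G).
        y \<otimes>\<^bsub>transport_graded_group f G\<^esub> x = \<one>\<^bsub>transport_graded_group f G\<^esub>"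
      if "x \<in> carrier (transport_graded_group f G)" for x
    proof -
      from that obtain g where g: "g \<in> carrier G" "x = f g" by (auto simp: simps)
      then have "f (inv\<^bsub>G\<^esub> g) \<otimes>\<^bsub>transport_graded_group f G\<^esub> x = \<one>\<^bsub>transport_graded_group f G\<^esub>"
        by (simp add: simps)
      moreover have "f (inv\<^bsub>G\<^esub> g) \<in> carrier (transport_graded_group f G)" using g by (simp add: simps)
      ultimately show ?thesis by blast
    qed
  qed (auto simp: simps m_assoc)
  moreover have "gdeg G x \<in> carrier (integer_mod_group 2)" if "x \<in> carrier G" for x
    using gdeg_hom that by (auto simp: hom_def)
  ultimately show ?thesis
    by (intro centrally_graded_group.intro centrally_graded_group_axioms.intro homI)
       (auto simp: simps gelt_closed gelt_square gdeg_gelt gelt_central)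
qed

text \<open>The locale fixes the product only up to a choice of class map, so relabelling elements
  just composes \<open>q\<close> with the relabelling.\<close>

lemma graded_product_of_transport:
  assumes "graded_product_of G1 G2 G q" and f: "inj_on f (carrier G)"
  shows "graded_product_of G1 G2 (transport_graded_group f G) (\<lambda>x y. f (q x y))"
proof -
  interpret graded_product_of G1 G2 G q by fact
  note simps = transport_simps[OF f]
  show ?thesis
  proof (intro graded_product_of.intro graded_product_of_axioms.intro)
    show "carrier (transport_graded_group f G) = (\<lambda>(x, y). f (q x y)) ` (carrier G1 \<times> carrier G2)"
      by (auto simp: simps carrier_eq)
    show "f (q x y) = f (q x' y') \<longleftrightarrow>
        (x' = x \<and> y' = y) \<or> (x' = gelt G1 \<otimes>\<^bsub>G1\<^esub> x \<and> y' = gelt G2 \<otimes>\<^bsub>G2\<^esub> y)"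
      if "x \<in> carrier G1" "x' \<in> carrier G1" "y \<in> carrier G2" "y' \<in> carrier G2" for x x' y y'
      using that inj_on_eq_iff[OF f, of "q x y" "q x' y'"] by (simp add: q_eq_iff)
  qed (use G1.gelt_closed nontrivial in \<open>auto simp: simps q_mult one_eq gelt_eq gdeg_q
      G1.centrally_graded_group_axioms G2.centrally_graded_group_axioms\<close>)
qed

section \<open>The groups Q(t) as iterated graded products\<close>

lemma Q1_simps:
  "carrier (Q1 t) = {(0, 0), (0, 1), (1, 0), (1, 1)}"
  "\<one>\<^bsub>Q1 t\<^esub> = (0, 0)" "gelt (Q1 t) = (1, 0)" "gdeg (Q1 t) = snd"
  "(x0, x1) \<otimes>\<^bsub>Q1 t\<^esub> (y0, y1) =
    (case t of One \<Rightarrow> ((x0 + y0) mod 2, (x1 + y1) mod 2)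
             | Zed \<Rightarrow> ((x0 + y0 + x1 * y1) mod 2, (x1 + y1) mod 2))"
  by (auto simp: Q1_def)

lemma Q1_mult:
  "(x0, x1) \<otimes>\<^bsub>Q1 t\<^esub> (y0, y1) = ((x0 + y0 + (if t = Zed then x1 * y1 else 0)) mod 2, (x1 + y1) mod 2)"
  by (cases t) (simp_all add: Q1_simps)

lemma Q1_centrally_graded_group: "centrally_graded_group (Q1 t)"
proof -
  have "\<forall>x\<in>carrier (Q1 t). \<forall>y\<in>carrier (Q1 t). \<forall>w\<in>carrier (Q1 t).
      x \<otimes>\<^bsub>Q1 t\<^esub> y \<otimes>\<^bsub>Q1 t\<^esub> w = x \<otimes>\<^bsub>Q1 t\<^esub> (y \<otimes>\<^bsub>Q1 t\<^esub> w)"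
    "\<forall>x\<in>carrier (Q1 t). \<forall>y\<in>carrier (Q1 t). x \<otimes>\<^bsub>Q1 t\<^esub> y \<in> carrier (Q1 t)"
    "\<forall>x\<in>carrier (Q1 t). \<one>\<^bsub>Q1 t\<^esub> \<otimes>\<^bsub>Q1 t\<^esub> x = x"
    "\<forall>x\<in>carrier (Q1 t). \<exists>y\<in>carrier (Q1 t). y \<otimes>\<^bsub>Q1 t\<^esub> x = \<one>\<^bsub>Q1 t\<^esub>"
    by (cases t; simp add: Q1_simps)+
  then have group: "group (Q1 t)"
    by (intro groupI) (blast, simp add: Q1_simps, blast+)
  have hom: "gdeg (Q1 t) \<in> hom (Q1 t) (integer_mod_group 2)"
    unfolding hom_def Pi_def Ball_def[symmetric] mem_Collect_eq
    by (cases t) (simp_all add: Q1_simps carrier_integer_mod_group)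
  have central: "\<forall>x\<in>carrier (Q1 t). gelt (Q1 t) \<otimes>\<^bsub>Q1 t\<^esub> x = x \<otimes>\<^bsub>Q1 t\<^esub> gelt (Q1 t)"
    by (cases t) (simp_all add: Q1_simps)
  show ?thesis
    by (rule centrally_graded_group.intro[OF group centrally_graded_group_axioms.intro[OF hom _ bspec[OF central]]])
       (cases t; simp add: Q1_simps)+
qed

definition "Z2 = (Q1 One)\<lparr>carrier := {0, 1} \<times> {0}\<rparr>"

lemma Z2_simps:
  "carrier Z2 = {(0, 0), (1, 0)}" "\<one>\<^bsub>Z2\<^esub> = (0, 0)" "gelt Z2 = (1, 0)" "gdeg Z2 = snd"
  "(x0, x1) \<otimes>\<^bsub>Z2\<^esub> (y0, y1) = ((x0 + y0) mod 2, (x1 + y1) mod 2)"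
  by (auto simp: Q1_def Z2_def)

lemma Z2_centrally_graded_group: "centrally_graded_group Z2"
proof -
  have "group Z2" by (rule groupI) (auto simp: Z2_simps)
  then show ?thesis
    by (intro centrally_graded_group.intro centrally_graded_group_axioms.intro homI)
       (auto simp: Z2_simps carrier_integer_mod_group)
qed

declare Q.simps [simp del]

lemma Q_Nil: "Q [] = transport_graded_group Base Z2"
  by (simp add: Q.simps Z2_def)

lemma Q_Nil_simps:
  "carrier (Q []) = {Base (0, 0), Base (1, 0)}" "\<one>\<^bsub>Q []\<^esub> = Base (0, 0)" "gelt (Q []) = Base (1, 0)"
  "\<lbrakk>p \<in> carrier Z2; p' \<in> carrier Z2\<rbrakk> \<Longrightarrow> Base p \<otimes>\<^bsub>Q []\<^esub> Base p' = Base (p \<otimes>\<^bsub>Z2\<^esub> p')"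
  "p \<in> carrier Z2 \<Longrightarrow> gdeg (Q []) (Base p) = snd p"
proof -
  have inj: "inj_on Base (carrier Z2)" by (auto intro: inj_onI)
  note s = transport_simps[OF inj]
  show "carrier (Q []) = {Base (0, 0), Base (1, 0)}" "\<one>\<^bsub>Q []\<^esub> = Base (0, 0)" "gelt (Q []) = Base (1, 0)"
    "\<lbrakk>p \<in> carrier Z2; p' \<in> carrier Z2\<rbrakk> \<Longrightarrow> Base p \<otimes>\<^bsub>Q []\<^esub> Base p' = Base (p \<otimes>\<^bsub>Z2\<^esub> p')"
    "p \<in> carrier Z2 \<Longrightarrow> gdeg (Q []) (Base p) = snd p"
    unfolding Q_Nil by (simp_all only: s) (simp_all add: Z2_simps)
qed

lemma Q_Nil_centrally_graded_group: "centrally_graded_group (Q [])"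
  unfolding Q_Nil by (rule transport_centrally_graded_group[OF Z2_centrally_graded_group]) (auto intro: inj_onI)

text \<open>By its recursion equations \<open>Q [t]\<close> is a copy of \<open>Q1 t\<close>, not a
  product. Sending (x, Z^k) to Z^k x exhibits it as the product with the unit \<open>Q []\<close>,
  so later inductions can start at the empty list with one uniform step.\<close>

lemma Q_single: "\<exists>q. graded_product_of (Q1 t) (Q []) (Q [t]) q"
proof -
  let ?q = "\<lambda>x y. case y of Base p \<Rightarrow> ((fst x + fst p) mod 2, snd x)"
  let ?z = "\<lambda>x' y. gelt (Q1 t) [^]\<^bsub>Q1 t\<^esub> (gdeg (Q1 t) x' * gdeg (Q []) y)"
  have q: "\<forall>x\<in>carrier (Q1 t). \<forall>x'\<in>carrier (Q1 t). \<forall>y\<in>carrier (Q []). \<forall>y'\<in>carrier (Q []).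
      (?q x y = ?q x' y' \<longleftrightarrow> (x' = x \<and> y' = y) \<or> (x' = gelt (Q1 t) \<otimes>\<^bsub>Q1 t\<^esub> x \<and> y' = gelt (Q []) \<otimes>\<^bsub>Q []\<^esub> y))
      \<and> ?q x y \<otimes>\<^bsub>Q1 t\<^esub> ?q x' y' = ?q (?z x' y \<otimes>\<^bsub>Q1 t\<^esub> (x \<otimes>\<^bsub>Q1 t\<^esub> x')) (y \<otimes>\<^bsub>Q []\<^esub> y')"
    by (cases t) (simp_all add: Q1_simps Q_Nil_simps Z2_simps)
  have "carrier (Q1 t) = (\<lambda>(x, y). ?q x y) ` (carrier (Q1 t) \<times> carrier (Q []))"
    unfolding Q1_simps(1) Q_Nil_simps(1) by auto
  then have "graded_product_of (Q1 t) (Q []) (Q1 t) ?q"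
  proof (intro graded_product_of.intro[OF Q1_centrally_graded_group Q_Nil_centrally_graded_group]
        graded_product_of_axioms.intro)
    fix x x' y y'
    assume c: "x \<in> carrier (Q1 t)" "x' \<in> carrier (Q1 t)" "y \<in> carrier (Q [])" "y' \<in> carrier (Q [])"
    note q = bspec[OF bspec[OF bspec[OF bspec[OF q c(1)] c(2)] c(3)] c(4)]
    show "?q x y = ?q x' y' \<longleftrightarrow> (x' = x \<and> y' = y) \<or> (x' = gelt (Q1 t) \<otimes>\<^bsub>Q1 t\<^esub> x \<and> y' = gelt (Q []) \<otimes>\<^bsub>Q []\<^esub> y)"
      by (rule conjunct1[OF q])
    show "?q x y \<otimes>\<^bsub>Q1 t\<^esub> ?q x' y' = ?q (?z x' y \<otimes>\<^bsub>Q1 t\<^esub> (x \<otimes>\<^bsub>Q1 t\<^esub> x')) (y \<otimes>\<^bsub>Q []\<^esub> y')"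
      by (rule conjunct2[OF q])
  qed (auto simp: Q1_simps Q_Nil_simps Z2_simps)
  then have "graded_product_of (Q1 t) (Q []) (Q [t]) (\<lambda>x y. Base (?q x y))"
    unfolding Q.simps(2) by (rule graded_product_of_transport) (auto intro: inj_onI)
  then show ?thesis by blast
qed

text \<open>The three claims are proved together because forming the next product requires that
  \<open>Q ts\<close> is centrally graded with a non-trivial grading element.\<close>

lemma Q_graded_product:
  "centrally_graded_group (Q ts) \<and> gelt (Q ts) \<noteq> \<one>\<^bsub>Q ts\<^esub> \<and>
    (\<forall>t. \<exists>q. graded_product_of (Q1 t) (Q ts) (Q (t # ts)) q)"
proof (induction ts)
  case Nil
  have "gelt (Q []) \<noteq> \<one>\<^bsub>Q []\<^esub>" by (simp add: Q_Nil_simps)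
  then show ?case using Q_single Q_Nil_centrally_graded_group by blast
next
  case (Cons u ts)
  then obtain q where "graded_product_of (Q1 u) (Q ts) (Q (u # ts)) q" by blast
  then interpret graded_product_of "Q1 u" "Q ts" "Q (u # ts)" q .
  have "\<exists>q. graded_product_of (Q1 t) (Q (u # ts)) (Q (t # u # ts)) q" for t
  proof -
    interpret P: graded_product_of "Q1 t" "Q (u # ts)" "graded_product (Q1 t) (Q (u # ts))"
      "\<lambda>x y. gcls (Q1 t) (Q (u # ts)) (x, y)"
      by (rule graded_product_of_graded_product)
         (simp_all add: Q1_centrally_graded_group G.centrally_graded_group_axioms gelt_neq_one Q1_simps)
    \<comment> \<open>Each class has at most two elements, and \<open>Abs_fset\<close> is injective
      on finite sets, so the wrapping loses nothing.\<close>
    have fin: "finite X" if "X \<in> carrier (graded_product (Q1 t) (Q (u # ts)))" for X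
      using that
      by (elim P.carrierE)
         (simp add: gcls_eq[OF Q1_centrally_graded_group G.centrally_graded_group_axioms])
    have "inj_on (\<lambda>X. Class (Abs_fset X)) (carrier (graded_product (Q1 t) (Q (u # ts))))"
      by (rule inj_onI) (simp add: Abs_fset_inject fin)
    then have "graded_product_of (Q1 t) (Q (u # ts)) (Q (t # u # ts))
        (\<lambda>x y. Class (Abs_fset (gcls (Q1 t) (Q (u # ts)) (x, y))))"
      unfolding Q.simps(3) by (rule graded_product_of_transport[OF P.graded_product_of_axioms])
    then show ?thesis by blast
  qed
  then show ?case using G.centrally_graded_group_axioms gelt_neq_one by blast
qed

lemmas Q_centrally_graded_group = Q_graded_product[THEN conjunct1]

lemma Q_Cons:
  obtains q where "graded_product_of (Q1 t) (Q ts) (Q (t # ts)) q"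
  using Q_graded_product by blast

section \<open>A presentation of Q(t) by generators and relations\<close>

definition clifford_family :: "('a, 'm) monoid_scheme \<Rightarrow> 'a \<Rightarrow> one_or_Z list \<Rightarrow> (nat \<Rightarrow> 'a) \<Rightarrow> bool" where
  "clifford_family M z ts c \<longleftrightarrow>
    (\<forall>i<length ts. c i \<in> carrier M \<and> c i \<otimes>\<^bsub>M\<^esub> c i = (case ts ! i of One \<Rightarrow> \<one>\<^bsub>M\<^esub> | Zed \<Rightarrow> z)) \<and>
    (\<forall>i<length ts. \<forall>j<length ts. i \<noteq> j \<longrightarrow> c i \<otimes>\<^bsub>M\<^esub> c j = z \<otimes>\<^bsub>M\<^esub> (c j \<otimes>\<^bsub>M\<^esub> c i))"

lemma clifford_familyD:
  assumes "clifford_family M z ts c" "i < length ts"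
  shows "c i \<in> carrier M"
    and "c i \<otimes>\<^bsub>M\<^esub> c i = (case ts ! i of One \<Rightarrow> \<one>\<^bsub>M\<^esub> | Zed \<Rightarrow> z)"
    and "\<lbrakk>j < length ts; i \<noteq> j\<rbrakk> \<Longrightarrow> c i \<otimes>\<^bsub>M\<^esub> c j = z \<otimes>\<^bsub>M\<^esub> (c j \<otimes>\<^bsub>M\<^esub> c i)"
  using assms unfolding clifford_family_def by blast+

text \<open>Generation as a monoid. The sets \<open>H\<close> need not lie in the carrier, so that
  any predicate can take their place in \<open>generated_by_induct\<close>.\<close>

definition generated_by :: "('a, 'm) monoid_scheme \<Rightarrow> 'a set \<Rightarrow> bool" where
  "generated_by G X \<longleftrightarrow> (\<forall>H. \<one>\<^bsub>G\<^esub> \<in> H \<and> X \<subseteq> H \<and>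
    (\<forall>x\<in>carrier G \<inter> H. \<forall>y\<in>carrier G \<inter> H. x \<otimes>\<^bsub>G\<^esub> y \<in> H) \<longrightarrow> carrier G \<subseteq> H)"

lemma generated_by_induct:
  assumes "generated_by G X" "x \<in> carrier G" "P \<one>\<^bsub>G\<^esub>" "\<And>x. x \<in> X \<Longrightarrow> P x"
    "\<And>x y. \<lbrakk>x \<in> carrier G; y \<in> carrier G; P x; P y\<rbrakk> \<Longrightarrow> P (x \<otimes>\<^bsub>G\<^esub> y)"
  shows "P x"
proof -
  have "carrier G \<subseteq> Collect P"
    using assms(1)[unfolded generated_by_def, rule_format, of "Collect P"] assms(3-) by auto
  then show ?thesis using assms(2) by blast
qed

text \<open>The targets of the universal property. The element \<open>z\<close> generalizes -1;
  monoids rather than groups are needed because the target will be the multiplicative monoid of the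
  Clifford algebra.\<close>

locale central_involution = monoid M for M :: "('c, 'x) monoid_scheme" (structure) +
  fixes z :: 'c
  assumes z_closed [simp]: "z \<in> carrier M" and z_square: "z \<otimes> z = \<one>"
    and z_central: "x \<in> carrier M \<Longrightarrow> x \<otimes> z = z \<otimes> x"
begin

lemma z_left: "\<lbrakk>x \<in> carrier M; y \<in> carrier M\<rbrakk> \<Longrightarrow> x \<otimes> (z \<otimes> y) = z \<otimes> (x \<otimes> y)"
  using z_central by (simp add: m_assoc[symmetric])

lemma z_z: "x \<in> carrier M \<Longrightarrow> z \<otimes> (z \<otimes> x) = x"
  by (simp add: m_assoc[symmetric] z_square)

end

text \<open>With a = (0, 1), the new generator is [a, 1] and the old ones become [1, g i]. Since a
  and the \<open>g i\<close> are odd, [1, g i][a, 1] picks up Z while [a, 1][1, g i] does not, and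
  products among the [1, g i] get no extra power of Z. The degrees are carried along because they
  produce this Z at the next step.\<close>

lemma clifford_family_Q_Cons:
  assumes "graded_product_of (Q1 t) (Q ts) (Q (t # ts)) q"
    and g: "clifford_family (Q ts) (gelt (Q ts)) ts g" "\<forall>i<length ts. gdeg (Q ts) (g i) = 1"
  defines "g' \<equiv> \<lambda>i. case i of 0 \<Rightarrow> q (0, 1) \<one>\<^bsub>Q ts\<^esub> | Suc i \<Rightarrow> q (0, 0) (g i)"
  shows "clifford_family (Q (t # ts)) (gelt (Q (t # ts))) (t # ts) g'"
    and "\<forall>i<length (t # ts). gdeg (Q (t # ts)) (g' i) = 1"
proof -
  interpret graded_product_of "Q1 t" "Q ts" "Q (t # ts)" q by fact
  have gc: "g i \<in> carrier (Q ts)" if "i < length ts" for i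
    using clifford_familyD(1)[OF g(1)] that .
  have c: "(0, 0) \<in> carrier (Q1 t)" "(0, 1) \<in> carrier (Q1 t)" "(1, 0) \<in> carrier (Q1 t)" "(1, 1) \<in> carrier (Q1 t)"
    by (simp_all add: Q1_simps(1-4) Q1_mult)
  note z = q_gelt(1)[symmetric]
  have 0: "g' 0 \<otimes>\<^bsub>Q (t # ts)\<^esub> g' 0 = (case t of One \<Rightarrow> \<one>\<^bsub>Q (t # ts)\<^esub> | Zed \<Rightarrow> gelt (Q (t # ts)))"
    unfolding one_eq gelt_eq
    by (simp add: g'_def c q_mult_zmul Q1_simps(1-4) Q1_mult split: one_or_Z.split)
  have S: "g' (Suc i) \<otimes>\<^bsub>Q (t # ts)\<^esub> g' (Suc i) = (case ts ! i of One \<Rightarrow> \<one>\<^bsub>Q (t # ts)\<^esub> | Zed \<Rightarrow> gelt (Q (t # ts)))"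
    if i: "i < length ts" for i
  proof -
    have "g' (Suc i) \<otimes>\<^bsub>Q (t # ts)\<^esub> g' (Suc i) = q \<one>\<^bsub>Q1 t\<^esub> (g i \<otimes>\<^bsub>Q ts\<^esub> g i)"
      using gc[OF i] c by (simp add: g'_def q_mult_zmul Q1_simps(1-4) Q1_mult)
    then show ?thesis
      using clifford_familyD(2)[OF g(1) i] q_zmul[of "\<one>\<^bsub>Q1 t\<^esub>" "\<one>\<^bsub>Q ts\<^esub>" 1]
      by (auto simp: one_eq gelt_eq G1.zmul_one_eq_gelt G2.zmul_one_eq_gelt split: one_or_Z.splits)
  qed
  have SS: "g' (Suc i) \<otimes>\<^bsub>Q (t # ts)\<^esub> g' (Suc j) = gelt (Q (t # ts)) \<otimes>\<^bsub>Q (t # ts)\<^esub> (g' (Suc j) \<otimes>\<^bsub>Q (t # ts)\<^esub> g' (Suc i))"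
    if "i < length ts" "j < length ts" "i \<noteq> j" for i j
  proof -
    have m: "g' (Suc i) \<otimes>\<^bsub>Q (t # ts)\<^esub> g' (Suc j) = q \<one>\<^bsub>Q1 t\<^esub> (g i \<otimes>\<^bsub>Q ts\<^esub> g j)" if "i < length ts" "j < length ts" for i j
      using gc that c by (simp add: g'_def q_mult_zmul Q1_simps(1-4) Q1_mult)
    have "g i \<otimes>\<^bsub>Q ts\<^esub> g j = gelt (Q ts) \<otimes>\<^bsub>Q ts\<^esub> (g j \<otimes>\<^bsub>Q ts\<^esub> g i)"
      using clifford_familyD(3)[OF g(1)] that .
    then show ?thesis using m that gc c by (simp add: q_gelt Q1_simps(2))
  qed
  have m0: "g' 0 \<otimes>\<^bsub>Q (t # ts)\<^esub> g' (Suc i) = q (0, 1) (g i)"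
    "g' (Suc i) \<otimes>\<^bsub>Q (t # ts)\<^esub> g' 0 = gelt (Q (t # ts)) \<otimes>\<^bsub>Q (t # ts)\<^esub> q (0, 1) (g i)" if i: "i < length ts" for i
    using gc[OF i] c g(2) i
    by (simp_all add: g'_def q_mult_zmul Q1_simps(1-4) Q1_mult z[OF c(2)] G1.zmul_odd)
  have Z: "X = gelt (Q (t # ts)) \<otimes>\<^bsub>Q (t # ts)\<^esub> (gelt (Q (t # ts)) \<otimes>\<^bsub>Q (t # ts)\<^esub> X)" if "X \<in> carrier (Q (t # ts))" for X
    using that G.gelt_closed by (simp add: G.m_assoc[symmetric] G.gelt_square)
  show "\<forall>i<length (t # ts). gdeg (Q (t # ts)) (g' i) = 1"
    using c g gc by (auto simp: g'_def gdeg_q Q1_simps(1-4) Q1_mult less_Suc_eq_0_disj)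
  show "clifford_family (Q (t # ts)) (gelt (Q (t # ts))) (t # ts) g'"
    unfolding clifford_family_def
  proof (intro conjI allI impI)
    fix i assume i: "i < length (t # ts)"
    show "g' i \<in> carrier (Q (t # ts))" using i c gc by (auto simp: g'_def less_Suc_eq_0_disj)
    show "g' i \<otimes>\<^bsub>Q (t # ts)\<^esub> g' i = (case (t # ts) ! i of One \<Rightarrow> \<one>\<^bsub>Q (t # ts)\<^esub> | Zed \<Rightarrow> gelt (Q (t # ts)))"
      using i 0 S by (cases i) auto
    fix j assume j: "j < length (t # ts)" "i \<noteq> j"
    show "g' i \<otimes>\<^bsub>Q (t # ts)\<^esub> g' j = gelt (Q (t # ts)) \<otimes>\<^bsub>Q (t # ts)\<^esub> (g' j \<otimes>\<^bsub>Q (t # ts)\<^esub> g' i)"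
    proof (cases i)
      case 0
      then obtain k where "j = Suc k" "k < length ts" using j by (cases j) auto
      then show ?thesis using 0 m0 Z gc c by simp
    next
      case (Suc i')
      then show ?thesis
      proof (cases j)
        case 0
        then show ?thesis using Suc i m0[of i'] by simp
      next
        case (Suc j')
        then show ?thesis using \<open>i = Suc i'\<close> i j SS[of i' j'] by simp
      qed
    qed
  qed
qed

text \<open>A closed set \<open>H\<close> contains every [1, y] by induction over the generation of
  \<open>Q ts\<close>, then every [a, y] = [a, 1][1, y] with a = (0, 1), and multiplication by Z
  reaches the two remaining elements of \<open>Q1 t\<close>.\<close>

lemma generated_by_Q_Cons:
  assumes "graded_product_of (Q1 t) (Q ts) (Q (t # ts)) q"
    and gc: "\<And>i. i < length ts \<Longrightarrow> g i \<in> carrier (Q ts)"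
    and gen: "generated_by (Q ts) (insert (gelt (Q ts)) (g ` {..<length ts}))"
  defines "g' \<equiv> \<lambda>i. case i of 0 \<Rightarrow> q (0, 1) \<one>\<^bsub>Q ts\<^esub> | Suc i \<Rightarrow> q (0, 0) (g i)"
  shows "generated_by (Q (t # ts)) (insert (gelt (Q (t # ts))) (g' ` {..<length (t # ts)}))"
proof -
  interpret graded_product_of "Q1 t" "Q ts" "Q (t # ts)" q by fact
  have c: "(0, 0) \<in> carrier (Q1 t)" "(0, 1) \<in> carrier (Q1 t)" "(1, 0) \<in> carrier (Q1 t)" "(1, 1) \<in> carrier (Q1 t)"
    by (simp_all add: Q1_simps(1-4) Q1_mult)
  have "X \<in> H"
    if one: "\<one>\<^bsub>Q (t # ts)\<^esub> \<in> H" and gens: "insert (gelt (Q (t # ts))) (g' ` {..<length (t # ts)}) \<subseteq> H"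
      and closed: "\<forall>x\<in>carrier (Q (t # ts)) \<inter> H. \<forall>y\<in>carrier (Q (t # ts)) \<inter> H. x \<otimes>\<^bsub>Q (t # ts)\<^esub> y \<in> H"
      and X: "X \<in> carrier (Q (t # ts))" for X H
  proof -
    have Z: "gelt (Q (t # ts)) \<in> H" and "g' 0 \<in> H" and g's: "\<And>i. i < length ts \<Longrightarrow> g' (Suc i) \<in> H"
      using gens by auto
    then have g0: "q (0, 1) \<one>\<^bsub>Q ts\<^esub> \<in> H" and gS: "\<And>i. i < length ts \<Longrightarrow> q (0, 0) (g i) \<in> H"
      by (simp_all add: g'_def)
    have y: "q (0, 0) y \<in> H" if y: "y \<in> carrier (Q ts)" for y
      using gen y
    proof (rule generated_by_induct)
      show "q (0, 0) \<one>\<^bsub>Q ts\<^esub> \<in> H" using one by (simp add: one_eq Q1_simps(1-4) Q1_mult)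
      show "q (0, 0) y \<in> H" if "y \<in> insert (gelt (Q ts)) (g ` {..<length ts})" for y
        using that gS Z q_zmul[of "(0, 0)" "\<one>\<^bsub>Q ts\<^esub>" 1] G1.zmul_one_eq_gelt c
        by (auto simp: G2.zmul_one_eq_gelt gelt_eq Q1_simps(1-4) Q1_mult)
      show "q (0, 0) (x \<otimes>\<^bsub>Q ts\<^esub> y) \<in> H"
        if "x \<in> carrier (Q ts)" "y \<in> carrier (Q ts)" "q (0, 0) x \<in> H" "q (0, 0) y \<in> H" for x y
      proof -
        have "q (0, 0) x \<otimes>\<^bsub>Q (t # ts)\<^esub> q (0, 0) y = q (0, 0) (x \<otimes>\<^bsub>Q ts\<^esub> y)"
          using that(1,2) c by (simp add: q_mult_zmul Q1_simps(1-4) Q1_mult)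
        then show ?thesis using closed that c by (metis IntI q_closed)
      qed
    qed
    have y1: "q (0, 1) y \<in> H" if "y \<in> carrier (Q ts)" for y
    proof -
      have "q (0, 1) \<one>\<^bsub>Q ts\<^esub> \<otimes>\<^bsub>Q (t # ts)\<^esub> q (0, 0) y = q (0, 1) y"
        using that c by (simp add: q_mult_zmul Q1_simps(1-4) Q1_mult)
      then show ?thesis using closed that c y g0 by (metis IntI q_closed G2.one_closed)
    qed
    have Zy: "q (gelt (Q1 t) \<otimes>\<^bsub>Q1 t\<^esub> x) y \<in> H" if "x \<in> carrier (Q1 t)" "y \<in> carrier (Q ts)" "q x y \<in> H" for x y
      using that closed Z G.gelt_closed by (simp add: q_gelt)
    have Zx: "gelt (Q1 t) \<otimes>\<^bsub>Q1 t\<^esub> (0, 0) = (1, 0)" "gelt (Q1 t) \<otimes>\<^bsub>Q1 t\<^esub> (0, 1) = (1, 1)"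
      by (simp_all add: Q1_simps(1-4) Q1_mult)
    obtain x y' where x: "x \<in> carrier (Q1 t)" "y' \<in> carrier (Q ts)" "X = q x y'" using X by (rule carrierE)
    have "x \<in> {(0, 0), (0, 1), (1, 0), (1, 1)}" using x(1) by (simp add: Q1_simps(1-4) Q1_mult)
    then show "X \<in> H" using x y y1 Zy[OF c(1)] Zy[OF c(2)] by (auto simp: Zx)
  qed
  then show ?thesis unfolding generated_by_def by blast
qed

text \<open>The homomorphism is \<phi> [x, y] = \<chi> x \<otimes> \<psi> y, with \<chi> given on
  \<open>Q1 t\<close> and \<psi> by induction. It is multiplicative exactly because \<psi> y and
  \<chi> x' commute up to z to the power d(x')d(y), the power of Z in the group law.\<close>

lemma (in central_involution) Q_Cons_hom:
  assumes "graded_product_of (Q1 t) (Q ts) (Q (t # ts)) q"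
    and g: "clifford_family (Q ts) (gelt (Q ts)) ts g" "\<forall>i<length ts. gdeg (Q ts) (g i) = 1"
    and gen: "generated_by (Q ts) (insert (gelt (Q ts)) (g ` {..<length ts}))"
    and c: "clifford_family M z (t # ts) c"
    and \<psi>: "\<psi> \<in> hom (Q ts) M" "\<psi> \<one>\<^bsub>Q ts\<^esub> = \<one>" "\<psi> (gelt (Q ts)) = z" "\<forall>i<length ts. \<psi> (g i) = c (Suc i)"
  defines "g' \<equiv> \<lambda>i. case i of 0 \<Rightarrow> q (0, 1) \<one>\<^bsub>Q ts\<^esub> | Suc i \<Rightarrow> q (0, 0) (g i)"
  shows "\<exists>\<phi>. \<phi> \<in> hom (Q (t # ts)) M \<and> \<phi> \<one>\<^bsub>Q (t # ts)\<^esub> = \<one> \<and> \<phi> (gelt (Q (t # ts))) = z \<and>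
    (\<forall>i<length (t # ts). \<phi> (g' i) = c i)"
proof -
  interpret graded_product_of "Q1 t" "Q ts" "Q (t # ts)" q by fact
  have c0: "c 0 \<in> carrier M" "c 0 \<otimes> c 0 = (case t of One \<Rightarrow> \<one> | Zed \<Rightarrow> z)"
    using clifford_familyD(1,2)[OF c, of 0] by simp_all
  have cS: "c (Suc i) \<otimes> c 0 = z \<otimes> (c 0 \<otimes> c (Suc i))" "c (Suc i) \<in> carrier M" if "i < length ts" for i
    using clifford_familyD(1,3)[OF c, of "Suc i"] that by simp_all
  have gc: "g i \<in> carrier (Q ts)" if "i < length ts" for i
    using clifford_familyD(1)[OF g(1)] that .
  have \<psi>_cl: "\<psi> y \<in> carrier M" if "y \<in> carrier (Q ts)" for y using \<psi>(1) that by (auto simp: hom_def)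
  have \<psi>_mult: "\<psi> (y \<otimes>\<^bsub>Q ts\<^esub> y') = \<psi> y \<otimes> \<psi> y'" if "y \<in> carrier (Q ts)" "y' \<in> carrier (Q ts)" for y y'
    using \<psi>(1) that by (auto simp: hom_def)
  \<comment> \<open>Each generator \<open>g i\<close> is odd and its image passes \<open>c 0\<close>
    at the cost of one z, whereas Z is even and central. So the power of z for a product of
    generators is its degree, by induction over the generation.\<close>
  have comm: "\<psi> y \<otimes> c 0 = (if gdeg (Q ts) y = 1 then z \<otimes> (c 0 \<otimes> \<psi> y) else c 0 \<otimes> \<psi> y)"
    if y: "y \<in> carrier (Q ts)" for y
    using gen y
  proof (rule generated_by_induct)
    show "\<psi> \<one>\<^bsub>Q ts\<^esub> \<otimes> c 0 = (if gdeg (Q ts) \<one>\<^bsub>Q ts\<^esub> = 1 then z \<otimes> (c 0 \<otimes> \<psi> \<one>\<^bsub>Q ts\<^esub>) else c 0 \<otimes> \<psi> \<one>\<^bsub>Q ts\<^esub>)"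
      using c0 by (simp add: \<psi>)
    show "\<psi> y \<otimes> c 0 = (if gdeg (Q ts) y = 1 then z \<otimes> (c 0 \<otimes> \<psi> y) else c 0 \<otimes> \<psi> y)"
      if "y \<in> insert (gelt (Q ts)) (g ` {..<length ts})" for y
      using that c0 cS \<psi> g(2) z_central by (auto simp: G2.gdeg_gelt)
    fix x y
    assume x: "x \<in> carrier (Q ts)" "\<psi> x \<otimes> c 0 = (if gdeg (Q ts) x = 1 then z \<otimes> (c 0 \<otimes> \<psi> x) else c 0 \<otimes> \<psi> x)"
      and y: "y \<in> carrier (Q ts)" "\<psi> y \<otimes> c 0 = (if gdeg (Q ts) y = 1 then z \<otimes> (c 0 \<otimes> \<psi> y) else c 0 \<otimes> \<psi> y)"
    have "\<psi> (x \<otimes>\<^bsub>Q ts\<^esub> y) \<otimes> c 0 = \<psi> x \<otimes> (\<psi> y \<otimes> c 0)"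
      using x(1) y(1) c0 \<psi>_cl by (simp add: \<psi>_mult m_assoc)
    also have "\<dots> = (if gdeg (Q ts) y = 1 then z \<otimes> ((\<psi> x \<otimes> c 0) \<otimes> \<psi> y) else (\<psi> x \<otimes> c 0) \<otimes> \<psi> y)"
      unfolding y(2) using x(1) y(1) c0 \<psi>_cl by (simp add: z_left[OF \<psi>_cl] m_assoc)
    also have "\<dots> = (if gdeg (Q ts) (x \<otimes>\<^bsub>Q ts\<^esub> y) = 1 then z \<otimes> (c 0 \<otimes> \<psi> (x \<otimes>\<^bsub>Q ts\<^esub> y)) else c 0 \<otimes> \<psi> (x \<otimes>\<^bsub>Q ts\<^esub> y))"
      unfolding x(2)
      by (rule G2.gdeg_cases[OF x(1)]; rule G2.gdeg_cases[OF y(1)])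
         (use c0 \<psi>_cl[OF x(1)] \<psi>_cl[OF y(1)] in \<open>simp_all add: x(1) y(1) \<psi>_mult m_assoc z_z\<close>)
    finally show "\<psi> (x \<otimes>\<^bsub>Q ts\<^esub> y) \<otimes> c 0 =
      (if gdeg (Q ts) (x \<otimes>\<^bsub>Q ts\<^esub> y) = 1 then z \<otimes> (c 0 \<otimes> \<psi> (x \<otimes>\<^bsub>Q ts\<^esub> y)) else c 0 \<otimes> \<psi> (x \<otimes>\<^bsub>Q ts\<^esub> y))" .
  qed
  \<comment> \<open>Every element of \<open>Q1 t\<close> is Z^i a^j with a = (0, 1) and i, j in {0,
    1}; \<chi> replaces Z by \<open>z\<close> and a by \<open>c 0\<close>.\<close>
  define \<chi> :: "int \<times> int \<Rightarrow> 'c" where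
    "\<chi> x = (if fst x = 1 then z else \<one>) \<otimes> (if snd x = 1 then c 0 else \<one>)" for x
  have \<chi>_cl: "\<chi> x \<in> carrier M" for x using c0 by (simp add: \<chi>_def)
  have "\<forall>x\<in>carrier (Q1 t). \<forall>x'\<in>carrier (Q1 t). \<chi> (x \<otimes>\<^bsub>Q1 t\<^esub> x') = \<chi> x \<otimes> \<chi> x'"
    using c0 by (cases t) (simp_all add: Q1_simps(1-4) Q1_mult \<chi>_def z_square z_left[OF c0(1)] z_z m_assoc z_central[OF c0(1)])
  then have \<chi>_mult: "\<chi> (x \<otimes>\<^bsub>Q1 t\<^esub> x') = \<chi> x \<otimes> \<chi> x'" if "x \<in> carrier (Q1 t)" "x' \<in> carrier (Q1 t)" for x x'
    using that by blast
  have \<chi>_gelt: "\<chi> (gelt (Q1 t)) = z" by (simp add: \<chi>_def Q1_simps(1-4) Q1_mult)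
  have \<chi>\<psi>: "\<psi> y \<otimes> \<chi> x = (if gdeg (Q1 t) x * gdeg (Q ts) y = 1 then z \<otimes> (\<chi> x \<otimes> \<psi> y) else \<chi> x \<otimes> \<psi> y)"
    if "x \<in> carrier (Q1 t)" and y: "y \<in> carrier (Q ts)" for x y
  proof -
    have "x \<in> {(0, 0), (0, 1), (1, 0), (1, 1)}" using that(1) by (simp add: Q1_simps(1-4) Q1_mult)
    then show ?thesis using comm[OF y] \<psi>_cl[OF y] c0(1) z_central[OF \<psi>_cl[OF y]]
      by (auto simp: \<chi>_def Q1_simps(1-4) Q1_mult z_left[OF \<psi>_cl[OF y]] m_assoc)
  qed
  have "\<chi> (gelt (Q1 t) \<otimes>\<^bsub>Q1 t\<^esub> x) \<otimes> \<psi> (gelt (Q ts) \<otimes>\<^bsub>Q ts\<^esub> y) = \<chi> x \<otimes> \<psi> y"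
    if "x \<in> carrier (Q1 t)" "y \<in> carrier (Q ts)" for x y
    using that \<chi>_cl \<psi>_cl[OF that(2)] G1.gelt_closed G2.gelt_closed
    by (simp add: \<chi>_mult \<psi>_mult \<chi>_gelt \<psi> z_left[OF \<chi>_cl] m_assoc z_z)
  then obtain \<phi> where \<phi>: "\<And>x y. \<lbrakk>x \<in> carrier (Q1 t); y \<in> carrier (Q ts)\<rbrakk> \<Longrightarrow> \<phi> (q x y) = \<chi> x \<otimes> \<psi> y"
    by (rule q_lift[where \<beta> = "\<lambda>x y. \<chi> x \<otimes> \<psi> y"]) blast+
  have \<phi>_hom: "\<phi> \<in> hom (Q (t # ts)) M"
  proof (rule homI)
    show "\<phi> X \<in> carrier M" if "X \<in> carrier (Q (t # ts))" for X
      using that \<chi>_cl \<psi>_cl by (elim carrierE) (simp add: \<phi>)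
    fix X X' assume X: "X \<in> carrier (Q (t # ts))" and X': "X' \<in> carrier (Q (t # ts))"
    obtain x y where x: "x \<in> carrier (Q1 t)" "y \<in> carrier (Q ts)" "X = q x y" using X by (rule carrierE)
    obtain x' y' where x': "x' \<in> carrier (Q1 t)" "y' \<in> carrier (Q ts)" "X' = q x' y'" using X' by (rule carrierE)
    have "\<phi> X \<otimes> \<phi> X' = \<chi> x \<otimes> ((\<psi> y \<otimes> \<chi> x') \<otimes> \<psi> y')"
      using x x' \<chi>_cl \<psi>_cl by (simp add: \<phi> m_assoc)
    also have "\<dots> = \<chi> (G1.zmul (gdeg (Q1 t) x' * gdeg (Q ts) y) (x \<otimes>\<^bsub>Q1 t\<^esub> x')) \<otimes> \<psi> (y \<otimes>\<^bsub>Q ts\<^esub> y')"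
      unfolding \<chi>\<psi>[OF x'(1) x(2)]
      by (rule G1.gdeg_cases[OF x'(1)]; rule G2.gdeg_cases[OF x(2)])
         (use x x' \<chi>_cl \<psi>_cl G1.gelt_closed in
           \<open>simp_all add: \<psi>_mult \<chi>_mult \<chi>_gelt m_assoc z_left[OF \<chi>_cl] G1.zmul_odd\<close>)
    finally show "\<phi> (X \<otimes>\<^bsub>Q (t # ts)\<^esub> X') = \<phi> X \<otimes> \<phi> X'"
      using x x' by (simp add: q_mult_zmul \<phi>)
  qed
  have q: "(0, 0) \<in> carrier (Q1 t)" "(0, 1) \<in> carrier (Q1 t)" "(1, 0) \<in> carrier (Q1 t)"
    by (simp_all add: Q1_simps(1-4) Q1_mult)
  have "\<phi> \<one>\<^bsub>Q (t # ts)\<^esub> = \<one>" "\<phi> (gelt (Q (t # ts))) = z" "\<forall>i<length (t # ts). \<phi> (g' i) = c i"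
    using q c0 cS gc \<psi> by (auto simp: one_eq gelt_eq Q1_simps(1-4) Q1_mult \<phi> \<chi>_def g'_def less_Suc_eq_0_disj)
  then show ?thesis using \<phi>_hom by blast
qed

text \<open>The generators are chosen before the target monoid. Their degrees and the fact that they
  generate are part of the claim because extending a homomorphism from \<open>Q ts\<close> to
  \<open>Q (t # ts)\<close> uses both.\<close>

lemma Q_presentation:
  "\<exists>g. clifford_family (Q ts) (gelt (Q ts)) ts g \<and> (\<forall>i<length ts. gdeg (Q ts) (g i) = 1) \<and>
    generated_by (Q ts) (insert (gelt (Q ts)) (g ` {..<length ts})) \<and>
    (\<forall>(M :: ('c, 'x) monoid_scheme) z c. central_involution M z \<and> clifford_family M z ts c \<longrightarrow>
      (\<exists>\<phi>. \<phi> \<in> hom (Q ts) M \<and> \<phi> \<one>\<^bsub>Q ts\<^esub> = \<one>\<^bsub>M\<^esub> \<and> \<phi> (gelt (Q ts)) = z \<and> (\<forall>i<length ts. \<phi> (g i) = c i)))"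
proof (induction ts)
  case Nil
  have "\<exists>\<phi>. \<phi> \<in> hom (Q []) M \<and> \<phi> \<one>\<^bsub>Q []\<^esub> = \<one>\<^bsub>M\<^esub> \<and> \<phi> (gelt (Q [])) = z"
    if "central_involution M z" for M :: "('c, 'x) monoid_scheme" and z
  proof -
    interpret central_involution M z by fact
    have "(\<lambda>x. if x = Base (0, 0) then \<one>\<^bsub>M\<^esub> else z) \<in> hom (Q []) M"
      by (rule homI) (auto simp: Q_Nil_simps Z2_simps z_square)
    then show ?thesis
      by (intro exI[of _ "\<lambda>x. if x = Base (0, 0) then \<one>\<^bsub>M\<^esub> else z"]) (simp add: Q_Nil_simps)
  qed
  moreover have "generated_by (Q []) {gelt (Q [])}"
    by (auto simp: generated_by_def Q_Nil_simps)
  ultimately show ?case by (simp add: clifford_family_def)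
next
  case (Cons t ts)
  then obtain g where g: "clifford_family (Q ts) (gelt (Q ts)) ts g" "\<forall>i<length ts. gdeg (Q ts) (g i) = 1"
      "generated_by (Q ts) (insert (gelt (Q ts)) (g ` {..<length ts}))"
    and up: "\<And>(M :: ('c, 'x) monoid_scheme) z c. \<lbrakk>central_involution M z; clifford_family M z ts c\<rbrakk> \<Longrightarrow>
      (\<exists>\<phi>. \<phi> \<in> hom (Q ts) M \<and> \<phi> \<one>\<^bsub>Q ts\<^esub> = \<one>\<^bsub>M\<^esub> \<and> \<phi> (gelt (Q ts)) = z \<and> (\<forall>i<length ts. \<phi> (g i) = c i))"
    by blast
  obtain q where q: "graded_product_of (Q1 t) (Q ts) (Q (t # ts)) q" by (rule Q_Cons)
  define g' where "g' = (\<lambda>i. case i of 0 \<Rightarrow> q (0, 1) \<one>\<^bsub>Q ts\<^esub> | Suc i \<Rightarrow> q (0, 0) (g i))"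
  have "\<exists>\<phi>. \<phi> \<in> hom (Q (t # ts)) M \<and> \<phi> \<one>\<^bsub>Q (t # ts)\<^esub> = \<one>\<^bsub>M\<^esub> \<and> \<phi> (gelt (Q (t # ts))) = z \<and>
      (\<forall>i<length (t # ts). \<phi> (g' i) = c i)"
    if M: "central_involution M z" and c: "clifford_family M z (t # ts) c" for M :: "('c, 'x) monoid_scheme" and z c
  proof -
    have "clifford_family M z ts (\<lambda>i. c (Suc i))"
      unfolding clifford_family_def
    proof (intro conjI allI impI)
      fix i assume i: "i < length ts"
      then show "c (Suc i) \<in> carrier M" using clifford_familyD(1)[OF c] by simp
      show "c (Suc i) \<otimes>\<^bsub>M\<^esub> c (Suc i) = (case ts ! i of One \<Rightarrow> \<one>\<^bsub>M\<^esub> | Zed \<Rightarrow> z)"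
        using i clifford_familyD(2)[OF c, of "Suc i"] by simp
      show "c (Suc i) \<otimes>\<^bsub>M\<^esub> c (Suc j) = z \<otimes>\<^bsub>M\<^esub> (c (Suc j) \<otimes>\<^bsub>M\<^esub> c (Suc i))"
        if "j < length ts" "i \<noteq> j" for j
        by (rule clifford_familyD(3)[OF c]) (use that i in auto)
    qed
    then obtain \<psi> where "\<psi> \<in> hom (Q ts) M" "\<psi> \<one>\<^bsub>Q ts\<^esub> = \<one>\<^bsub>M\<^esub>" "\<psi> (gelt (Q ts)) = z" "\<forall>i<length ts. \<psi> (g i) = c (Suc i)"
      using up[OF M] by blast
    then show ?thesis unfolding g'_def by (rule central_involution.Q_Cons_hom[OF M q g c])
  qed
  moreover have "clifford_family (Q (t # ts)) (gelt (Q (t # ts))) (t # ts) g'"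
    "\<forall>i<length (t # ts). gdeg (Q (t # ts)) (g' i) = 1"
    unfolding g'_def by (rule clifford_family_Q_Cons[OF q g(1,2)])+
  moreover have "generated_by (Q (t # ts)) (insert (gelt (Q (t # ts))) (g' ` {..<length (t # ts)}))"
    unfolding g'_def by (rule generated_by_Q_Cons[OF q _ g(3)]) (rule clifford_familyD(1)[OF g(1)])
  ultimately show ?case by blast
qed

section \<open>The quotient of Q(t) by its grading element\<close>

lemma Q_to_power_set:
  "\<exists>\<pi>. \<pi> \<in> hom (Q ts) (power_set_group (length ts)) \<and> \<pi> ` carrier (Q ts) = Pow {1..length ts} \<and>
    (\<forall>x\<in>carrier (Q ts). \<forall>y\<in>carrier (Q ts). \<pi> x = \<pi> y \<longleftrightarrow> x = y \<or> x = gelt (Q ts) \<otimes>\<^bsub>Q ts\<^esub> y)"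
proof (induction ts)
  case Nil
  show ?case
    by (rule exI[of _ "\<lambda>_. {}"]) (auto simp: hom_def power_set_group_def Q_Nil_simps Z2_simps)
next
  case (Cons t ts)
  from Cons.IH obtain \<pi> where \<pi>12: "\<pi> \<in> hom (Q ts) (power_set_group (length ts))" "\<pi> ` carrier (Q ts) = Pow {1..length ts}"
    and \<pi>3: "\<forall>x\<in>carrier (Q ts). \<forall>y\<in>carrier (Q ts). \<pi> x = \<pi> y \<longleftrightarrow> x = y \<or> x = gelt (Q ts) \<otimes>\<^bsub>Q ts\<^esub> y"
    by (elim exE conjE)
  note \<pi> = \<pi>12 bspec[OF bspec[OF \<pi>3]]
  obtain q where "graded_product_of (Q1 t) (Q ts) (Q (t # ts)) q" by (rule Q_Cons)
  then interpret graded_product_of "Q1 t" "Q ts" "Q (t # ts)" q .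
  have \<pi>_cl: "\<pi> y \<subseteq> {1..length ts}" if "y \<in> carrier (Q ts)" for y using \<pi>(2) that by blast
  have \<pi>_mult: "\<pi> (y \<otimes>\<^bsub>Q ts\<^esub> y') = sym_diff (\<pi> y) (\<pi> y')" if "y \<in> carrier (Q ts)" "y' \<in> carrier (Q ts)" for y y'
    using \<pi>(1) that by (auto simp: hom_def power_set_group_def)
  have \<pi>_gelt: "\<pi> (gelt (Q ts) \<otimes>\<^bsub>Q ts\<^esub> y) = \<pi> y" if "y \<in> carrier (Q ts)" for y
    using \<pi>(3) that G2.gelt_closed by simp
  \<comment> \<open>An element of Q(t) goes to the set of positions whose generators occur in it.
    \<open>B\<close> records the first position as 1; the others are shifted by
    \<open>Suc\<close>.\<close>
  define B where "B x = (if snd x = 1 then {1 :: nat} else {})" for x :: "int \<times> int"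
  have "\<forall>x\<in>carrier (Q1 t). \<forall>x'\<in>carrier (Q1 t). B (x \<otimes>\<^bsub>Q1 t\<^esub> x') = sym_diff (B x) (B x')"
    "\<forall>x\<in>carrier (Q1 t). B (gelt (Q1 t) \<otimes>\<^bsub>Q1 t\<^esub> x) = B x"
    "\<forall>x\<in>carrier (Q1 t). \<forall>x'\<in>carrier (Q1 t). B x = B x' \<longleftrightarrow> x = x' \<or> x = gelt (Q1 t) \<otimes>\<^bsub>Q1 t\<^esub> x'"
    by (cases t; simp add: Q1_simps(1-4) Q1_mult B_def)+
  note B = bspec[OF bspec[OF this(1)]] bspec[OF this(2)] bspec[OF bspec[OF this(3)]]
  obtain \<rho> where \<rho>: "\<And>x y. \<lbrakk>x \<in> carrier (Q1 t); y \<in> carrier (Q ts)\<rbrakk> \<Longrightarrow> \<rho> (q x y) = B x \<union> Suc ` \<pi> y"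
    by (rule q_lift[where \<beta> = "\<lambda>x y. B x \<union> Suc ` \<pi> y"]) (auto simp: B(2) \<pi>_gelt)
  \<comment> \<open>A subset of \<open>{1..n + 1}\<close> splits uniquely into parts in \<open>{1}\<close> and in \<open>Suc ` {1..n}\<close>, and this
    is compatible with symmetric differences.\<close>
  have sym_diff_Un: "sym_diff A A' \<union> sym_diff C C' = sym_diff (A \<union> C) (A' \<union> C')"
    and Un_eq_iff: "A \<union> C = A' \<union> C' \<longleftrightarrow> A = A' \<and> C = C'"
    if "A \<subseteq> {1}" "A' \<subseteq> {1}" "C \<subseteq> {2..n}" "C' \<subseteq> {2..n}" for A A' C C' and n :: nat
  proof -
    have "A \<inter> C = {}" "A \<inter> C' = {}" "A' \<inter> C = {}" "A' \<inter> C' = {}" using that by force+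
    then show "sym_diff A A' \<union> sym_diff C C' = sym_diff (A \<union> C) (A' \<union> C')"
      "A \<union> C = A' \<union> C' \<longleftrightarrow> A = A' \<and> C = C'" by blast+
  qed
  have B_sub: "B x \<subseteq> {1}" for x by (simp add: B_def)
  have \<pi>_sub: "Suc ` \<pi> y \<subseteq> {2..Suc (length ts)}" if "y \<in> carrier (Q ts)" for y
    using \<pi>_cl[OF that] by auto
  have B_zmul: "B (G1.zmul k x) = B x" if "x \<in> carrier (Q1 t)" for k x
    using that by (cases "even k") (simp_all add: G1.zmul_even G1.zmul_odd B)
  have "\<rho> \<in> hom (Q (t # ts)) (power_set_group (length (t # ts)))"
  proof (rule homI)
    show "\<rho> X \<in> carrier (power_set_group (length (t # ts)))" if X: "X \<in> carrier (Q (t # ts))" for X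
    proof -
      obtain x y where x: "x \<in> carrier (Q1 t)" "y \<in> carrier (Q ts)" "X = q x y" using X by (rule carrierE)
      then show ?thesis using B_sub[of x] \<pi>_sub[of y] by (fastforce simp: \<rho> power_set_group_def)
    qed
    fix X X' assume X: "X \<in> carrier (Q (t # ts))" and X': "X' \<in> carrier (Q (t # ts))"
    obtain x y where x: "x \<in> carrier (Q1 t)" "y \<in> carrier (Q ts)" "X = q x y" using X by (rule carrierE)
    obtain x' y' where x': "x' \<in> carrier (Q1 t)" "y' \<in> carrier (Q ts)" "X' = q x' y'" using X' by (rule carrierE)
    have "\<rho> (X \<otimes>\<^bsub>Q (t # ts)\<^esub> X') = sym_diff (B x) (B x') \<union> sym_diff (Suc ` \<pi> y) (Suc ` \<pi> y')"
      using x x' by (simp add: q_mult_zmul \<rho> B_zmul B(1) \<pi>_mult image_Un image_set_diff)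
    also have "\<dots> = sym_diff (B x \<union> Suc ` \<pi> y) (B x' \<union> Suc ` \<pi> y')"
      by (rule sym_diff_Un[OF B_sub B_sub \<pi>_sub[OF x(2)] \<pi>_sub[OF x'(2)]])
    finally show "\<rho> (X \<otimes>\<^bsub>Q (t # ts)\<^esub> X') = \<rho> X \<otimes>\<^bsub>power_set_group (length (t # ts))\<^esub> \<rho> X'"
      using x x' by (simp add: \<rho> power_set_group_def)
  qed
  moreover have "\<rho> ` carrier (Q (t # ts)) = Pow {1..length (t # ts)}"
  proof
    show "\<rho> ` carrier (Q (t # ts)) \<subseteq> Pow {1..length (t # ts)}"
      using calculation by (auto simp: hom_def power_set_group_def)
    show "Pow {1..length (t # ts)} \<subseteq> \<rho> ` carrier (Q (t # ts))"
    proof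
      fix X assume X: "X \<in> Pow {1..length (t # ts)}"
      \<comment> \<open>The condition i \<noteq> 0 leaves out the element 1 = Suc 0 of X, which is
        accounted for by \<open>B x\<close>.\<close>
      define Y where "Y = {i. Suc i \<in> X \<and> i \<noteq> 0}"
      have "Y \<in> Pow {1..length ts}" using X by (auto simp: Y_def)
      then obtain y where y: "y \<in> carrier (Q ts)" "Y = \<pi> y" unfolding \<pi>(2)[symmetric] by blast
      define x :: "int \<times> int" where "x = (if 1 \<in> X then (0, 1) else (0, 0))"
      have x: "x \<in> carrier (Q1 t)" by (simp add: x_def Q1_simps(1-4) Q1_mult)
      have "X = B x \<union> Suc ` Y"
      proof (rule subset_antisym)
        show "X \<subseteq> B x \<union> Suc ` Y"
        proof
          fix i assume i: "i \<in> X"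
          then have "i \<in> {1..Suc (length ts)}" using X by auto
          then show "i \<in> B x \<union> Suc ` Y" using i by (cases i; cases "i = 1") (auto simp: B_def x_def Y_def)
        qed
      qed (auto simp: B_def x_def Y_def split: if_splits)
      then have "X = \<rho> (q x y)" using x y by (simp add: \<rho>)
      then show "X \<in> \<rho> ` carrier (Q (t # ts))" by (rule image_eqI[OF _ q_closed[OF x y(1)]])
    qed
  qed
  moreover have "\<rho> X = \<rho> X' \<longleftrightarrow> X = X' \<or> X = gelt (Q (t # ts)) \<otimes>\<^bsub>Q (t # ts)\<^esub> X'"
    if X: "X \<in> carrier (Q (t # ts))" and X': "X' \<in> carrier (Q (t # ts))" for X X'
  proof -
    obtain x y where x: "x \<in> carrier (Q1 t)" "y \<in> carrier (Q ts)" "X = q x y" using X by (rule carrierE)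
    obtain x' y' where x': "x' \<in> carrier (Q1 t)" "y' \<in> carrier (Q ts)" "X' = q x' y'" using X' by (rule carrierE)
    have "B x \<union> Suc ` \<pi> y = B x' \<union> Suc ` \<pi> y' \<longleftrightarrow> B x = B x' \<and> Suc ` \<pi> y = Suc ` \<pi> y'"
      by (rule Un_eq_iff[OF B_sub B_sub \<pi>_sub[OF x(2)] \<pi>_sub[OF x'(2)]])
    also have "\<dots> \<longleftrightarrow> (x = x' \<or> x = gelt (Q1 t) \<otimes>\<^bsub>Q1 t\<^esub> x') \<and> (y = y' \<or> y = gelt (Q ts) \<otimes>\<^bsub>Q ts\<^esub> y')"
      using x x' by (simp add: inj_image_eq_iff B(3) \<pi>(3))
    \<comment> \<open>Of the four combinations, those where x and y both agree or both change by Z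
      give X = X', and the two mixed ones give X = Z X'.\<close>
    also have "\<dots> \<longleftrightarrow> X = X' \<or> X = gelt (Q (t # ts)) \<otimes>\<^bsub>Q (t # ts)\<^esub> X'"
    proof -
      have Z: "gelt (Q (t # ts)) \<otimes>\<^bsub>Q (t # ts)\<^esub> X' = q (gelt (Q1 t) \<otimes>\<^bsub>Q1 t\<^esub> x') y'"
        using x' by (simp add: q_gelt)
      have "gelt (Q1 t) \<otimes>\<^bsub>Q1 t\<^esub> (gelt (Q1 t) \<otimes>\<^bsub>Q1 t\<^esub> a) = a" if "a \<in> carrier (Q1 t)" for a
        using that G1.gelt_closed by (simp add: G1.m_assoc[symmetric] G1.gelt_square)
      then have z1: "x' = gelt (Q1 t) \<otimes>\<^bsub>Q1 t\<^esub> x \<longleftrightarrow> x = gelt (Q1 t) \<otimes>\<^bsub>Q1 t\<^esub> x'"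
        "gelt (Q1 t) \<otimes>\<^bsub>Q1 t\<^esub> x' = gelt (Q1 t) \<otimes>\<^bsub>Q1 t\<^esub> x \<longleftrightarrow> x = x'"
        using x x' by metis+
      have "gelt (Q ts) \<otimes>\<^bsub>Q ts\<^esub> (gelt (Q ts) \<otimes>\<^bsub>Q ts\<^esub> a) = a" if "a \<in> carrier (Q ts)" for a
        using that G2.gelt_closed by (simp add: G2.m_assoc[symmetric] G2.gelt_square)
      then have z2: "y' = gelt (Q ts) \<otimes>\<^bsub>Q ts\<^esub> y \<longleftrightarrow> y = gelt (Q ts) \<otimes>\<^bsub>Q ts\<^esub> y'"
        using x x' by metis
      have "X = X' \<longleftrightarrow> x = x' \<and> y = y' \<or> x = gelt (Q1 t) \<otimes>\<^bsub>Q1 t\<^esub> x' \<and> y = gelt (Q ts) \<otimes>\<^bsub>Q ts\<^esub> y'"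
        unfolding x(3) x'(3) q_eq_iff[OF x(1) x'(1) x(2) x'(2)] z1(1) z2 by blast
      moreover have "X = q (gelt (Q1 t) \<otimes>\<^bsub>Q1 t\<^esub> x') y' \<longleftrightarrow>
          x = gelt (Q1 t) \<otimes>\<^bsub>Q1 t\<^esub> x' \<and> y = y' \<or> x = x' \<and> y = gelt (Q ts) \<otimes>\<^bsub>Q ts\<^esub> y'"
        unfolding x(3) q_eq_iff[OF x(1) G1.m_closed[OF G1.gelt_closed x'(1)] x(2) x'(2)]
          z1(2) z2 by blast
      ultimately show ?thesis unfolding Z by blast
    qed
    finally show ?thesis using x x' by (simp add: \<rho>)
  qed
  ultimately show ?case by blast
qed

section \<open>The algebras \<open>K[Q(t)]\<^sup>\<plusminus>\<close>\<close>

lemma algebra_isomorphicI: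
  assumes "h \<in> algebra_hom K A B" "\<And>y. y \<in> carrier B \<Longrightarrow> k y \<in> carrier A"
    "\<And>x. x \<in> carrier A \<Longrightarrow> k (h x) = x" "\<And>y. y \<in> carrier B \<Longrightarrow> h (k y) = y"
  shows "algebra_isomorphic K A B"
proof -
  have "h x \<in> carrier B" if "x \<in> carrier A" for x
    using assms(1) that by (auto simp: algebra_hom_def linear_map_def)
  then have "bij_betw h (carrier A) (carrier B)"
    using assms(2-) by (intro bij_betw_byWitness[where f' = k]) auto
  then show ?thesis using assms(1) by (auto simp: algebra_isomorphic_def)
qed

text \<open>The unit of the ideal is \<open>e \<one>\<close>, not the unit of K[G], so preservation
  of units is a separate condition on the restriction.\<close>

lemma (in sign_algebra) algebra_hom_restrict:
  assumes h: "h \<in> algebra_hom K A B" and one: "h (e \<one>\<^bsub>G\<^esub>) = \<one>\<^bsub>B\<^esub>"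
  shows "h \<in> algebra_hom K S B"
proof -
  have "h \<in> ring_hom S B"
    using h S_subset one by (auto simp: algebra_hom_def ring_hom_def S_simps one_S)
  then show ?thesis using h linear_map_restrict by (auto simp: algebra_hom_def)
qed

text \<open>Existence in the universal property of K[G]^s: homomorphisms from G to the
  multiplicative monoid of an algebra that send Z to the scalar s extend. In particular
  \<open>e \<one>\<close> goes to the unit, as the restriction requires.\<close>

lemma (in sign_algebra) lin_ext_algebra_hom_S:
  assumes B: "assoc_algebra K B" and \<phi>: "\<phi> \<in> hom G B" "\<phi> \<one>\<^bsub>G\<^esub> = \<one>\<^bsub>B\<^esub>" "\<phi> (gelt G) = s \<odot>\<^bsub>B\<^esub> \<one>\<^bsub>B\<^esub>"
  shows "lin_ext K B \<phi> \<in> algebra_hom K S B"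
    and "g \<in> carrier G \<Longrightarrow> lin_ext K B \<phi> (e g) = \<phi> g"
proof -
  interpret B: assoc_algebra K B by fact
  have \<phi>': "\<phi> \<in> carrier G \<rightarrow> carrier B" using \<phi>(1) by (simp add: hom_def)
  show val: "lin_ext K B \<phi> (e g) = \<phi> g" if "g \<in> carrier G" for g
  proof (rule lin_ext_e[OF B.module_axioms \<phi>' _ that])
    fix x assume x: "x \<in> carrier G"
    then have "\<phi> x \<in> carrier B" using \<phi>' by blast
    then show "\<phi> (gelt G \<otimes>\<^bsub>G\<^esub> x) = s \<odot>\<^bsub>B\<^esub> \<phi> x"
      using x G.gelt_closed \<phi> by (simp add: hom_mult B.smult_mult_left)
  qed
  have "lin_ext K B \<phi> \<in> algebra_hom K A B"
    by (rule lin_ext_algebra_hom[OF K.is_cring G.is_monoid B \<phi>']) (use \<phi> in \<open>simp_all add: hom_mult\<close>)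
  then show "lin_ext K B \<phi> \<in> algebra_hom K S B"
    by (rule algebra_hom_restrict) (simp add: val \<phi>(2))
qed

text \<open>Here \<open>H\<close> is G modulo Z, described by the fibres of \<pi>. For s = 1 the
  element \<open>e g\<close> depends only on \<pi> g, so the inverse may send the delta of x to
  \<open>e\<close> of an arbitrary preimage \<open>rep x\<close>.\<close>

lemma (in sign_algebra) plus_isomorphic_quotient:
  assumes s: "s = \<one>\<^bsub>K\<^esub>" and H: "monoid H"
    and \<pi>: "\<pi> \<in> hom G H" "\<pi> \<one>\<^bsub>G\<^esub> = \<one>\<^bsub>H\<^esub>" "\<pi> ` carrier G = carrier H"
    and fib: "\<And>x y. \<lbrakk>x \<in> carrier G; y \<in> carrier G\<rbrakk> \<Longrightarrow> \<pi> x = \<pi> y \<longleftrightarrow> x = y \<or> x = gelt G \<otimes>\<^bsub>G\<^esub> y"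
  shows "algebra_isomorphic K S (monoid_algebra K H)"
proof -
  let ?B = "monoid_algebra K H"
  have B: "assoc_algebra K ?B" by (rule monoid_algebra_assoc_algebra[OF K.is_cring H])
  interpret B: assoc_algebra K ?B by (rule B)
  note dB = delta_closed[OF K.is_cring H]
  have B_simps: "carrier ?B = carrier (free_module K (carrier H))"
    "linear_map K ?B M = linear_map K (free_module K (carrier H)) M" for M :: "('k, 'z, 'w) module_scheme"
    by (simp_all add: monoid_algebra_eq linear_map_update)
  define h where "h = lin_ext K ?B (\<lambda>g. delta K (\<pi> g))"
  have \<pi>_cl: "\<pi> g \<in> carrier H" if "g \<in> carrier G" for g using \<pi>(3) that by blast
  have oneB: "\<one>\<^bsub>?B\<^esub> = delta K \<one>\<^bsub>H\<^esub>" by (simp add: monoid_algebra_eq)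
  have \<pi>_gelt: "\<pi> (gelt G) = \<one>\<^bsub>H\<^esub>"
    using fib[of "gelt G" "\<one>\<^bsub>G\<^esub>"] G.gelt_closed \<pi>(2) by simp
  have hom: "(\<lambda>g. delta K (\<pi> g)) \<in> hom G ?B"
    by (rule homI) (simp_all add: dB \<pi>_cl hom_mult[OF \<pi>(1)] delta_mult[OF K.is_cring H])
  have gelt: "delta K (\<pi> (gelt G)) = s \<odot>\<^bsub>?B\<^esub> \<one>\<^bsub>?B\<^esub>"
    unfolding s \<pi>_gelt oneB[symmetric] by simp
  note h = lin_ext_algebra_hom_S[OF B hom _ gelt, folded h_def, unfolded \<pi>(2) oneB[symmetric], OF refl]
  have hl: "h \<in> linear_map K S ?B" using h(1) by (simp add: algebra_hom_def)
  define rep where "rep = inv_into (carrier G) \<pi>"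
  have rep: "rep x \<in> carrier G" "\<pi> (rep x) = x" if "x \<in> carrier H" for x
    using that \<pi>(3) by (auto simp: rep_def inv_into_into f_inv_into_f)
  define k where "k = lin_ext K S (\<lambda>x. e (rep x))"
  have e_rep: "(\<lambda>x. e (rep x)) \<in> carrier H \<rightarrow> carrier S" by (auto simp: rep)
  have k: "k \<in> linear_map K ?B S"
    unfolding k_def B_simps by (rule lin_ext_linear[OF S.module_axioms e_rep])
  have k_delta: "k (delta K x) = e (rep x)" if "x \<in> carrier H" for x
    unfolding k_def by (rule lin_ext_delta[OF S.module_axioms e_rep that])
  show ?thesis
  proof (rule algebra_isomorphicI[OF h(1)])
    show "k y \<in> carrier S" if "y \<in> carrier ?B" for y using linear_mapD(1)[OF k that] .
    show "k (h f) = f" if f: "f \<in> carrier S" for f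
    proof (rule S_eqI[OF S.module_axioms linear_map_comp[OF hl k] linear_map_id _ f])
      fix g assume g: "g \<in> carrier G"
      have "rep (\<pi> g) = g \<or> rep (\<pi> g) = gelt G \<otimes>\<^bsub>G\<^esub> g"
        using fib[OF rep(1) g] rep(2) \<pi>_cl[OF g] by blast
      then have "e (rep (\<pi> g)) = e g" using e_gelt_S[OF g] s S.smult_one[OF e_closed[OF g]] by auto
      then show "k (h (e g)) = e g" by (simp add: h(2) g k_delta \<pi>_cl)
    qed
    show "h (k y) = y" if y: "y \<in> carrier ?B" for y
    proof (rule linear_map_eqI[OF B.module_axioms, where X = "carrier H" and h = "\<lambda>y. h (k y)" and h' = "\<lambda>y. y"])
      show "(\<lambda>y. h (k y)) \<in> linear_map K (free_module K (carrier H)) ?B"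
        using linear_map_comp[OF k hl] by (simp add: B_simps)
      show "(\<lambda>y. y) \<in> linear_map K (free_module K (carrier H)) ?B"
        using linear_map_id[of K ?B] by (simp add: B_simps)
      show "h (k (delta K x)) = delta K x" if "x \<in> carrier H" for x
        using that by (simp add: k_delta h(2) rep)
    qed (use y in \<open>simp add: B_simps\<close>)
  qed
qed

lemma power_set_monoid: "monoid (power_set_group n)"
  unfolding power_set_group_def by (rule monoidI) (simp_all, blast+)

section \<open>Squares of combinations of anticommuting elements\<close>

lemma (in assoc_algebra) anticommute_finsum:
  assumes "finite I" "x \<in> carrier A" "\<And>i. i \<in> I \<Longrightarrow> d i \<in> carrier A" "\<And>i. i \<in> I \<Longrightarrow> d i \<otimes>\<^bsub>A\<^esub> x = \<ominus>\<^bsub>A\<^esub> (x \<otimes>\<^bsub>A\<^esub> d i)"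
  shows "(\<Oplus>\<^bsub>A\<^esub>i\<in>I. d i) \<otimes>\<^bsub>A\<^esub> x = \<ominus>\<^bsub>A\<^esub> (x \<otimes>\<^bsub>A\<^esub> (\<Oplus>\<^bsub>A\<^esub>i\<in>I. d i))"
  using assms
proof (induction I rule: finite_induct)
  case (insert i I)
  have d: "d \<in> I \<rightarrow> carrier A" "d i \<in> carrier A" using insert.prems by auto
  then show ?case
    using insert by (simp add: M.finsum_insert l_distr r_distr minus_add)
next
  case empty
  then show ?case by simp
qed

text \<open>The cross terms of the square cancel in pairs.\<close>

lemma (in assoc_algebra) anticommuting_square:
  assumes "finite I" "\<And>i. i \<in> I \<Longrightarrow> d i \<in> carrier A" "\<And>i. i \<in> I \<Longrightarrow> v i \<in> carrier K" "\<And>i. i \<in> I \<Longrightarrow> w i \<in> carrier K"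
    and sq: "\<And>i. i \<in> I \<Longrightarrow> d i \<otimes>\<^bsub>A\<^esub> d i = w i \<odot>\<^bsub>A\<^esub> \<one>\<^bsub>A\<^esub>"
    and anti: "\<And>i j. \<lbrakk>i \<in> I; j \<in> I; i \<noteq> j\<rbrakk> \<Longrightarrow> d i \<otimes>\<^bsub>A\<^esub> d j = \<ominus>\<^bsub>A\<^esub> (d j \<otimes>\<^bsub>A\<^esub> d i)"
  shows "(\<Oplus>\<^bsub>A\<^esub>i\<in>I. v i \<odot>\<^bsub>A\<^esub> d i) \<otimes>\<^bsub>A\<^esub> (\<Oplus>\<^bsub>A\<^esub>i\<in>I. v i \<odot>\<^bsub>A\<^esub> d i) = (\<Oplus>i\<in>I. w i \<otimes> (v i \<otimes> v i)) \<odot>\<^bsub>A\<^esub> \<one>\<^bsub>A\<^esub>"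
  using assms
proof (induction I rule: finite_induct)
  case (insert i I)
  let ?a = "v i \<odot>\<^bsub>A\<^esub> d i" and ?b = "\<Oplus>\<^bsub>A\<^esub>j\<in>I. v j \<odot>\<^bsub>A\<^esub> d j"
  have d: "d i \<in> carrier A" "\<And>j. j \<in> I \<Longrightarrow> d j \<in> carrier A"
    and v: "v i \<in> carrier K" "\<And>j. j \<in> I \<Longrightarrow> v j \<in> carrier K"
    and w: "w i \<in> carrier K" "\<And>j. j \<in> I \<Longrightarrow> w j \<in> carrier K"
    using insert.prems(1-3) by auto
  have cl: "?a \<in> carrier A" "?b \<in> carrier A" using d v by (auto intro!: M.finsum_closed)
  have IH: "?b \<otimes>\<^bsub>A\<^esub> ?b = (\<Oplus>j\<in>I. w j \<otimes> (v j \<otimes> v j)) \<odot>\<^bsub>A\<^esub> \<one>\<^bsub>A\<^esub>"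
    by (rule insert.IH[OF insert.prems(1)[OF insertI2] insert.prems(2)[OF insertI2]
          insert.prems(3)[OF insertI2] insert.prems(4)[OF insertI2] insert.prems(5)[OF insertI2 insertI2]])
  have ba: "?b \<otimes>\<^bsub>A\<^esub> ?a = \<ominus>\<^bsub>A\<^esub> (?a \<otimes>\<^bsub>A\<^esub> ?b)"
  proof (rule anticommute_finsum[OF insert.hyps(1) cl(1)])
    fix j assume j: "j \<in> I"
    then have "d j \<otimes>\<^bsub>A\<^esub> d i = \<ominus>\<^bsub>A\<^esub> (d i \<otimes>\<^bsub>A\<^esub> d j)" using insert.prems(5)[of j i] insert.hyps(2) by auto
    then show "v j \<odot>\<^bsub>A\<^esub> d j \<otimes>\<^bsub>A\<^esub> ?a = \<ominus>\<^bsub>A\<^esub> (?a \<otimes>\<^bsub>A\<^esub> (v j \<odot>\<^bsub>A\<^esub> d j))"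
      using j d v
      by (simp add: smult_mult_left smult_mult_right smult_r_minus smult_assoc1[symmetric] R.m_comm)
  qed (use d v in auto)
  have aa: "?a \<otimes>\<^bsub>A\<^esub> ?a = (w i \<otimes> (v i \<otimes> v i)) \<odot>\<^bsub>A\<^esub> \<one>\<^bsub>A\<^esub>"
    using d v w insert.prems(4)[of i]
    by (simp add: smult_mult_left smult_mult_right smult_assoc1[symmetric] R.m_ac)
  have "(?a \<oplus>\<^bsub>A\<^esub> ?b) \<otimes>\<^bsub>A\<^esub> (?a \<oplus>\<^bsub>A\<^esub> ?b) = (?a \<otimes>\<^bsub>A\<^esub> ?a \<oplus>\<^bsub>A\<^esub> (?a \<otimes>\<^bsub>A\<^esub> ?b \<oplus>\<^bsub>A\<^esub> ?b \<otimes>\<^bsub>A\<^esub> ?a)) \<oplus>\<^bsub>A\<^esub> ?b \<otimes>\<^bsub>A\<^esub> ?b"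
    using cl by (simp add: l_distr r_distr a_ac)
  also have "\<dots> = ((w i \<otimes> (v i \<otimes> v i)) \<oplus> (\<Oplus>j\<in>I. w j \<otimes> (v j \<otimes> v j))) \<odot>\<^bsub>A\<^esub> \<one>\<^bsub>A\<^esub>"
    unfolding ba IH aa using cl v w
    by (simp add: M.r_neg smult_l_distr)
  finally show ?case
    using insert.hyps d v w by (simp add: M.finsum_insert R.finsum_insert Pi_iff)
next
  case empty
  show ?case by simp
qed

section \<open>Comparison with the Clifford algebra\<close>

definition weight :: "('k, 'm) ring_scheme \<Rightarrow> one_or_Z \<Rightarrow> 'k" where
  "weight K t = (case t of One \<Rightarrow> \<one>\<^bsub>K\<^esub> | Zed \<Rightarrow> \<ominus>\<^bsub>K\<^esub> \<one>\<^bsub>K\<^esub>)"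

lemma Cl_t_eq:
  "Cl_t K t = clifford_algebra K (free_module K {1..length t}) (diagonal_form K (length t) (\<lambda>i. weight K (t ! (i - 1))))"
  by (simp add: Cl_t_def weight_def)

text \<open>The relations evaluate the form only at vectors of V. This matters for diagonal forms,
  whose sums can be compared only for vectors with entries in \<open>carrier K\<close>.\<close>

lemma clifford_algebra_cong:
  assumes "\<And>v. v \<in> carrier V \<Longrightarrow> q v = q' v"
  shows "clifford_algebra K V q = clifford_algebra K V q'"
proof -
  have "clifford_relations K V q = clifford_relations K V q'"
    unfolding clifford_relations_def Let_def Setcompr_eq_image
    by (intro arg_cong2[of _ _ _ _ "(\<union>)"] image_cong refl) (simp add: assms)
  then show ?thesis by (simp add: clifford_algebra_def)
qed

context sign_algebra
begin

text \<open>The universal property of G enters as the hypothesis \<open>up\<close>, asked only for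
  the Clifford algebra with -1 in the role of Z; this is the instance that yields a map from K[G]^-
  to the Clifford algebra.\<close>

lemma minus_isomorphic_clifford:
  assumes s: "s = \<ominus>\<^bsub>K\<^esub> \<one>\<^bsub>K\<^esub>"
    and g: "clifford_family G (gelt G) ts g" "generated_by G (insert (gelt G) (g ` {..<length ts}))"
    and up: "\<And>c. \<lbrakk>central_involution (Cl_t K ts) (\<ominus>\<^bsub>Cl_t K ts\<^esub> \<one>\<^bsub>Cl_t K ts\<^esub>);
        clifford_family (Cl_t K ts) (\<ominus>\<^bsub>Cl_t K ts\<^esub> \<one>\<^bsub>Cl_t K ts\<^esub>) ts c\<rbrakk> \<Longrightarrow>
      \<exists>\<phi>. \<phi> \<in> hom G (Cl_t K ts) \<and> \<phi> \<one>\<^bsub>G\<^esub> = \<one>\<^bsub>Cl_t K ts\<^esub> \<and> \<phi> (gelt G) = \<ominus>\<^bsub>Cl_t K ts\<^esub> \<one>\<^bsub>Cl_t K ts\<^esub> \<and>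
        (\<forall>i<length ts. \<phi> (g i) = c i)"
  shows "algebra_isomorphic K S (Cl_t K ts)"
proof -
  define n where "n = length ts"
  define V where "V = free_module K {1..n}"
  define w where "w = (\<lambda>i. weight K (ts ! (i - 1)))"
  define Qf where "Qf = diagonal_form K n w"
  let ?C = "Cl_t K ts"
  have C_eq: "?C = clifford_algebra K V Qf" by (simp add: Cl_t_eq V_def Qf_def w_def n_def)
  define j where "j = clifford_map K V Qf"
  have V: "module K V" unfolding V_def by (rule free_module_module[OF K.is_cring])
  interpret V: module K V by (rule V)
  have wK: "w i \<in> carrier K" for i by (simp add: w_def weight_def split: one_or_Z.split)
  have vK: "v i \<in> carrier K" if "v \<in> carrier V" for v i using that by (simp add: V_def free_carrier)
  have Qf: "Qf \<in> carrier V \<rightarrow> carrier K"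
    by (auto simp: Qf_def diagonal_form_def wK vK intro!: K.finsum_closed)
  have C: "assoc_algebra K ?C" and jl: "j \<in> linear_map K V ?C"
    and j_square: "\<And>v. v \<in> carrier V \<Longrightarrow> j v \<otimes>\<^bsub>?C\<^esub> j v = Qf v \<odot>\<^bsub>?C\<^esub> \<one>\<^bsub>?C\<^esub>"
    unfolding C_eq j_def using clifford_algebra_universal(1-3)[OF V Qf] by blast+
  note universal = clifford_algebra_universal(4)[OF V Qf, folded C_eq j_def]
  interpret C: assoc_algebra K ?C by (rule C)
  note jD = linear_mapD[OF jl]
  have dV: "delta K i \<in> carrier V" if "i \<in> {1..n}" for i
    unfolding V_def by (rule delta_free[OF K.is_cring that])
  have Qf_sum: "Qf v = (\<Oplus>\<^bsub>K\<^esub>i\<in>I. w i \<otimes>\<^bsub>K\<^esub> (v i \<otimes>\<^bsub>K\<^esub> v i))"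
    if "v \<in> carrier V" "I \<subseteq> {1..n}" "\<And>i. i \<notin> I \<Longrightarrow> v i = \<zero>\<^bsub>K\<^esub>" for v I
    unfolding Qf_def diagonal_form_def
    by (rule K.add.finprod_mono_neutral_cong_right) (use that wK vK[OF that(1)] in auto)
  have Qf_delta: "Qf (delta K i) = w i" if i: "i \<in> {1..n}" for i
    by (subst Qf_sum[of _ "{i}"]) (use i dV wK in \<open>auto simp: delta_def\<close>)
  have Qf_delta2: "Qf (delta K i \<oplus>\<^bsub>V\<^esub> delta K i') = w i \<oplus>\<^bsub>K\<^esub> w i'"
    if i: "i \<in> {1..n}" "i' \<in> {1..n}" "i \<noteq> i'" for i i'
    by (subst Qf_sum[of _ "{i, i'}"]) (use i dV V.M.a_closed[OF dV dV] wK in \<open>auto simp: delta_def V_def\<close>)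
  have one_neg: "(\<ominus>\<^bsub>K\<^esub> \<one>\<^bsub>K\<^esub>) \<odot>\<^bsub>?C\<^esub> x = \<ominus>\<^bsub>?C\<^esub> x" if "x \<in> carrier ?C" for x
    using that by (simp add: C.smult_l_minus)
  have inv: "central_involution ?C (\<ominus>\<^bsub>?C\<^esub> \<one>\<^bsub>?C\<^esub>)"
    by unfold_locales (simp_all add: C.l_minus C.r_minus)
  \<comment> \<open>Positions in \<open>ts\<close> start at 0 and coordinates at 1, so position i
    belongs to the basis vector with index \<open>Suc i\<close>.\<close>
  have fam: "clifford_family ?C (\<ominus>\<^bsub>?C\<^esub> \<one>\<^bsub>?C\<^esub>) ts (\<lambda>i. j (delta K (Suc i)))"
    unfolding clifford_family_def n_def[symmetric]
  proof (intro conjI allI impI)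
    fix i assume i: "i < n"
    then have i': "delta K (Suc i) \<in> carrier V" "Suc i \<in> {1..n}" using dV[of "Suc i"] by auto
    then show cl: "j (delta K (Suc i)) \<in> carrier ?C" by (simp add: jD)
    show "j (delta K (Suc i)) \<otimes>\<^bsub>?C\<^esub> j (delta K (Suc i)) = (case ts ! i of One \<Rightarrow> \<one>\<^bsub>?C\<^esub> | Zed \<Rightarrow> \<ominus>\<^bsub>?C\<^esub> \<one>\<^bsub>?C\<^esub>)"
      unfolding j_square[OF i'(1)] Qf_delta[OF i'(2)]
      by (simp add: w_def weight_def one_neg split: one_or_Z.split)
    fix k assume k: "k < n" "i \<noteq> k"
    then have k': "delta K (Suc k) \<in> carrier V" "Suc k \<in> {1..n}" using dV[of "Suc k"] by auto
    let ?a = "j (delta K (Suc i))" and ?b = "j (delta K (Suc k))"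
    have b: "?b \<in> carrier ?C" using k' by (simp add: jD)
    \<comment> \<open>Polarization: the diagonal form takes the value w(i + 1) + w(k + 1) on the sum
      of the two basis vectors, so the square of the sum is the sum of the squares and the mixed
      terms ab + ba vanish.\<close>
    have "(?a \<oplus>\<^bsub>?C\<^esub> ?b) \<otimes>\<^bsub>?C\<^esub> (?a \<oplus>\<^bsub>?C\<^esub> ?b) = (w (Suc i) \<oplus>\<^bsub>K\<^esub> w (Suc k)) \<odot>\<^bsub>?C\<^esub> \<one>\<^bsub>?C\<^esub>"
      using j_square[OF V.M.a_closed[OF i'(1) k'(1)]] Qf_delta2[OF i'(2) k'(2)] k
      unfolding jD(2)[OF i'(1) k'(1)] by simp
    also have "\<dots> = ?a \<otimes>\<^bsub>?C\<^esub> ?a \<oplus>\<^bsub>?C\<^esub> ?b \<otimes>\<^bsub>?C\<^esub> ?b"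
      unfolding j_square[OF i'(1)] Qf_delta[OF i'(2)] j_square[OF k'(1)] Qf_delta[OF k'(2)]
      by (rule C.smult_l_distr) (simp_all add: wK)
    finally have "(?a \<otimes>\<^bsub>?C\<^esub> ?a \<oplus>\<^bsub>?C\<^esub> ?b \<otimes>\<^bsub>?C\<^esub> ?b) \<oplus>\<^bsub>?C\<^esub> (?a \<otimes>\<^bsub>?C\<^esub> ?b \<oplus>\<^bsub>?C\<^esub> ?b \<otimes>\<^bsub>?C\<^esub> ?a)
        = ?a \<otimes>\<^bsub>?C\<^esub> ?a \<oplus>\<^bsub>?C\<^esub> ?b \<otimes>\<^bsub>?C\<^esub> ?b"
      using cl b by (simp add: C.l_distr C.r_distr C.a_ac)
    then have "?a \<otimes>\<^bsub>?C\<^esub> ?b \<oplus>\<^bsub>?C\<^esub> ?b \<otimes>\<^bsub>?C\<^esub> ?a = \<zero>\<^bsub>?C\<^esub>"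
      by (rule C.add.l_cancel_one[THEN iffD1, rotated -1]) (use cl b in auto)
    then have "?a \<otimes>\<^bsub>?C\<^esub> ?b = \<ominus>\<^bsub>?C\<^esub> (?b \<otimes>\<^bsub>?C\<^esub> ?a)"
      using C.minus_equality[of "?a \<otimes>\<^bsub>?C\<^esub> ?b" "?b \<otimes>\<^bsub>?C\<^esub> ?a"] cl b by simp
    then show "?a \<otimes>\<^bsub>?C\<^esub> ?b = \<ominus>\<^bsub>?C\<^esub> \<one>\<^bsub>?C\<^esub> \<otimes>\<^bsub>?C\<^esub> (?b \<otimes>\<^bsub>?C\<^esub> ?a)"
      using cl b by (simp add: C.l_minus)
  qed
  obtain \<phi> where \<phi>: "\<phi> \<in> hom G ?C" "\<phi> \<one>\<^bsub>G\<^esub> = \<one>\<^bsub>?C\<^esub>" "\<phi> (gelt G) = \<ominus>\<^bsub>?C\<^esub> \<one>\<^bsub>?C\<^esub>"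
    "\<forall>i<length ts. \<phi> (g i) = j (delta K (Suc i))"
    using up[OF inv fam] by blast
  define k where "k = lin_ext K ?C \<phi>"
  note k = lin_ext_algebra_hom_S[OF C \<phi>(1,2), folded k_def]
  have \<phi>_gelt: "\<phi> (gelt G) = s \<odot>\<^bsub>?C\<^esub> \<one>\<^bsub>?C\<^esub>" by (simp add: \<phi>(3) s one_neg)
  note k = k[OF \<phi>_gelt]
  have neg_S: "s \<odot>\<^bsub>S\<^esub> x = \<ominus>\<^bsub>S\<^esub> x" if "x \<in> carrier S" for x
    using that S.smult_l_minus[OF K.one_closed that] by (simp add: s[symmetric])
  have gc: "g i \<in> carrier G" if "i < n" for i using clifford_familyD(1)[OF g(1)] that by (simp add: n_def)
  \<comment> \<open>The candidates for the images of the basis vectors; the shift by 1 undoes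
    \<open>Suc\<close>.\<close>
  define d where "d i = e (g (i - 1))" for i
  have d_cl: "d i \<in> carrier S" if "i \<in> {1..n}" for i using that gc by (auto simp: d_def)
  have d_fun: "d \<in> {1..n} \<rightarrow> carrier S" using d_cl by blast
  have e_one: "e (gelt G) = s \<odot>\<^bsub>S\<^esub> \<one>\<^bsub>S\<^esub>"
    using e_gelt_S[of "\<one>\<^bsub>G\<^esub>"] G.gelt_closed by (simp add: one_S)
  have d_square: "d i \<otimes>\<^bsub>S\<^esub> d i = w i \<odot>\<^bsub>S\<^esub> \<one>\<^bsub>S\<^esub>" if i: "i \<in> {1..n}" for i
  proof -
    have i': "i - 1 < length ts" using i by (auto simp: n_def)
    have "d i \<otimes>\<^bsub>S\<^esub> d i = e (case ts ! (i - 1) of One \<Rightarrow> \<one>\<^bsub>G\<^esub> | Zed \<Rightarrow> gelt G)"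
      using clifford_familyD(1,2)[OF g(1) i'] by (simp add: d_def)
    then show ?thesis by (simp add: w_def weight_def one_S[symmetric] e_one s[symmetric] split: one_or_Z.split)
  qed
  have d_anti: "d i \<otimes>\<^bsub>S\<^esub> d i' = \<ominus>\<^bsub>S\<^esub> (d i' \<otimes>\<^bsub>S\<^esub> d i)" if i: "i \<in> {1..n}" "i' \<in> {1..n}" "i \<noteq> i'" for i i'
  proof -
    have i': "i - 1 < length ts" "i' - 1 < length ts" "i - 1 \<noteq> i' - 1" using i by (auto simp: n_def)
    have cl: "g (i - 1) \<in> carrier G" "g (i' - 1) \<in> carrier G" using clifford_familyD(1)[OF g(1)] i' by auto
    have "d i \<otimes>\<^bsub>S\<^esub> d i' = e (gelt G \<otimes>\<^bsub>G\<^esub> (g (i' - 1) \<otimes>\<^bsub>G\<^esub> g (i - 1)))"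
      unfolding d_def clifford_familyD(3)[OF g(1) i', symmetric] by (rule e_mult_S[OF cl])
    then show ?thesis using cl by (simp add: e_gelt_S neg_S d_def)
  qed
  define f where "f = lin_ext K S d"
  have f: "f \<in> linear_map K V S" unfolding f_def V_def by (rule lin_ext_linear[OF S.module_axioms d_fun])
  have f_delta: "f (delta K i) = d i" if "i \<in> {1..n}" for i
    unfolding f_def by (rule lin_ext_delta[OF S.module_axioms d_fun that])
  have f_square: "f v \<otimes>\<^bsub>S\<^esub> f v = Qf v \<odot>\<^bsub>S\<^esub> \<one>\<^bsub>S\<^esub>" if v: "v \<in> carrier V" for v
  proof -
    have "f v = (\<Oplus>\<^bsub>S\<^esub>i\<in>{1..n}. v i \<odot>\<^bsub>S\<^esub> d i)"
      unfolding f_def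
      by (rule lin_ext_eq[OF S.module_axioms _ d_fun]) (use v in \<open>auto simp: V_def free_carrier\<close>)
    then show ?thesis
      unfolding Qf_def diagonal_form_def
      using S.anticommuting_square[OF finite_atLeastAtMost d_cl vK[OF v] wK d_square d_anti] by simp
  qed
  obtain h where h: "h \<in> algebra_hom K ?C S" "\<And>v. v \<in> carrier V \<Longrightarrow> h (j v) = f v"
    using universal[OF S_assoc_algebra f f_square] by blast
  have hr: "h \<in> ring_hom ?C S" and hl: "h \<in> linear_map K ?C S"
    and kr: "k \<in> ring_hom S ?C" and kl: "k \<in> linear_map K S ?C"
    using h(1) k(1) by (simp_all add: algebra_hom_def)
  \<comment> \<open>Both sides are multiplicative in x, so it is enough to check Z and the
    generators. Together with the values of \<open>k\<close> this gives h (k (e x)) = e x, hence one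
    half of the inverse property.\<close>
  have h_\<phi>: "h (\<phi> x) = e x" if x: "x \<in> carrier G" for x
    using g(2) x
  proof (rule generated_by_induct)
    show "h (\<phi> \<one>\<^bsub>G\<^esub>) = e \<one>\<^bsub>G\<^esub>" using ring_hom_one[OF hr] by (simp add: \<phi>(2) one_S)
    show "h (\<phi> x) = e x" if "x \<in> insert (gelt G) (g ` {..<length ts})" for x
      using that
    proof
      assume "x = gelt G"
      then show ?thesis
        using linear_mapD(3)[OF hl s_closed C.one_closed] ring_hom_one[OF hr] by (simp add: \<phi>_gelt e_one)
    next
      assume "x \<in> g ` {..<length ts}"
      then obtain i where i: "i < n" "x = g i" by (auto simp: n_def)
      then show ?thesis using \<phi>(4) h(2)[OF dV, of "Suc i"] f_delta[of "Suc i"] by (simp add: n_def d_def)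
    qed
    show "h (\<phi> (x \<otimes>\<^bsub>G\<^esub> y)) = e (x \<otimes>\<^bsub>G\<^esub> y)"
      if "x \<in> carrier G" "y \<in> carrier G" "h (\<phi> x) = e x" "h (\<phi> y) = e y" for x y
      using that \<phi>(1) by (simp add: hom_mult ring_hom_mult[OF hr] hom_in_carrier)
  qed
  have kh: "k (h x) = x" if x: "x \<in> carrier ?C" for x
  proof -
    \<comment> \<open>The composite of \<open>h\<close> and \<open>k\<close> and the identity both
      extend \<open>j\<close>; uniqueness in the universal property, with the Clifford algebra
      itself as target, makes them equal.\<close>
    have jj: "\<exists>h\<in>algebra_hom K ?C ?C. (\<forall>v\<in>carrier V. h (j v) = j v) \<and>
        (\<forall>h'\<in>algebra_hom K ?C ?C. (\<forall>v\<in>carrier V. h' (j v) = j v) \<longrightarrow> (\<forall>x\<in>carrier ?C. h' x = h x))"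
      by (rule universal[OF C jl j_square])
    have id: "(\<lambda>x. x) \<in> algebra_hom K ?C ?C"
      by (auto simp: algebra_hom_def ring_hom_def linear_map_id)
    have comp: "(\<lambda>x. k (h x)) \<in> algebra_hom K ?C ?C"
    proof -
      have "(\<lambda>x. k (h x)) \<in> ring_hom ?C ?C"
        using ring_hom_trans[OF hr kr] by (simp add: o_def)
      then show ?thesis using linear_map_comp[OF hl kl] by (simp add: algebra_hom_def)
    qed
    have "k (h (j v)) = j v" if v: "v \<in> carrier V" for v
    proof -
      have "k (f v) = j v"
      proof (rule linear_map_eqI[OF C.module_axioms, where X = "{1..n}" and h = "\<lambda>v. k (f v)" and h' = j])
        show "(\<lambda>v. k (f v)) \<in> linear_map K (free_module K {1..n}) ?C"
          using linear_map_comp[OF f kl] by (simp add: V_def)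
        show "j \<in> linear_map K (free_module K {1..n}) ?C" using jl by (simp add: V_def)
        show "v \<in> carrier (free_module K {1..n})" using v by (simp add: V_def)
        fix i assume i: "i \<in> {1..n}"
        then have "i - 1 < n" "Suc (i - 1) = i" by auto
        then show "k (f (delta K i)) = j (delta K i)"
          using f_delta[OF i] \<phi>(4) gc[of "i - 1"] by (simp add: d_def k(2) n_def)
      qed
      then show ?thesis using h(2)[OF v] by simp
    qed
    then show ?thesis using jj id comp x by metis
  qed
  show ?thesis
  proof (rule algebra_isomorphicI[OF k(1)])
    show "h y \<in> carrier S" if "y \<in> carrier ?C" for y using linear_mapD(1)[OF hl that] .
    show "h (k x) = x" if x: "x \<in> carrier S" for x
      by (rule S_eqI[OF S.module_axioms linear_map_comp[OF kl hl] linear_map_id _ x]) (simp add: k(2) h_\<phi>)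
  qed (rule kh)
qed

end

theorem group_algebra_Q:
  assumes K: "cring K" "\<one>\<^bsub>K\<^esub> \<oplus>\<^bsub>K\<^esub> \<one>\<^bsub>K\<^esub> \<in> Units K"
  shows "algebra_isomorphic K (group_algebra_plus K (Q t)) (monoid_algebra K (power_set_group (length t)))"
    and "algebra_isomorphic K (group_algebra_minus K (Q t)) (Cl_t K t)"
proof -
  interpret K: cring K by fact
  interpret G: centrally_graded_group "Q t" by (rule Q_centrally_graded_group)
  interpret plus: sign_algebra K "Q t" "\<one>\<^bsub>K\<^esub>"
    by (intro sign_algebra.intro sign_algebra_axioms.intro K G.centrally_graded_group_axioms) simp_all
  interpret minus: sign_algebra K "Q t" "\<ominus>\<^bsub>K\<^esub> \<one>\<^bsub>K\<^esub>"
    by (intro sign_algebra.intro sign_algebra_axioms.intro K G.centrally_graded_group_axioms)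
       (simp_all add: K.l_minus)
  obtain \<pi> where \<pi>: "\<pi> \<in> hom (Q t) (power_set_group (length t))" "\<pi> ` carrier (Q t) = Pow {1..length t}"
    and fib: "\<forall>x\<in>carrier (Q t). \<forall>y\<in>carrier (Q t). \<pi> x = \<pi> y \<longleftrightarrow> x = y \<or> x = gelt (Q t) \<otimes>\<^bsub>Q t\<^esub> y"
    using Q_to_power_set[of t] by (elim exE conjE)
  show "algebra_isomorphic K (group_algebra_plus K (Q t)) (monoid_algebra K (power_set_group (length t)))"
  proof (rule plus.plus_isomorphic_quotient[OF refl power_set_monoid \<pi>(1)])
    \<comment> \<open>Membership in \<open>hom\<close> says nothing about units, but the image of
      the unit is its own symmetric difference with itself, hence empty.\<close>
    have "\<pi> \<one>\<^bsub>Q t\<^esub> = sym_diff (\<pi> \<one>\<^bsub>Q t\<^esub>) (\<pi> \<one>\<^bsub>Q t\<^esub>)"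
      using hom_mult[OF \<pi>(1) G.one_closed G.one_closed] by (simp add: power_set_group_def)
    then show "\<pi> \<one>\<^bsub>Q t\<^esub> = \<one>\<^bsub>power_set_group (length t)\<^esub>" by (simp add: power_set_group_def)
    show "\<pi> ` carrier (Q t) = carrier (power_set_group (length t))"
      using \<pi>(2) by (simp add: power_set_group_def)
  qed (rule bspec[OF bspec[OF fib]])
  obtain g where g: "clifford_family (Q t) (gelt (Q t)) t g"
    "generated_by (Q t) (insert (gelt (Q t)) (g ` {..<length t}))"
    "\<forall>z c. central_involution (Cl_t K t) z \<and> clifford_family (Cl_t K t) z t c \<longrightarrow>
      (\<exists>\<phi>. \<phi> \<in> hom (Q t) (Cl_t K t) \<and> \<phi> \<one>\<^bsub>Q t\<^esub> = \<one>\<^bsub>Cl_t K t\<^esub> \<and> \<phi> (gelt (Q t)) = z \<and> (\<forall>i<length t. \<phi> (g i) = c i))"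
    using Q_presentation[of t] by (elim exE conjE) (rule that, assumption, assumption, erule spec)
  show "algebra_isomorphic K (group_algebra_minus K (Q t)) (Cl_t K t)"
    by (rule minus.minus_isomorphic_clifford[OF refl g(1,2)]) (rule g(3)[rule_format, OF conjI])
qed

text \<open>The coefficients match because, for i \<ge> 1, the list position i - 1 lies among the
  first p entries exactly when i \<le> p.\<close>

lemma Cl_pq_eq:
  assumes K: "cring K"
  shows "Cl_pq K p q = Cl_t K (replicate p One @ replicate q Zed)"
  unfolding Cl_pq_def Cl_t_eq length_append length_replicate
proof (rule clifford_algebra_cong)
  interpret K: cring K by fact
  fix v assume v: "v \<in> carrier (free_module K {1..p + q})"
  show "diagonal_form K (p + q) (\<lambda>i. if i \<le> p then \<one>\<^bsub>K\<^esub> else \<ominus>\<^bsub>K\<^esub> \<one>\<^bsub>K\<^esub>) v =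
      diagonal_form K (p + q) (\<lambda>i. weight K ((replicate p One @ replicate q Zed) ! (i - 1))) v"
    unfolding diagonal_form_def
    by (rule K.finsum_cong')
       (use v in \<open>auto simp: weight_def nth_append free_carrier split: one_or_Z.split\<close>)
qed

theorem theorem4p2:
  fixes K :: "('k, 'm) ring_scheme"
  assumes "cring K" and "\<one>\<^bsub>K\<^esub> \<oplus>\<^bsub>K\<^esub> \<one>\<^bsub>K\<^esub> \<in> Units K"
  shows "(\<forall>(G1 :: ('a, 'x) graded_group_scheme) (G2 :: ('b, 'y) graded_group_scheme).
            centrally_graded_group G1 \<and> centrally_graded_group G2 \<and>
            gelt G1 \<noteq> \<one>\<^bsub>G1\<^esub> \<and> gelt G2 \<noteq> \<one>\<^bsub>G2\<^esub> \<longrightarrow>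
            algebra_isomorphic K (group_algebra_plus K (graded_product G1 G2))
              (tensor_algebra K (group_algebra_plus K G1) (group_algebra_plus K G2)) \<and>
            algebra_isomorphic K (group_algebra_minus K (graded_product G1 G2))
              (graded_tensor_algebra K
                 (group_algebra_minus K G1) (group_algebra_minus_part K G1)
                 (group_algebra_minus K G2) (group_algebra_minus_part K G2)))
       \<and> (\<forall>t. algebra_isomorphic K (group_algebra_plus K (Q t))
                (monoid_algebra K (power_set_group (length t))) \<and>
              algebra_isomorphic K (group_algebra_minus K (Q t)) (Cl_t K t))
       \<and> (\<forall>p q. algebra_isomorphic K (group_algebra_minus K (Qpq p q)) (Cl_pq K p q))"
proof (intro conjI allI impI)
  fix G1 :: "('a, 'x) graded_group_scheme" and G2 :: "('b, 'y) graded_group_scheme"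
  assume "centrally_graded_group G1 \<and> centrally_graded_group G2 \<and> gelt G1 \<noteq> \<one>\<^bsub>G1\<^esub> \<and> gelt G2 \<noteq> \<one>\<^bsub>G2\<^esub>"
  then have G: "centrally_graded_group G1" "centrally_graded_group G2" "gelt G1 \<noteq> \<one>\<^bsub>G1\<^esub>" "gelt G2 \<noteq> \<one>\<^bsub>G2\<^esub>"
    by auto
  show "algebra_isomorphic K (group_algebra_plus K (graded_product G1 G2))
      (tensor_algebra K (group_algebra_plus K G1) (group_algebra_plus K G2))"
    by (rule group_algebra_graded_product(1)[OF assms G])
  show "algebra_isomorphic K (group_algebra_minus K (graded_product G1 G2))
      (graded_tensor_algebra K
         (group_algebra_minus K G1) (group_algebra_minus_part K G1)
         (group_algebra_minus K G2) (group_algebra_minus_part K G2))"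
    by (rule group_algebra_graded_product(2)[OF assms G])
next
  fix t
  show "algebra_isomorphic K (group_algebra_plus K (Q t)) (monoid_algebra K (power_set_group (length t)))"
    by (rule group_algebra_Q(1)[OF assms])
  show "algebra_isomorphic K (group_algebra_minus K (Q t)) (Cl_t K t)"
    by (rule group_algebra_Q(2)[OF assms])
next
  fix p q
  show "algebra_isomorphic K (group_algebra_minus K (Qpq p q)) (Cl_pq K p q)"
    unfolding Qpq_def Cl_pq_eq[OF assms(1)] by (rule group_algebra_Q(2)[OF assms])
qed

end
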